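(* Let $(\alpha(i))_{i\in\mathbb{Z}}$ be independent and identically distributed positive random variables whose common law is not a point mass, and let $r=\inf\{s:\mathbb{P}[\alpha(i)\geq s]<1\}$ be the essential infimum of this law; assume $r>0$. Let $f$ be the flux function of TASEP with disorder $\alpha$ (defined in the context), and set $\mu=\frac{1}{r}-\mathbb{E}\!\left[\frac{1}{\alpha(i)}\right]$. Then for all $\rho\in\left[\frac12-\frac14\mu r,\ \frac12+\frac14\mu r\right]$, \[ f(\rho)=\frac{r}{4}. \]
   Context: TASEP with disorder $\alpha$: configurations are elements of $\{0,1\}^{\mathbb{Z}}$ (indicators of particles at sites). If site $i$ is occupied and site $i+1$ is empty, the particle at $i$ jumps to $i+1$ according to a Poisson clock of rate $\alpha(i)$, independently over bonds. The flux $f(\rho)$ is the long-run rate at which particles cross a bond at macroscopic density $\rho\in[0,1]$; it is given by the following last-passage percolation formula. Let $\mathcal{W}=\{(i,j)\in\mathbb{Z}^2: j\geq 0,\ i+j\geq 0\}$ and, given the disorder, let $Y_{ij}$, $(i,j)\in\mathcal{W}$, be independent exponential random variables with rate $\alpha(i)$. A path from $x$ to $y$ in $\mathcal{W}$ is a sequence of vertices $x=(i_0,j_0),\dots,(i_k,j_k)=y$ in $\mathcal{W}$ with $(i_\ell-i_{\ell-1},j_\ell-j_{\ell-1})\in\{(1,0),(-1,1)\}$. Let $\Gamma_{i,j}$ be the set of paths from $(0,0)$ to $(i,j)$ and $T(i,j)=\max_{\gamma\in\Gamma_{i,j}}\sum_{(i',j')\in\gamma}Y_{i'j'}$. For $(x,y)$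 with $y\ge 0$, $x+y\ge 0$, $\tau(x,y)=\lim_{n\to\infty}\frac1n T(\lfloor xn\rfloor,\lfloor yn\rfloor)$, which exists almost surely and is deterministic. Set $h(t,x)=\inf\{y\ge 0:\tau(x,y)>t\}$, which satisfies $h(t,x)=t\,k(x/t)$ for a function $k$, and $f(\rho)=\inf_{v\in\mathbb{R}}[k(v)+v\rho]$. *)

theory Defs
  imports "HOL-Probability.Probability"
begin

definition disorder :: "real measure \<Rightarrow> (int \<Rightarrow> real) measure" where
  "disorder L = PiM (UNIV :: int set) (\<lambda>_. L)"

text \<open>Given the disorder, independent exponential weights Y(i,j) with rate alpha(i).
(Weights are indexed by all of Z x Z; only those in the wedge W are used.)\<close>
definition lpp_env :: "(int \<Rightarrow> real) \<Rightarrow> (int \<times> int \<Rightarrow> real) measure" where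
  "lpp_env \<alpha> = PiM (UNIV :: (int \<times> int) set) (\<lambda>ij. density lborel (exponential_density (\<alpha> (fst ij))))"

definition lpp_W :: "(int \<times> int) set" where
  "lpp_W = {(i, j). 0 \<le> j \<and> 0 \<le> i + j}"

definition lpp_paths :: "int \<Rightarrow> int \<Rightarrow> (int \<times> int) list set" where
  "lpp_paths i j = {p. p \<noteq> [] \<and> hd p = (0, 0) \<and> last p = (i, j) \<and> set p \<subseteq> lpp_W \<and>
      (\<forall>k. Suc k < length p \<longrightarrow>
         (fst (p ! Suc k) - fst (p ! k), snd (p ! Suc k) - snd (p ! k)) \<in> {(1, 0), (-1, 1)})}"

definition lpp_T :: "(int \<times> int \<Rightarrow> real) \<Rightarrow> int \<Rightarrow> int \<Rightarrow> real" where
  "lpp_T Y i j = Max ((\<lambda>p. sum_list (map Y p)) ` lpp_paths i j)"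

definition lpp_tau :: "real measure \<Rightarrow> real \<Rightarrow> real \<Rightarrow> real" where
  "lpp_tau L x y = (THE c. AE \<alpha> in disorder L. AE Y in lpp_env \<alpha>.
      (\<lambda>n::nat. lpp_T Y \<lfloor>x * real n\<rfloor> \<lfloor>y * real n\<rfloor> / real n) \<longlonglongrightarrow> c)"

definition lpp_h :: "real measure \<Rightarrow> real \<Rightarrow> real \<Rightarrow> real" where
  "lpp_h L t x = Inf {y. 0 \<le> y \<and> 0 < x + y \<and> t < lpp_tau L x y}"

text \<open>k with h(t,x) = t k(x/t), i.e. k(v) = h(1,v).\<close>
definition lpp_k :: "real measure \<Rightarrow> real \<Rightarrow> real" where
  "lpp_k L v = lpp_h L 1 v"

definition flux :: "real measure \<Rightarrow> real \<Rightarrow> real" where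
  "flux L \<rho> = (INF v. lpp_k L v + v * \<rho>)"

definition law_ess_inf :: "real measure \<Rightarrow> real" where
  "law_ess_inf L = Inf {s. measure L {x. s \<le> x} < 1}"

end

theory Submission
  imports Defs
begin

text \<open>In the coordinates \<open>(a, b) = (i + j, j)\<close> the model is directed last-passage percolation in a quadrant
whose weights in column \<open>i = a - b\<close> have rate \<open>\<alpha>(i) \<ge> r\<close>.

Upper bound on the passage time: an exponential variable of rate \<open>r\<close> is the sum of one of rate \<open>\<alpha>\<close> and an
independent nonnegative \<open>Z\<close> of mean \<open>1/r - 1/\<alpha>\<close>. Averaging over the \<open>Z\<close>'s first (Jensen) shows that the
homogeneous passage time of rate \<open>r\<close>, which is at most \<open>2(a + b)/r\<close>, exceeds the disordered one by the sum of
\<open>1/r - 1/\<alpha>(i)\<close> over the columns that every path has to cross. Hence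
\<open>\<tau>(x, y) \<le> (4y + 2x)/r - \<mu>|x|\<close>, which gives \<open>k(v) + v\<rho> \<ge> r/4\<close> for \<open>\<rho>\<close> in the stated interval.

Lower bound: with positive probability all rates near the origin are close to \<open>r\<close>, and zigzagging through these
columns takes nearly \<open>4y/r\<close>, so \<open>\<tau>(0, y) \<ge> 4y/r\<close> and \<open>k(0) \<le> r/4\<close>.

The two homogeneous estimates come from the stationary model (Burke's theorem): its increments along a row are
i.i.d., so its passage times concentrate, and comparing the parameters \<open>1/2\<close> and \<open>1/2 \<plusminus> d\<close> shows that its
geodesics leave the axes early. The time constant exists by a superadditive ergodic theorem; its lower half uses
that blocks in far apart columns are independent, which is why directions with \<open>a = b\<close> are only reached by
monotone approximation.\<close>

subsection \<open>Last-passage percolation in a quadrant\<close>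

text \<open>The plateau exists because a first order gain beats a second order loss. At rate
  \<open>r\<close> the known time constant is (sqrt a + sqrt b)^2 / r; the bound 2(a + b)/r is its
  tangent at a = b and exceeds it by (sqrt a - sqrt b)^2 / r only, while disorder saves a multiple
  of |a - b|. Hence the stationary parameter 1/2 alone serves for every upper bound, and a lower
  bound is wanted only at a = b. The obstacle lies there too. Rates are constant along columns, so a
  translation along a = b leaves the disorder untouched and mixes nothing, although exactly this
  direction fixes the value r/4. As \<open>lpp_tau\<close> is a definite description, a
  deterministic limit has to be established on the diagonal as well. Once it is known to be
  deterministic, an event of positive probability is enough to bound it from below. Writing Y = X /
  \<alpha> with unit exponentials X independent of \<alpha> makes rates and clocks one product
  measure, invariant under all translations.\<close>

text \<open>The weight of the end point is not counted, which makes the passage time exactly superadditive.\<close>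

fun lpp :: "(nat \<Rightarrow> nat \<Rightarrow> real) \<Rightarrow> nat \<Rightarrow> nat \<Rightarrow> real" where
  "lpp w 0 0 = 0"
| "lpp w (Suc a) 0 = lpp w a 0 + w a 0"
| "lpp w 0 (Suc b) = lpp w 0 b + w 0 b"
| "lpp w (Suc a) (Suc b) = max (lpp w a (Suc b) + w a (Suc b)) (lpp w (Suc a) b + w (Suc a) b)"

lemma lpp_mono_weights:
  assumes "\<And>i j. i \<le> a \<Longrightarrow> j \<le> b \<Longrightarrow> w i j \<le> w' i j"
  shows "lpp w a b \<le> lpp w' a b"
  using assms
proof (induction w a b rule: lpp.induct)
  case (4 w a b)
  have "lpp w a (Suc b) \<le> lpp w' a (Suc b)" "lpp w (Suc a) b \<le> lpp w' (Suc a) b"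
    using 4 by auto
  moreover have "w a (Suc b) \<le> w' a (Suc b)" "w (Suc a) b \<le> w' (Suc a) b"
    using 4(3) by auto
  ultimately show ?case by (simp add: max_def)
qed (auto simp: add_mono)

lemma lpp_cong:
  assumes "\<And>i j. i \<le> a \<Longrightarrow> j \<le> b \<Longrightarrow> w i j = w' i j"
  shows "lpp w a b = lpp w' a b"
  by (intro antisym lpp_mono_weights) (auto simp: assms)

lemma lpp_zero [simp]: "lpp (\<lambda>_ _. 0) a b = 0"
  by (induction "(\<lambda>_ _. 0) :: nat \<Rightarrow> nat \<Rightarrow> real" a b rule: lpp.induct) auto

lemma lpp_nonneg: "(\<And>i j. 0 \<le> w i j) \<Longrightarrow> 0 \<le> lpp w a b"
  using lpp_mono_weights[of a b "\<lambda>_ _. 0" w] by simp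

lemma lpp_scale: "0 \<le> c \<Longrightarrow> lpp (\<lambda>i j. c * w i j) a b = c * lpp w a b"
  by (induction w a b rule: lpp.induct) (auto simp: algebra_simps max_mult_distrib_left)

lemma lpp_step_right: "lpp w a b + w a b \<le> lpp w (Suc a) b"
  by (cases b) auto

lemma lpp_step_up: "lpp w a b + w a b \<le> lpp w a (Suc b)"
  by (cases a) auto

text \<open>An optimal path to \<open>(a, b)\<close> continued by an optimal path from there
  competes for the far corner; the weight at the junction is counted by the second piece
  only.\<close>

lemma lpp_superadd:
  "lpp w a b + lpp (\<lambda>i j. w (a + i) (b + j)) c d \<le> lpp w (a + c) (b + d)"
proof (induction "\<lambda>i j. w (a + i) (b + j)" c d rule: lpp.induct)
  case (2 c)
  then show ?case using lpp_step_right[of w "a + c" b] by simp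
next
  case (3 d)
  then show ?case using lpp_step_up[of w a "b + d"] by simp
next
  case (4 c d)
  then show ?case using lpp_step_up[of w "a + Suc c" "b + d"] lpp_step_right[of w "a + c" "b + Suc d"]
    by (simp add: max_def)
qed auto

lemma lpp_mono:
  assumes "\<And>i j. 0 \<le> w i j" "a \<le> a'" "b \<le> b'"
  shows "lpp w a b \<le> lpp w a' b'"
  using lpp_superadd[of w a b "a' - a" "b' - b"] lpp_nonneg[of "\<lambda>i j. w (a + i) (b + j)" "a' - a" "b' - b"] assms
  by simp

lemma lpp_le_sum:
  assumes "\<And>i j. 0 \<le> w i j"
  shows "lpp w a b \<le> (\<Sum>i\<le>a. \<Sum>j\<le>b. w i j)"
proof -
  \<comment> \<open>The end weight joins the induction claim: a predecessor's weight is added in the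
    recursion and must be covered by the predecessor's own rectangle, not counted on top of
    it.\<close>
  have "lpp w a b + w a b \<le> (\<Sum>i\<le>a. \<Sum>j\<le>b. w i j)"
    using assms
  proof (induction w a b rule: lpp.induct)
    case (2 w a)
    then show ?case by simp
  next
    case (3 w b)
    then show ?case by simp
  next
    case (4 w a b)
    have 1: "0 \<le> (\<Sum>i\<le>a. w i (Suc b))" "0 \<le> (\<Sum>j\<le>b. w (Suc a) j)"
      by (intro sum_nonneg 4)+
    have 2: "(\<Sum>i\<le>Suc a. \<Sum>j\<le>Suc b. w i j) = (\<Sum>i\<le>Suc a. \<Sum>j\<le>b. w i j) + (\<Sum>i\<le>a. w i (Suc b)) + w (Suc a) (Suc b)"
      by (simp add: sum.distrib)
    have 3: "(\<Sum>i\<le>Suc a. \<Sum>j\<le>Suc b. w i j) = (\<Sum>i\<le>a. \<Sum>j\<le>Suc b. w i j) + (\<Sum>j\<le>b. w (Suc a) j) + w (Suc a) (Suc b)"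
      by simp
    show ?case using 4(1)[OF 4(3)] 4(2)[OF 4(3)] 1 2 3 by simp
  qed auto
  then show ?thesis using assms[of a b] by linarith
qed

text \<open>Every path from column \<open>0\<close> to column \<open>x\<close> visits each column of this set before its last step.\<close>
definition cols_between :: "int \<Rightarrow> int set" where
  "cols_between x = {0..<x} \<union> {x<..0}"

lemma finite_cols_between [simp]: "finite (cols_between x)"
  by (simp add: cols_between_def)

lemma card_cols_between [simp]: "card (cols_between x) = nat \<bar>x\<bar>"
proof (cases "0 \<le> x")
  case True
  then have "cols_between x = {0..<x}" by (auto simp: cols_between_def)
  then show ?thesis using True by simp
next
  case False
  then have "cols_between x = {x<..0}" by (auto simp: cols_between_def)
  then show ?thesis using False by simp
qed

text \<open>A step away from column 0 adds exactly the column just left, a step back only shrinks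
  the set; nonnegativity of \<open>e\<close> covers the second case.\<close>

lemma sum_cols_between_step:
  fixes e :: "int \<Rightarrow> real"
  assumes "\<And>i. 0 \<le> e i" "y = x + 1 \<or> y = x - 1"
  shows "sum e (cols_between y) \<le> sum e (cols_between x) + e x"
proof -
  have "cols_between y \<subseteq> insert x (cols_between x)"
    using assms(2) by (auto simp: cols_between_def)
  then have "sum e (cols_between y) \<le> sum e (insert x (cols_between x))"
    using assms by (intro sum_mono2) auto
  also have "\<dots> \<le> sum e (cols_between x) + e x"
    using assms(1)[of x] by (cases "x \<in> cols_between x") (auto simp: insert_absorb)
  finally show ?thesis .
qed

text \<open>A path collects \<open>e i\<close> on each visit to column \<open>i\<close>, hence at
  least once for each column it is forced to cross; further visits only help.\<close>

lemma lpp_add_columns: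
  fixes e :: "int \<Rightarrow> real"
  assumes e: "\<And>i. 0 \<le> e i"
  shows "lpp w a b + sum e (cols_between (int a - int b)) \<le> lpp (\<lambda>i j. w i j + e (int i - int j)) a b"
proof (induction w a b rule: lpp.induct)
  case (1 w)
  then show ?case by (simp add: cols_between_def)
next
  case (2 w a)
  then show ?case using sum_cols_between_step[of e "int (Suc a)" "int a"] e by force
next
  case (3 w b)
  then show ?case using sum_cols_between_step[of e "- int (Suc b)" "- int b"] e by force
next
  case (4 w a b)
  have "sum e (cols_between (int (Suc a) - int (Suc b))) \<le> sum e (cols_between (int a - int (Suc b))) + e (int a - int (Suc b))"
    "sum e (cols_between (int (Suc a) - int (Suc b))) \<le> sum e (cols_between (int (Suc a) - int b)) + e (int (Suc a) - int b)"
    by (intro sum_cols_between_step e; simp)+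
  then show ?case using 4 by (simp add: max_def)
qed

subsection \<open>Paths in the wedge\<close>

lemma lpp_pathsD:
  assumes "p \<in> lpp_paths i j"
  shows "p \<noteq> []" "hd p = (0, 0)" "last p = (i, j)" "set p \<subseteq> lpp_W"
    "Suc k < length p \<Longrightarrow> (fst (p ! Suc k) - fst (p ! k), snd (p ! Suc k) - snd (p ! k)) \<in> {(1, 0), (-1, 1)}"
  using assms unfolding lpp_paths_def by blast+

lemma lpp_paths_snoc:
  assumes q: "q \<in> lpp_paths i' j'" and z: "(i - i', j - j') \<in> {(1, 0), (-1, 1)}" "(i, j) \<in> lpp_W"
  shows "q @ [(i, j)] \<in> lpp_paths i j"
  unfolding lpp_paths_def mem_Collect_eq
proof (intro conjI allI impI)
  note D = lpp_pathsD[OF q]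
  show "hd (q @ [(i, j)]) = (0, 0)" using D by simp
  show "set (q @ [(i, j)]) \<subseteq> lpp_W" using D z by simp
  fix k assume k: "Suc k < length (q @ [(i, j)])"
  let ?p = "q @ [(i, j)]"
  show "(fst (?p ! Suc k) - fst (?p ! k), snd (?p ! Suc k) - snd (?p ! k)) \<in> {(1, 0), (-1, 1)}"
  proof (cases "Suc k < length q")
    case True
    then have "?p ! Suc k = q ! Suc k" "?p ! k = q ! k" by (simp_all add: nth_append)
    then show ?thesis using D(5)[OF True] by (simp only:)
  next
    case False
    then have "Suc k = length q" using k by simp
    then have "?p ! Suc k = (i, j)" "?p ! k = last q"
      using D(1) by (simp_all add: nth_append last_conv_nth flip: \<open>Suc k = length q\<close>)
    then show ?thesis using D(3) z(1) by (simp only: fst_conv snd_conv)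
  qed
qed simp_all

lemma lpp_paths_snocD:
  assumes p: "q @ [(i, j)] \<in> lpp_paths i j" and q: "q \<noteq> []"
  shows "q \<in> lpp_paths (i - 1) j \<union> lpp_paths (i + 1) (j - 1)"
proof -
  note D = lpp_pathsD[OF p]
  let ?p = "q @ [(i, j)]"
  have mem: "q \<in> lpp_paths (fst (last q)) (snd (last q))"
    unfolding lpp_paths_def mem_Collect_eq
  proof (intro conjI allI impI)
    show "hd q = (0, 0)" using D(2) q by simp
    show "set q \<subseteq> lpp_W" using D(4) by simp
    fix k assume k: "Suc k < length q"
    then have "?p ! Suc k = q ! Suc k" "?p ! k = q ! k" by (simp_all add: nth_append)
    then show "(fst (q ! Suc k) - fst (q ! k), snd (q ! Suc k) - snd (q ! k)) \<in> {(1, 0), (-1, 1)}"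
      using D(5)[of k] k by simp
  qed (use q in simp_all)
  have "?p ! Suc (length q - 1) = (i, j)" "?p ! (length q - 1) = last q"
    using q by (simp_all add: nth_append last_conv_nth)
  then have "(i - fst (last q), j - snd (last q)) \<in> {(1, 0), (-1, 1)}"
    using D(5)[of "length q - 1"] q by simp
  then have "fst (last q) = i - 1 \<and> snd (last q) = j \<or> fst (last q) = i + 1 \<and> snd (last q) = j - 1"
    by auto
  then show ?thesis using mem by auto
qed

lemma lpp_paths_step:
  assumes "(i, j) \<noteq> (0, 0)" "(i, j) \<in> lpp_W"
  shows "lpp_paths i j = (\<lambda>p. p @ [(i, j)]) ` (lpp_paths (i - 1) j \<union> lpp_paths (i + 1) (j - 1))"
proof (intro set_eqI iffI)
  fix p assume p: "p \<in> lpp_paths i j"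
  note D = lpp_pathsD[OF p]
  have eq: "p = butlast p @ [(i, j)]"
    using D(1,3) append_butlast_last_id[of p] by simp
  have "butlast p \<noteq> []"
  proof
    assume "butlast p = []"
    then have "p = [(i, j)]" using eq by simp
    then show False using D(2) assms(1) by simp
  qed
  then have "butlast p \<in> lpp_paths (i - 1) j \<union> lpp_paths (i + 1) (j - 1)"
    using p eq by (intro lpp_paths_snocD) auto
  then show "p \<in> (\<lambda>p. p @ [(i, j)]) ` (lpp_paths (i - 1) j \<union> lpp_paths (i + 1) (j - 1))"
    using eq by blast
next
  fix p assume "p \<in> (\<lambda>p. p @ [(i, j)]) ` (lpp_paths (i - 1) j \<union> lpp_paths (i + 1) (j - 1))"
  then show "p \<in> lpp_paths i j"
    using lpp_paths_snoc[of _ "i - 1" j i j] lpp_paths_snoc[of _ "i + 1" "j - 1" i j] assms(2) by auto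
qed

lemma lpp_paths_outside: "(i, j) \<notin> lpp_W \<Longrightarrow> lpp_paths i j = {}"
  using lpp_pathsD(1,3,4) by (metis all_not_in_conv last_in_set subsetD)

text \<open>Both admissible steps raise \<open>i + 2 * j\<close> by one, so the end point determines
  the length.\<close>

lemma lpp_paths_length:
  assumes "p \<in> lpp_paths i j"
  shows "int (length p) = i + 2 * j + 1"
proof -
  note p = lpp_pathsD(1-3)[OF assms] and st = lpp_pathsD(5)[OF assms]
  have "k < length p \<Longrightarrow> fst (p ! k) + 2 * snd (p ! k) = int k" for k
  proof (induction k)
    case 0 then show ?case using p by (simp add: hd_conv_nth)
  next
    case (Suc k)
    then show ?case using st[of k] by auto
  qed
  from this[of "length p - 1"] have "fst (last p) + 2 * snd (last p) = int (length p - 1)"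
    using p(1) by (simp add: last_conv_nth)
  moreover have "0 < length p" using p(1) by simp
  ultimately show ?thesis using p(3) by simp
qed

lemma lpp_paths_origin: "lpp_paths 0 0 = {[(0, 0)]}"
proof (intro set_eqI iffI)
  fix p assume p: "p \<in> lpp_paths 0 0"
  from lpp_paths_length[OF p] have "length p = 1" by simp
  then obtain x where "p = [x]" by (metis One_nat_def length_0_conv length_Suc_conv)
  then show "p \<in> {[(0, 0)]}" using p by (auto simp: lpp_paths_def)
qed (auto simp: lpp_paths_def lpp_W_def)

lemma Max_image_snoc:
  fixes Y :: "int \<times> int \<Rightarrow> real"
  assumes "finite P" "P \<noteq> {}"
  shows "Max ((\<lambda>p. sum_list (map Y p)) ` (\<lambda>p. p @ [z]) ` P) = Max ((\<lambda>p. sum_list (map Y p)) ` P) + Y z"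
proof -
  have "mono (\<lambda>t. t + Y z)" by (simp add: mono_def)
  from mono_Max_commute[OF this, of "(\<lambda>p. sum_list (map Y p)) ` P"] assms
  show ?thesis by (simp add: image_image)
qed

text \<open>With a = i + j and b = j the steps (1, 0) and (-1, 1) become the two unit steps of the
  quadrant. Finiteness and nonemptiness travel with the induction because \<open>Max\<close> is
  meaningful only then. \<open>lpp_T\<close> counts the end weight, hence the summand
  \<open>w a b\<close>.\<close>

lemma lpp_T_eq_aux:
  fixes Y :: "int \<times> int \<Rightarrow> real"
  defines "w \<equiv> \<lambda>a b. Y (int a - int b, int b)"
  shows "finite (lpp_paths (int a - int b) (int b)) \<and> lpp_paths (int a - int b) (int b) \<noteq> {}
    \<and> lpp_T Y (int a - int b) (int b) = lpp w a b + w a b"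
  unfolding lpp_T_def w_def
proof (induction "\<lambda>a b. Y (int a - int b, int b)" a b rule: lpp.induct)
  case 1
  then show ?case by (simp add: lpp_paths_origin)
next
  case (2 a)
  have *: "lpp_paths (int (Suc a) - int 0) (int 0) = (\<lambda>p. p @ [(int (Suc a), 0)]) ` (lpp_paths (int a) 0)"
    by (subst lpp_paths_step) (auto simp: lpp_W_def lpp_paths_outside)
  show ?case using 2 unfolding * by (simp add: Max_image_snoc)
next
  case (3 b)
  have *: "lpp_paths (int 0 - int (Suc b)) (int (Suc b)) = (\<lambda>p. p @ [(- int (Suc b), int (Suc b))]) ` (lpp_paths (- int b) (int b))"
    by (subst lpp_paths_step) (auto simp: lpp_W_def lpp_paths_outside)
  show ?case using 3 unfolding * by (simp add: Max_image_snoc)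
next
  case (4 a b)
  have e: "int (Suc a) - int (Suc b) - 1 = int a - int (Suc b)"
    "int (Suc a) - int (Suc b) + 1 = int (Suc a) - int b" "int (Suc b) - 1 = int b" by auto
  have *: "lpp_paths (int (Suc a) - int (Suc b)) (int (Suc b)) = (\<lambda>p. p @ [(int (Suc a) - int (Suc b), int (Suc b))]) `
      (lpp_paths (int a - int (Suc b)) (int (Suc b)) \<union> lpp_paths (int (Suc a) - int b) (int b))"
    by (subst lpp_paths_step) (simp_all only: e, auto simp: lpp_W_def)
  show ?case using 4 unfolding * by (subst Max_image_snoc) (auto simp: image_Un Max_Un)
qed

lemma lpp_T_eq:
  "lpp_T Y (int a - int b) (int b) = lpp (\<lambda>a b. Y (int a - int b, int b)) a b + Y (int a - int b, int b)"
  using lpp_T_eq_aux[of a b Y] by simp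

lemma borel_measurable_lpp:
  assumes "\<And>i j. i \<le> a \<Longrightarrow> j \<le> b \<Longrightarrow> (i, j) \<noteq> (a, b) \<Longrightarrow> (\<lambda>\<omega>. w \<omega> i j) \<in> borel_measurable M"
  shows "(\<lambda>\<omega>. lpp (w \<omega>) a b) \<in> borel_measurable M"
  using assms
proof (induction "a + b" arbitrary: a b rule: less_induct)
  case less
  have r: "(\<lambda>\<omega>. lpp (w \<omega>) i j + w \<omega> i j) \<in> borel_measurable M"
    if "i \<le> a" "j \<le> b" "(i, j) \<noteq> (a, b)" for i j
    using that by (intro borel_measurable_add less) auto
  show ?case
  proof (cases a)
    case 0
    show ?thesis using r[of 0 "b - 1"] 0 by (cases b) simp_all
  next
    case (Suc a')
    show ?thesis
    proof (cases b)
      case 0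
      then show ?thesis using r[of a' 0] Suc by simp
    next
      case (Suc b')
      then show ?thesis using r[of a' b] r[of a b'] \<open>a = Suc a'\<close> by simp
    qed
  qed
qed

subsection \<open>The Burke property of exponential increments\<close>

abbreviation expd :: "real \<Rightarrow> real measure" where
  "expd l \<equiv> density lborel (exponential_density l)"

lemma exponential_density_borel [measurable]: "exponential_density l \<in> borel_measurable borel"
  unfolding exponential_density_def by measurable

lemma nn_integral_expd:
  assumes "f \<in> borel_measurable borel"
  shows "(\<integral>\<^sup>+x. f x \<partial>expd l) = (\<integral>\<^sup>+x. ennreal (exponential_density l x) * f x \<partial>lborel)"
  using assms by (subst nn_integral_density) auto

lemma nn_integral_expd_scale:
  assumes l: "0 < l" and [measurable]: "f \<in> borel_measurable borel"
  shows "(\<integral>\<^sup>+x. f x \<partial>expd l) = (\<integral>\<^sup>+x. f (x / l) \<partial>expd 1)"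
proof -
  have "(\<integral>\<^sup>+x. f x \<partial>expd l) = (\<integral>\<^sup>+x. ennreal (exponential_density l x) * f x \<partial>lborel)"
    by (rule nn_integral_expd) simp
  also have "\<dots> = ennreal \<bar>1/l\<bar> * (\<integral>\<^sup>+x. ennreal (exponential_density l (0 + 1/l * x)) * f (0 + 1/l * x) \<partial>lborel)"
    by (rule nn_integral_real_affine) (use l in auto)
  also have "\<dots> = (\<integral>\<^sup>+x. ennreal \<bar>1/l\<bar> * (ennreal (exponential_density l (0 + 1/l * x)) * f (0 + 1/l * x)) \<partial>lborel)"
    by (subst nn_integral_cmult) auto
  also have "\<dots> = (\<integral>\<^sup>+x. ennreal (exponential_density 1 x) * f (x / l) \<partial>lborel)"
  proof (rule nn_integral_cong)
    fix x :: real
    have "\<bar>1/l\<bar> * exponential_density l (0 + 1/l * x) = exponential_density 1 x"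
      using l by (auto simp: exponential_density_def field_simps)
    then show "ennreal \<bar>1/l\<bar> * (ennreal (exponential_density l (0 + 1/l * x)) * f (0 + 1/l * x))
      = ennreal (exponential_density 1 x) * f (x / l)"
      by (simp add: mult.assoc[symmetric] ennreal_mult'[symmetric])
  qed
  also have "\<dots> = (\<integral>\<^sup>+x. f (x / l) \<partial>expd 1)"
    by (rule nn_integral_expd[symmetric]) simp
  finally show ?thesis .
qed

text \<open>On u > v the Burke map is the linear involution (u, v, x) -> (x + u - v, x, v). It has
  determinant of modulus 1, maps the region to itself and preserves p u + q v + (p + q) x, hence the
  joint density.\<close>

lemma burke_region:
  fixes F :: "real \<Rightarrow> real \<Rightarrow> real \<Rightarrow> ennreal"
  assumes p: "0 < p" and q: "0 < q"
    and [measurable]: "(\<lambda>(x, y, z). F x y z) \<in> borel_measurable (borel \<Otimes>\<^sub>M borel \<Otimes>\<^sub>M borel)"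
  defines "h \<equiv> \<lambda>u v x. ennreal (exponential_density p u * exponential_density q v * exponential_density (p + q) x)"
  shows "(\<integral>\<^sup>+u. \<integral>\<^sup>+v. \<integral>\<^sup>+x. h u v x * indicator {v<..} u * F (x + (u - v)) x v \<partial>lborel \<partial>lborel \<partial>lborel)
       = (\<integral>\<^sup>+u. \<integral>\<^sup>+v. \<integral>\<^sup>+x. h u v x * indicator {v<..} u * F u v x \<partial>lborel \<partial>lborel \<partial>lborel)"
proof -
  have [measurable]: "(\<lambda>x. F (f x) (g x) (k x)) \<in> borel_measurable M"
    if "f \<in> borel_measurable M" "g \<in> borel_measurable M" "k \<in> borel_measurable M" for f g k and M :: "'c measure"
    using measurable_compose[of "\<lambda>x. (f x, g x, k x)" M, OF _ assms(3)] that by simp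
  have i [measurable]: "(\<lambda>x. indicator {g x<..} (f x) :: ennreal) \<in> borel_measurable M"
    if [measurable]: "f \<in> borel_measurable M" "g \<in> borel_measurable M" for f g :: "'c \<Rightarrow> real" and M
  proof -
    have "(\<lambda>x. indicator {g x<..} (f x) :: ennreal) = (\<lambda>x. if g x < f x then 1 else 0)"
      by (auto simp: indicator_def)
    then show ?thesis by simp
  qed
  have [measurable]: "(\<lambda>x. h (f x) (g x) (k x)) \<in> borel_measurable M"
    if [measurable]: "f \<in> borel_measurable M" "g \<in> borel_measurable M" "k \<in> borel_measurable M" for f g k and M :: "'c measure"
    unfolding h_def by measurable
  have "(\<integral>\<^sup>+u. \<integral>\<^sup>+v. \<integral>\<^sup>+x. h u v x * indicator {v<..} u * F (x + (u - v)) x v \<partial>lborel \<partial>lborel \<partial>lborel)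
      = (\<integral>\<^sup>+v. \<integral>\<^sup>+u. \<integral>\<^sup>+x. h u v x * indicator {v<..} u * F (x + (u - v)) x v \<partial>lborel \<partial>lborel \<partial>lborel)"
    by (rule lborel_pair.Fubini') measurable
  also have "\<dots> = (\<integral>\<^sup>+v. \<integral>\<^sup>+x. \<integral>\<^sup>+u. h u v x * indicator {v<..} u * F (x + (u - v)) x v \<partial>lborel \<partial>lborel \<partial>lborel)"
    by (intro nn_integral_cong lborel_pair.Fubini') measurable
  also have "\<dots> = (\<integral>\<^sup>+v. \<integral>\<^sup>+x. \<integral>\<^sup>+u. h u x v * indicator {x<..} u * F u x v \<partial>lborel \<partial>lborel \<partial>lborel)"
  proof (rule nn_integral_cong, rule nn_integral_cong)
    \<comment> \<open>The involution is split into a translation of \<open>u\<close> by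
      \<open>v - x\<close>, done here, and the exchange of \<open>v\<close> and \<open>x\<close>,
      which is a renaming of bound variables undone by Fubini below.\<close>
    fix v x :: real
    have "(\<integral>\<^sup>+u. h u v x * indicator {v<..} u * F (x + (u - v)) x v \<partial>lborel)
        = ennreal \<bar>1\<bar> * (\<integral>\<^sup>+u. h ((v - x) + 1 * u) v x * indicator {v<..} ((v - x) + 1 * u) * F (x + (((v - x) + 1 * u) - v)) x v \<partial>lborel)"
      by (rule nn_integral_real_affine) auto
    also have "\<dots> = (\<integral>\<^sup>+u. h u x v * indicator {x<..} u * F u x v \<partial>lborel)"
    proof (simp, rule nn_integral_cong)
      fix u
      have "h (v - x + u) v x * indicator {v<..} (v - x + u) = h u x v * indicator {x<..} u"
      proof (cases "x < u")
        case True
        have "exp ((x - v - u) * p) * (exp (- (v * q)) * exp (- (x * (p + q)))) = exp (- (u * p)) * (exp (- (x * q)) * exp (- (v * (p + q))))"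
          by (simp add: algebra_simps flip: exp_add)
        then have "h (v - x + u) v x = h u x v"
          using p q True unfolding h_def by (auto simp: exponential_density_def intro!: arg_cong[where f = ennreal])
        then show ?thesis using True by (simp add: indicator_def)
      qed (simp add: indicator_def)
      then show "h (v - x + u) v x * indicator {v<..} (v - x + u) * F u x v = h u x v * indicator {x<..} u * F u x v"
        by simp
    qed
    finally show "(\<integral>\<^sup>+u. h u v x * indicator {v<..} u * F (x + (u - v)) x v \<partial>lborel)
        = (\<integral>\<^sup>+u. h u x v * indicator {x<..} u * F u x v \<partial>lborel)" .
  qed
  also have "\<dots> = (\<integral>\<^sup>+v. \<integral>\<^sup>+u. \<integral>\<^sup>+x. h u x v * indicator {x<..} u * F u x v \<partial>lborel \<partial>lborel \<partial>lborel)"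
    by (intro nn_integral_cong lborel_pair.Fubini') measurable
  also have "\<dots> = (\<integral>\<^sup>+u. \<integral>\<^sup>+v. \<integral>\<^sup>+x. h u x v * indicator {x<..} u * F u x v \<partial>lborel \<partial>lborel \<partial>lborel)"
    by (rule lborel_pair.Fubini') measurable
  also have "\<dots> = (\<integral>\<^sup>+u. \<integral>\<^sup>+v. \<integral>\<^sup>+x. h u v x * indicator {v<..} u * F u v x \<partial>lborel \<partial>lborel \<partial>lborel)"
    by (intro nn_integral_cong lborel_pair.Fubini') measurable
  finally show ?thesis .
qed

lemma borel_measurable_triple:
  fixes F :: "real \<Rightarrow> real \<Rightarrow> real \<Rightarrow> ennreal"
  assumes F: "(\<lambda>(x, y, z). F x y z) \<in> borel_measurable (borel \<Otimes>\<^sub>M borel \<Otimes>\<^sub>M borel)"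
    and [measurable]: "f \<in> borel_measurable M" "g \<in> borel_measurable M" "k \<in> borel_measurable M"
  shows "(\<lambda>x. F (f x) (g x) (k x)) \<in> borel_measurable M"
  using measurable_compose[of "\<lambda>x. (f x, g x, k x)" M, OF _ F] by simp

lemma nn_integral_expd3:
  fixes F :: "real \<Rightarrow> real \<Rightarrow> real \<Rightarrow> ennreal"
  assumes F: "(\<lambda>(x, y, z). F x y z) \<in> borel_measurable (borel \<Otimes>\<^sub>M borel \<Otimes>\<^sub>M borel)"
    and "0 < p" "0 < q" "0 < r"
  shows "(\<integral>\<^sup>+u. \<integral>\<^sup>+v. \<integral>\<^sup>+x. F u v x \<partial>expd r \<partial>expd q \<partial>expd p)
    = (\<integral>\<^sup>+u. \<integral>\<^sup>+v. \<integral>\<^sup>+x. ennreal (exponential_density p u * exponential_density q v * exponential_density r x) * F u v x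
        \<partial>lborel \<partial>lborel \<partial>lborel)"
proof -
  note [measurable] = borel_measurable_triple[OF F]
  have "(\<integral>\<^sup>+u. \<integral>\<^sup>+v. \<integral>\<^sup>+x. F u v x \<partial>expd r \<partial>expd q \<partial>expd p)
      = (\<integral>\<^sup>+u. ennreal (exponential_density p u) * (\<integral>\<^sup>+v. ennreal (exponential_density q v) *
          (\<integral>\<^sup>+x. ennreal (exponential_density r x) * F u v x \<partial>lborel) \<partial>lborel) \<partial>lborel)"
    by (simp add: nn_integral_density)
  also have "\<dots> = (\<integral>\<^sup>+u. \<integral>\<^sup>+v. \<integral>\<^sup>+x. ennreal (exponential_density p u) * (ennreal (exponential_density q v) *
      (ennreal (exponential_density r x) * F u v x)) \<partial>lborel \<partial>lborel \<partial>lborel)"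
    by (simp add: nn_integral_cmult)
  also have "\<dots> = (\<integral>\<^sup>+u. \<integral>\<^sup>+v. \<integral>\<^sup>+x. ennreal (exponential_density p u * exponential_density q v * exponential_density r x) * F u v x
        \<partial>lborel \<partial>lborel \<partial>lborel)"
    using assms by (intro nn_integral_cong) (simp add: ennreal_mult exponential_density_nonneg mult.assoc)
  finally show ?thesis .
qed

text \<open>Burke's theorem for one cell: \<open>u\<close> and \<open>v\<close> are the incoming
  increments, \<open>x\<close> the weight. Keeping \<open>min u v\<close> as a third output makes
  the map preserve a full product law, so that it can be iterated over cells. The half u < v follows
  from the half u > v by exchanging \<open>p\<close> and \<open>q\<close>.\<close>

lemma burke_rates:
  fixes F :: "real \<Rightarrow> real \<Rightarrow> real \<Rightarrow> ennreal"
  assumes p: "0 < p" and q: "0 < q"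
    and F: "(\<lambda>(x, y, z). F x y z) \<in> borel_measurable (borel \<Otimes>\<^sub>M borel \<Otimes>\<^sub>M borel)"
  shows "(\<integral>\<^sup>+u. \<integral>\<^sup>+v. \<integral>\<^sup>+x. F (x + max 0 (u - v)) (x + max 0 (v - u)) (min u v) \<partial>expd (p + q) \<partial>expd q \<partial>expd p)
       = (\<integral>\<^sup>+u. \<integral>\<^sup>+v. \<integral>\<^sup>+x. F u v x \<partial>expd (p + q) \<partial>expd q \<partial>expd p)"
proof -
  note [measurable] = borel_measurable_triple[OF F]
  have i [measurable]: "(\<lambda>x. indicator {g x<..} (f x) :: ennreal) \<in> borel_measurable M"
    if [measurable]: "f \<in> borel_measurable M" "g \<in> borel_measurable M" for f g :: "'c \<Rightarrow> real" and M
  proof -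
    have "(\<lambda>x. indicator {g x<..} (f x) :: ennreal) = (\<lambda>x. if g x < f x then 1 else 0)"
      by (auto simp: indicator_def)
    then show ?thesis by simp
  qed
  define h where "h p q u v x = ennreal (exponential_density p u * exponential_density q v * exponential_density (p + q) x)" for p q u v x
  have [measurable]: "(\<lambda>x. h p q (f x) (g x) (k x)) \<in> borel_measurable M"
    if [measurable]: "f \<in> borel_measurable M" "g \<in> borel_measurable M" "k \<in> borel_measurable M" for p q f g k and M :: "'c measure"
    unfolding h_def by measurable
  have hsym: "h p q u v x = h q p v u x" for u v x
    by (simp add: h_def mult.commute mult.left_commute add.commute)
  \<comment> \<open>the diagonal \<open>u = v\<close> is a null set\<close>
  have split: "(\<integral>\<^sup>+u. \<integral>\<^sup>+v. \<integral>\<^sup>+x. h p q u v x * G u v x \<partial>lborel \<partial>lborel \<partial>lborel)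
    = (\<integral>\<^sup>+u. \<integral>\<^sup>+v. \<integral>\<^sup>+x. h p q u v x * indicator {v<..} u * G u v x \<partial>lborel \<partial>lborel \<partial>lborel)
    + (\<integral>\<^sup>+v. \<integral>\<^sup>+u. \<integral>\<^sup>+x. h q p v u x * indicator {u<..} v * G u v x \<partial>lborel \<partial>lborel \<partial>lborel)"
    if G: "(\<lambda>(x, y, z). G x y z) \<in> borel_measurable (borel \<Otimes>\<^sub>M borel \<Otimes>\<^sub>M borel)" for G
  proof -
    note [measurable] = borel_measurable_triple[OF G]
    have "(\<integral>\<^sup>+u. \<integral>\<^sup>+v. \<integral>\<^sup>+x. h p q u v x * G u v x \<partial>lborel \<partial>lborel \<partial>lborel)
      = (\<integral>\<^sup>+u. \<integral>\<^sup>+v. (\<integral>\<^sup>+x. h p q u v x * indicator {v<..} u * G u v x \<partial>lborel) +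
          (\<integral>\<^sup>+x. h q p v u x * indicator {u<..} v * G u v x \<partial>lborel) \<partial>lborel \<partial>lborel)"
    proof (rule nn_integral_cong, rule nn_integral_cong_AE)
      fix u :: real
      have "AE v in lborel. v \<noteq> u" by (rule AE_lborel_singleton)
      then show "AE v in lborel. (\<integral>\<^sup>+x. h p q u v x * G u v x \<partial>lborel) =
        (\<integral>\<^sup>+x. h p q u v x * indicator {v<..} u * G u v x \<partial>lborel) +
          (\<integral>\<^sup>+x. h q p v u x * indicator {u<..} v * G u v x \<partial>lborel)"
      proof eventually_elim
        case (elim v)
        then show ?case using hsym[of u v] by (cases "u < v") (auto simp: indicator_def)
      qed
    qed
    also have "\<dots> = (\<integral>\<^sup>+u. \<integral>\<^sup>+v. \<integral>\<^sup>+x. h p q u v x * indicator {v<..} u * G u v x \<partial>lborel \<partial>lborel \<partial>lborel)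
      + (\<integral>\<^sup>+u. \<integral>\<^sup>+v. \<integral>\<^sup>+x. h q p v u x * indicator {u<..} v * G u v x \<partial>lborel \<partial>lborel \<partial>lborel)"
      by (simp add: nn_integral_add)
    also have "(\<integral>\<^sup>+u. \<integral>\<^sup>+v. \<integral>\<^sup>+x. h q p v u x * indicator {u<..} v * G u v x \<partial>lborel \<partial>lborel \<partial>lborel)
      = (\<integral>\<^sup>+v. \<integral>\<^sup>+u. \<integral>\<^sup>+x. h q p v u x * indicator {u<..} v * G u v x \<partial>lborel \<partial>lborel \<partial>lborel)"
      by (rule lborel_pair.Fubini') measurable
    finally show ?thesis .
  qed
  have F2: "(\<lambda>(y, x, z). F x y z) \<in> borel_measurable (borel \<Otimes>\<^sub>M borel \<Otimes>\<^sub>M borel)" by measurable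
  let ?G = "\<lambda>u v x. F (x + max 0 (u - v)) (x + max 0 (v - u)) (min u v)"
  have A: "(\<integral>\<^sup>+u. \<integral>\<^sup>+v. \<integral>\<^sup>+x. h p q u v x * indicator {v<..} u * ?G u v x \<partial>lborel \<partial>lborel \<partial>lborel)
    = (\<integral>\<^sup>+u. \<integral>\<^sup>+v. \<integral>\<^sup>+x. h p q u v x * indicator {v<..} u * F u v x \<partial>lborel \<partial>lborel \<partial>lborel)"
    unfolding burke_region[OF p q F, folded h_def, symmetric]
    by (intro nn_integral_cong) (auto simp: indicator_def max_def min_def)
  have B: "(\<integral>\<^sup>+v. \<integral>\<^sup>+u. \<integral>\<^sup>+x. h q p v u x * indicator {u<..} v * ?G u v x \<partial>lborel \<partial>lborel \<partial>lborel)
    = (\<integral>\<^sup>+v. \<integral>\<^sup>+u. \<integral>\<^sup>+x. h q p v u x * indicator {u<..} v * F u v x \<partial>lborel \<partial>lborel \<partial>lborel)"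
    unfolding burke_region[OF q p F2, folded h_def, symmetric]
    by (intro nn_integral_cong) (auto simp: indicator_def max_def min_def)
  have pq: "0 < p + q" using p q by simp
  show ?thesis
    apply (subst nn_integral_expd3[OF _ p q pq, of ?G, folded h_def])
     apply measurable
    apply (subst nn_integral_expd3[OF F p q pq, folded h_def])
    apply (subst split[of ?G])
     apply measurable
    apply (subst split[OF F])
    apply (simp only: A B)
    done
qed

lemma prob_space_exp1: "prob_space (expd 1)"
  by (rule prob_space_exponential_density) simp

interpretation exp1: prob_space "expd 1"
  by (rule prob_space_exp1)

interpretation exp1_prod: product_sigma_finite "\<lambda>_. expd 1"
  by standard

text \<open>The rates \<open>1 - \<rho>\<close>, \<open>\<rho>\<close> and 1 fit the requirement
  that the weight's rate be the sum of the other two. Everything is expressed through unit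
  exponentials.\<close>

lemma burke_scaled:
  fixes F :: "real \<Rightarrow> real \<Rightarrow> real \<Rightarrow> ennreal"
  assumes \<rho>: "0 < \<rho>" "\<rho> < 1"
    and F: "(\<lambda>(x, y, z). F x y z) \<in> borel_measurable (borel \<Otimes>\<^sub>M borel \<Otimes>\<^sub>M borel)"
  shows "(\<integral>\<^sup>+u. \<integral>\<^sup>+v. \<integral>\<^sup>+x. F ((1 - \<rho>) * (x + max 0 (u / (1 - \<rho>) - v / \<rho>))) (\<rho> * (x + max 0 (v / \<rho> - u / (1 - \<rho>))))
            (min (u / (1 - \<rho>)) (v / \<rho>)) \<partial>expd 1 \<partial>expd 1 \<partial>expd 1)
       = (\<integral>\<^sup>+u. \<integral>\<^sup>+v. \<integral>\<^sup>+x. F u v x \<partial>expd 1 \<partial>expd 1 \<partial>expd 1)"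
proof -
  note [measurable] = borel_measurable_triple[OF F]
  have m: "(\<lambda>(u, v, x). F ((1 - \<rho>) * u) (\<rho> * v) x) \<in> borel_measurable (borel \<Otimes>\<^sub>M borel \<Otimes>\<^sub>M borel)"
    by measurable
  have \<rho>': "0 < 1 - \<rho>" using \<rho> by simp
  from burke_rates[OF \<rho>' \<rho>(1) m]
  have "(\<integral>\<^sup>+u. \<integral>\<^sup>+v. \<integral>\<^sup>+x. F ((1 - \<rho>) * (x + max 0 (u - v))) (\<rho> * (x + max 0 (v - u))) (min u v) \<partial>expd 1 \<partial>expd \<rho> \<partial>expd (1 - \<rho>))
     = (\<integral>\<^sup>+u. \<integral>\<^sup>+v. \<integral>\<^sup>+x. F ((1 - \<rho>) * u) (\<rho> * v) x \<partial>expd 1 \<partial>expd \<rho> \<partial>expd (1 - \<rho>))"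
    by simp
  then show ?thesis
    using \<rho> by (simp add: nn_integral_expd_scale[OF \<rho>(1)] nn_integral_expd_scale[OF \<rho>'])
qed

text \<open>The increments are stored multiplied by their rates, so every slot keeps the unit
  exponential law and one fixed product measure is preserved, whichever slots are acted on.\<close>

definition burke_map :: "real \<Rightarrow> 'i \<Rightarrow> 'i \<Rightarrow> 'i \<Rightarrow> ('i \<Rightarrow> real) \<Rightarrow> 'i \<Rightarrow> real" where
  "burke_map \<rho> i j k w = w(
     i := (1 - \<rho>) * (w k + max 0 (w i / (1 - \<rho>) - w j / \<rho>)),
     j := \<rho> * (w k + max 0 (w j / \<rho> - w i / (1 - \<rho>))),
     k := min (w i / (1 - \<rho>)) (w j / \<rho>))"

lemma measurable_burke_map:
  assumes [simp]: "i \<in> K" "j \<in> K" "k \<in> K"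
  shows "burke_map \<rho> i j k \<in> PiM K (\<lambda>_. expd 1) \<rightarrow>\<^sub>M PiM K (\<lambda>_. expd 1)"
proof (rule measurable_PiM_single')
  fix l assume l [simp]: "l \<in> K"
  have [measurable]: "(\<lambda>w. w x) \<in> borel_measurable (PiM K (\<lambda>_. expd 1))" if "x \<in> K" for x
    using measurable_component_singleton[OF that, of "\<lambda>_. expd 1"] by simp
  show "(\<lambda>w. burke_map \<rho> i j k w l) \<in> PiM K (\<lambda>_. expd 1) \<rightarrow>\<^sub>M expd 1"
    unfolding burke_map_def fun_upd_def by measurable
qed (auto simp: burke_map_def space_PiM PiE_def extensional_def)

text \<open>Fubini moves the three affected slots innermost; for frozen other coordinates the claim
  is \<open>burke_scaled\<close>. Peeling off coordinates one by one is what asks for a finite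
  \<open>K\<close>.\<close>

lemma nn_integral_burke_map:
  assumes \<rho>: "0 < \<rho>" "\<rho> < 1" and K: "finite K" "i \<in> K" "j \<in> K" "k \<in> K" "i \<noteq> j" "i \<noteq> k" "j \<noteq> k"
    and f: "f \<in> borel_measurable (PiM K (\<lambda>_. expd 1))"
  shows "(\<integral>\<^sup>+w. f (burke_map \<rho> i j k w) \<partial>PiM K (\<lambda>_. expd 1)) = (\<integral>\<^sup>+w. f w \<partial>PiM K (\<lambda>_. expd 1))"
proof -
  define K' where "K' = K - {i, j, k}"
  have K': "K = insert i (insert j (insert k K'))" "finite K'" "i \<notin> insert j (insert k K')" "j \<notin> insert k K'" "k \<notin> K'"
    using K by (auto simp: K'_def)
  let ?P = "\<lambda>K. PiM K (\<lambda>_. expd 1)"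
  have *: "integral\<^sup>N (?P K) g = (\<integral>\<^sup>+w. \<integral>\<^sup>+u. \<integral>\<^sup>+v. \<integral>\<^sup>+x. g (w(k := x, j := v, i := u)) \<partial>expd 1 \<partial>expd 1 \<partial>expd 1 \<partial>?P K')"
    if g: "g \<in> borel_measurable (?P K)" for g :: "_ \<Rightarrow> ennreal"
  proof -
    have gm: "g \<in> borel_measurable (?P (insert i (insert j (insert k K'))))" using g K' by simp
    have 1: "integral\<^sup>N (?P K) g = (\<integral>\<^sup>+u. \<integral>\<^sup>+w. g (w(i := u)) \<partial>?P (insert j (insert k K')) \<partial>expd 1)"
      unfolding K'(1) using K' gm by (intro exp1_prod.product_nn_integral_insert_rev) auto
    have m1: "(\<lambda>w. g (w(i := u))) \<in> borel_measurable (?P (insert j (insert k K')))" for u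
      by (rule measurable_compose[OF _ gm]) (rule measurable_fun_upd[where J = "insert j (insert k K')"], auto)
    have 2: "(\<integral>\<^sup>+w. g (w(i := u)) \<partial>?P (insert j (insert k K')))
       = (\<integral>\<^sup>+v. \<integral>\<^sup>+w. g (w(j := v, i := u)) \<partial>?P (insert k K') \<partial>expd 1)" for u
      using K' by (intro exp1_prod.product_nn_integral_insert_rev m1) auto
    have m2: "(\<lambda>w. g (w(j := v, i := u))) \<in> borel_measurable (?P (insert k K'))" for u v
      by (rule measurable_compose[OF _ m1]) (rule measurable_fun_upd[where J = "insert k K'"], auto)
    have 3: "(\<integral>\<^sup>+w. g (w(j := v, i := u)) \<partial>?P (insert k K'))
       = (\<integral>\<^sup>+x. \<integral>\<^sup>+w. g (w(k := x, j := v, i := u)) \<partial>?P K' \<partial>expd 1)" for u v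
      using K' by (intro exp1_prod.product_nn_integral_insert_rev m2) auto
    interpret P': prob_space "?P K'" by (intro prob_space_PiM prob_space_exp1)
    interpret pair_sigma_finite "?P K'" "expd 1" by standard
    have m: "(\<lambda>(w, u, v, x). g (w(k := x, j := v, i := u))) \<in> borel_measurable (?P K' \<Otimes>\<^sub>M borel \<Otimes>\<^sub>M borel \<Otimes>\<^sub>M borel)"
    proof -
      have "(\<lambda>z. (fst z)(k := snd (snd (snd z)), j := fst (snd (snd z)), i := fst (snd z)))
        \<in> ?P K' \<Otimes>\<^sub>M borel \<Otimes>\<^sub>M borel \<Otimes>\<^sub>M borel \<rightarrow>\<^sub>M ?P (insert i (insert j (insert k K')))"
        by (rule measurable_fun_upd[where J = "insert j (insert k K')"], simp)
           (rule measurable_fun_upd[where J = "insert k K'"], simp,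
            rule measurable_fun_upd[where J = "K'"], auto)
      from measurable_compose[OF this gm] show ?thesis by (simp add: case_prod_beta')
    qed
    have mm [measurable]: "(\<lambda>z. g ((p z)(k := d z, j := c z, i := b z))) \<in> borel_measurable M"
      if [measurable]: "p \<in> M \<rightarrow>\<^sub>M ?P K'" "b \<in> borel_measurable M" "c \<in> borel_measurable M" "d \<in> borel_measurable M"
      for p b c d and M :: "'b measure"
      using measurable_compose[of "\<lambda>z. (p z, b z, c z, d z)" M, OF _ m] by simp
    have "(\<integral>\<^sup>+u. \<integral>\<^sup>+v. \<integral>\<^sup>+x. \<integral>\<^sup>+w. g (w(k := x, j := v, i := u)) \<partial>?P K' \<partial>expd 1 \<partial>expd 1 \<partial>expd 1)
      = (\<integral>\<^sup>+u. \<integral>\<^sup>+v. \<integral>\<^sup>+w. \<integral>\<^sup>+x. g (w(k := x, j := v, i := u)) \<partial>expd 1 \<partial>?P K' \<partial>expd 1 \<partial>expd 1)"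
      by (intro nn_integral_cong Fubini') measurable
    also have "\<dots> = (\<integral>\<^sup>+u. \<integral>\<^sup>+w. \<integral>\<^sup>+v. \<integral>\<^sup>+x. g (w(k := x, j := v, i := u)) \<partial>expd 1 \<partial>expd 1 \<partial>?P K' \<partial>expd 1)"
      by (intro nn_integral_cong Fubini') measurable
    also have "\<dots> = (\<integral>\<^sup>+w. \<integral>\<^sup>+u. \<integral>\<^sup>+v. \<integral>\<^sup>+x. g (w(k := x, j := v, i := u)) \<partial>expd 1 \<partial>expd 1 \<partial>expd 1 \<partial>?P K')"
      by (intro Fubini') measurable
    finally show ?thesis unfolding 1 2 3 .
  qed
  have bm: "(\<lambda>w. f (burke_map \<rho> i j k w)) \<in> borel_measurable (?P K)"
    using K f by (intro measurable_compose[OF measurable_burke_map])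
  show ?thesis
    unfolding *[OF bm] *[OF f]
  proof (rule nn_integral_cong)
    fix w assume w: "w \<in> space (?P K')"
    define F where "F u v x = f (w(k := x, j := v, i := u))" for u v x
    have "(\<lambda>z. w(k := snd (snd z), j := fst (snd z), i := fst z))
        \<in> borel \<Otimes>\<^sub>M borel \<Otimes>\<^sub>M borel \<rightarrow>\<^sub>M ?P (insert i (insert j (insert k K')))"
      by (rule measurable_fun_upd[where J = "insert j (insert k K')"], simp)
         (rule measurable_fun_upd[where J = "insert k K'"], simp,
          rule measurable_fun_upd[where J = "K'"], use w in auto)
    from measurable_compose[OF this f[unfolded K'(1)]]
    have F: "(\<lambda>(u, v, x). F u v x) \<in> borel_measurable (borel \<Otimes>\<^sub>M borel \<Otimes>\<^sub>M borel)"
      by (simp add: F_def case_prod_beta')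
    have "f (burke_map \<rho> i j k (w(k := x, j := v, i := u)))
      = F ((1 - \<rho>) * (x + max 0 (u / (1 - \<rho>) - v / \<rho>))) (\<rho> * (x + max 0 (v / \<rho> - u / (1 - \<rho>))))
            (min (u / (1 - \<rho>)) (v / \<rho>))" for u v x
      using K by (auto simp: F_def burke_map_def fun_upd_twist intro!: arg_cong[where f = f])
    then show "(\<integral>\<^sup>+u. \<integral>\<^sup>+v. \<integral>\<^sup>+x. f (burke_map \<rho> i j k (w(k := x, j := v, i := u))) \<partial>expd 1 \<partial>expd 1 \<partial>expd 1)
      = (\<integral>\<^sup>+u. \<integral>\<^sup>+v. \<integral>\<^sup>+x. f (w(k := x, j := v, i := u)) \<partial>expd 1 \<partial>expd 1 \<partial>expd 1)"
      using burke_scaled[OF \<rho> F] by (simp add: F_def)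
  qed
qed

lemma distr_burke_map:
  assumes "0 < \<rho>" "\<rho> < 1" "finite K" "i \<in> K" "j \<in> K" "k \<in> K" "i \<noteq> j" "i \<noteq> k" "j \<noteq> k"
  shows "distr (PiM K (\<lambda>_. expd 1)) (PiM K (\<lambda>_. expd 1)) (burke_map \<rho> i j k) = PiM K (\<lambda>_. expd 1)"
proof (rule measure_eqI)
  fix A assume "A \<in> sets (distr (PiM K (\<lambda>_. expd 1)) (PiM K (\<lambda>_. expd 1)) (burke_map \<rho> i j k))"
  then have A [measurable]: "A \<in> sets (PiM K (\<lambda>_. expd 1))" by simp
  note m [measurable] = measurable_burke_map[OF assms(4-6), of \<rho>]
  have "emeasure (distr (PiM K (\<lambda>_. expd 1)) (PiM K (\<lambda>_. expd 1)) (burke_map \<rho> i j k)) A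
    = (\<integral>\<^sup>+w. indicator A (burke_map \<rho> i j k w) \<partial>PiM K (\<lambda>_. expd 1))"
    using nn_integral_distr[OF m, of "indicator A"] by simp
  also have "\<dots> = emeasure (PiM K (\<lambda>_. expd 1)) A"
    by (subst nn_integral_burke_map[OF assms]) auto
  finally show "emeasure (distr (PiM K (\<lambda>_. expd 1)) (PiM K (\<lambda>_. expd 1)) (burke_map \<rho> i j k)) A
    = emeasure (PiM K (\<lambda>_. expd 1)) A" .
qed simp

subsection \<open>Stationary last-passage percolation\<close>

text \<open>Weights of rate \<open>1 - \<rho>\<close> on the horizontal and \<open>\<rho>\<close> on
  the vertical axis are those for which the one-cell Burke property applies in every cell. Unlike in
  \<open>lpp\<close>, the end weight is counted, and the origin carries none.\<close>

fun stat_lpp :: "real \<Rightarrow> (nat \<times> nat \<Rightarrow> real) \<Rightarrow> nat \<Rightarrow> nat \<Rightarrow> real" where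
  "stat_lpp \<rho> w 0 0 = 0"
| "stat_lpp \<rho> w (Suc a) 0 = stat_lpp \<rho> w a 0 + w (Suc a, 0) / (1 - \<rho>)"
| "stat_lpp \<rho> w 0 (Suc b) = stat_lpp \<rho> w 0 b + w (0, Suc b) / \<rho>"
| "stat_lpp \<rho> w (Suc a) (Suc b) = w (Suc a, Suc b) + max (stat_lpp \<rho> w a (Suc b)) (stat_lpp \<rho> w (Suc a) b)"

primrec burke_row :: "real \<Rightarrow> nat \<Rightarrow> nat \<Rightarrow> (nat \<times> nat \<Rightarrow> real) \<Rightarrow> nat \<times> nat \<Rightarrow> real" where
  "burke_row \<rho> b 0 w = w"
| "burke_row \<rho> b (Suc a) w = burke_map \<rho> (Suc a, 0) (0, b) (Suc a, b) (burke_row \<rho> b a w)"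

primrec burke_rows :: "real \<Rightarrow> nat \<Rightarrow> nat \<Rightarrow> (nat \<times> nat \<Rightarrow> real) \<Rightarrow> nat \<times> nat \<Rightarrow> real" where
  "burke_rows \<rho> n 0 w = w"
| "burke_rows \<rho> n (Suc b) w = burke_row \<rho> (Suc b) n (burke_rows \<rho> n b w)"

text \<open>Slot \<open>(k, 0)\<close> carries the horizontal increment of column \<open>k\<close> along the current row, and slot \<open>(0, b)\<close>
the vertical increment of row \<open>b\<close> along the current column; processing a cell moves both across it.\<close>

lemma burke_row_invariant:
  assumes \<rho>: "0 < \<rho>" "\<rho> < 1"
    and top: "\<And>k. Suc k \<le> n \<Longrightarrow> w' (Suc k, 0) / (1 - \<rho>) = stat_lpp \<rho> w (Suc k) b - stat_lpp \<rho> w k b"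
    and rest: "\<And>k l. b < l \<Longrightarrow> w' (k, l) = w (k, l)"
    and a: "a \<le> n"
  defines "\<eta> \<equiv> burke_row \<rho> (Suc b) a w'"
  shows "\<And>k. Suc k \<le> a \<Longrightarrow> \<eta> (Suc k, 0) / (1 - \<rho>) = stat_lpp \<rho> w (Suc k) (Suc b) - stat_lpp \<rho> w k (Suc b)"
    and "\<And>k. a < k \<Longrightarrow> \<eta> (k, 0) = w' (k, 0)"
    and "\<eta> (0, Suc b) / \<rho> = stat_lpp \<rho> w a (Suc b) - stat_lpp \<rho> w a b"
    and "\<And>k. a < k \<Longrightarrow> \<eta> (k, Suc b) = w (k, Suc b)"
    and "\<And>k l. Suc b < l \<Longrightarrow> \<eta> (k, l) = w (k, l)"
  using a unfolding \<eta>_def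
proof (induction a)
  case 0
  { case 1 then show ?case by simp
  next case 2 then show ?case by simp
  next case 3 then show ?case using rest[of "Suc b" 0] by simp
  next case 4 then show ?case using rest by simp
  next case 5 then show ?case using rest by simp }
next
  case (Suc a)
  define \<zeta> where "\<zeta> = burke_row \<rho> (Suc b) a w'"
  have le: "a \<le> n" "Suc a \<le> n" if "Suc a \<le> n" using that by auto
  note IH = Suc.IH[folded \<zeta>_def]
  have eq: "burke_row \<rho> (Suc b) (Suc a) w' = burke_map \<rho> (Suc a, 0) (0, Suc b) (Suc a, Suc b) \<zeta>"
    by (simp add: \<zeta>_def)
  have u: "\<zeta> (Suc a, 0) / (1 - \<rho>) = stat_lpp \<rho> w (Suc a) b - stat_lpp \<rho> w a b" if "Suc a \<le> n"
    using IH(2)[of "Suc a"] top[of a] that by simp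
  have v: "\<zeta> (0, Suc b) / \<rho> = stat_lpp \<rho> w a (Suc b) - stat_lpp \<rho> w a b" if "Suc a \<le> n"
    using IH(3) that by simp
  have x: "\<zeta> (Suc a, Suc b) = w (Suc a, Suc b)" if "Suc a \<le> n"
    using IH(4)[of "Suc a"] that by simp
  have [simp]: "\<rho> \<noteq> 0" "1 - \<rho> \<noteq> 0" using \<rho> by auto
  { case (1 k)
    then show ?case unfolding eq using IH(1)[of k] u v x \<rho>
      by (cases "k = a") (auto simp: burke_map_def max_def)
  next
    case (2 k) then show ?case unfolding eq using IH(2)[of k] by (simp add: burke_map_def)
  next
    case 3 then show ?case unfolding eq using u v x \<rho> by (auto simp: burke_map_def max_def)
  next
    case (4 k) then show ?case unfolding eq using IH(4)[of k] by (simp add: burke_map_def)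
  next
    case (5 k l) then show ?case unfolding eq using IH(5)[of l k] by (simp add: burke_map_def) }
qed

lemma burke_rows_invariant:
  assumes \<rho>: "0 < \<rho>" "\<rho> < 1"
  shows "Suc k \<le> n \<Longrightarrow> burke_rows \<rho> n b w (Suc k, 0) / (1 - \<rho>) = stat_lpp \<rho> w (Suc k) b - stat_lpp \<rho> w k b"
    and "b < l \<Longrightarrow> burke_rows \<rho> n b w (k, l) = w (k, l)"
proof (induction b arbitrary: k l)
  case 0
  { case 1 then show ?case by simp
  next case 2 then show ?case by simp }
next
  case (Suc b)
  { case 1 then show ?case using burke_row_invariant(1)[OF \<rho> Suc.IH, of n n k] by simp
  next case 2 then show ?case using burke_row_invariant(5)[OF \<rho> Suc.IH, of n n l k] by simp }
qed

text \<open>Up the vertical axis, then along row \<open>m\<close>, where the increments telescope.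
  The two sums depend on each other, but each alone has the law of a sum of i.i.d. unit
  exponentials, which is enough for L1 bounds.\<close>

lemma stat_lpp_eq_increments:
  assumes "0 < \<rho>" "\<rho> < 1"
  shows "stat_lpp \<rho> w n m = (\<Sum>l<m. w (0, Suc l)) / \<rho> + (\<Sum>k<n. burke_rows \<rho> n m w (Suc k, 0)) / (1 - \<rho>)"
proof -
  have "(\<Sum>k<n. burke_rows \<rho> n m w (Suc k, 0)) / (1 - \<rho>) = (\<Sum>k<n. stat_lpp \<rho> w (Suc k) m - stat_lpp \<rho> w k m)"
    unfolding sum_divide_distrib by (intro sum.cong burke_rows_invariant(1)[OF assms]) auto
  also have "\<dots> = stat_lpp \<rho> w n m - stat_lpp \<rho> w 0 m"
    by (rule sum_lessThan_telescope)
  also have "stat_lpp \<rho> w 0 m = (\<Sum>l<m. w (0, Suc l)) / \<rho>"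
    by (induction m) (auto simp: add_divide_distrib)
  finally show ?thesis by simp
qed

lemma burke_rows_measure_preserving:
  assumes \<rho>: "0 < \<rho>" "\<rho> < 1" and K: "finite K" "{..n} \<times> {..m} \<subseteq> K"
  shows "burke_rows \<rho> n m \<in> PiM K (\<lambda>_. expd 1) \<rightarrow>\<^sub>M PiM K (\<lambda>_. expd 1)"
    "distr (PiM K (\<lambda>_. expd 1)) (PiM K (\<lambda>_. expd 1)) (burke_rows \<rho> n m) = PiM K (\<lambda>_. expd 1)"
proof -
  let ?P = "PiM K (\<lambda>_. expd 1)"
  have comp: "(\<lambda>w. f (g w)) \<in> ?P \<rightarrow>\<^sub>M ?P \<and> distr ?P ?P (\<lambda>w. f (g w)) = ?P"
    if "f \<in> ?P \<rightarrow>\<^sub>M ?P \<and> distr ?P ?P f = ?P" "g \<in> ?P \<rightarrow>\<^sub>M ?P \<and> distr ?P ?P g = ?P" for f g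
    using that distr_distr[of f ?P ?P g ?P] measurable_compose[of g ?P ?P f ?P] by (simp add: comp_def)
  have id: "(\<lambda>w. w) \<in> ?P \<rightarrow>\<^sub>M ?P \<and> distr ?P ?P (\<lambda>w. w) = ?P"
    by (simp add: distr_id2)
  have row: "burke_row \<rho> (Suc b) a \<in> ?P \<rightarrow>\<^sub>M ?P \<and> distr ?P ?P (burke_row \<rho> (Suc b) a) = ?P" if "a \<le> n" "Suc b \<le> m" for a b
    using that(1)
  proof (induction a)
    case 0 show ?case using id by simp
  next
    case (Suc a)
    have in_K: "(Suc a, 0) \<in> K" "(0, Suc b) \<in> K" "(Suc a, Suc b) \<in> K"
      using K(2) Suc.prems that(2) by auto
    have "burke_map \<rho> (Suc a, 0) (0, Suc b) (Suc a, Suc b) \<in> ?P \<rightarrow>\<^sub>M ?P \<and>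
        distr ?P ?P (burke_map \<rho> (Suc a, 0) (0, Suc b) (Suc a, Suc b)) = ?P"
      using in_K K \<rho> by (intro conjI measurable_burke_map distr_burke_map) auto
    from comp[OF this] Suc show ?case by simp
  qed
  have rows: "burke_rows \<rho> n b \<in> ?P \<rightarrow>\<^sub>M ?P \<and> distr ?P ?P (burke_rows \<rho> n b) = ?P" if "b \<le> m" for b
    using that
  proof (induction b)
    case 0 show ?case using id by simp
  next
    case (Suc b)
    from comp[OF row[of n b]] Suc show ?case by simp
  qed
  show "burke_rows \<rho> n m \<in> ?P \<rightarrow>\<^sub>M ?P" "distr ?P ?P (burke_rows \<rho> n m) = ?P"
    using rows[of m] by auto
qed

subsection \<open>Concentration of the stationary model\<close>

lemma distributed_exp1: "distributed (expd 1) lborel (\<lambda>x. x) (exponential_density 1)"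
  unfolding distributed_def by (auto simp: distr_id2)

lemma exp1_moments:
  shows "integrable (expd 1) (\<lambda>x. x)" "integrable (expd 1) (\<lambda>x. (x - 1)\<^sup>2)"
    and "(\<integral>x. x \<partial>expd 1) = 1" "(\<integral>x. (x - 1)\<^sup>2 \<partial>expd 1) = 1"
proof -
  have i2: "integrable (expd 1) (\<lambda>x. x\<^sup>2)" and i1: "integrable (expd 1) (\<lambda>x. x)"
    using exp1.erlang_ith_moment_integrable[OF _ distributed_exp1, of 2]
      exp1.erlang_ith_moment_integrable[OF _ distributed_exp1, of 1] by auto
  show "integrable (expd 1) (\<lambda>x. x)" by (fact i1)
  show "integrable (expd 1) (\<lambda>x. (x - 1)\<^sup>2)"
    unfolding power2_diff using i1 i2 by auto
  show e: "(\<integral>x. x \<partial>expd 1) = 1"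
    using exp1.exponential_distributed_expectation[OF _ distributed_exp1] by simp
  show "(\<integral>x. (x - 1)\<^sup>2 \<partial>expd 1) = 1"
    using exp1.exponential_distributed_variance[OF _ distributed_exp1] by (simp add: e)
qed

lemma exp1_AE_nonneg: "AE x in expd 1. 0 \<le> x"
  by (subst AE_density) (auto simp: exponential_density_def)

abbreviation exp_env :: "'i set \<Rightarrow> ('i \<Rightarrow> real) measure" where
  "exp_env K \<equiv> PiM K (\<lambda>_. expd 1)"

lemma prob_space_exp_env: "prob_space (exp_env K)"
  by (intro prob_space_PiM prob_space_exp1)

lemma borel_measurable_exp_env [measurable (raw)]: "k \<in> K \<Longrightarrow> (\<lambda>w. w k) \<in> borel_measurable (exp_env K)"
  using measurable_component_singleton[of k K "\<lambda>_. expd 1"] by simp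

lemma distr_exp_env_component: "k \<in> K \<Longrightarrow> distr (exp_env K) borel (\<lambda>w. w k) = expd 1"
  using distr_PiM_component[of K "\<lambda>_. expd 1" k] prob_space_exp1
  by (simp cong: distr_cong)

lemma exp_env_component:
  fixes f :: "real \<Rightarrow> real"
  assumes [measurable]: "k \<in> K" "f \<in> borel_measurable borel"
  shows "integrable (exp_env K) (\<lambda>w. f (w k)) \<longleftrightarrow> integrable (expd 1) f"
    "(\<integral>w. f (w k) \<partial>exp_env K) = (\<integral>x. f x \<partial>expd 1)"
  using integrable_distr_eq[of "\<lambda>w. w k" "exp_env K" borel f] integral_distr[of "\<lambda>w. w k" "exp_env K" borel f]
  by (simp_all add: distr_exp_env_component assms)

lemma AE_exp_env_nonneg: "countable K \<Longrightarrow> AE w in exp_env K. \<forall>k\<in>K. 0 \<le> w k"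
  by (intro AE_ball_countable[THEN iffD2] ballI AE_PiM_component prob_space_exp1 exp1_AE_nonneg)

lemma exp_env_covariance:
  assumes K: "finite K" "s \<in> K" "t \<in> K"
  shows "integrable (exp_env K) (\<lambda>w. (w s - 1) * (w t - 1))"
    "(\<integral>w. (w s - 1) * (w t - 1) \<partial>exp_env K) = (if s = t then 1 else 0)"
proof -
  have "integrable (exp_env K) (\<lambda>w. (w s - 1) * (w t - 1)) \<and>
    (\<integral>w. (w s - 1) * (w t - 1) \<partial>exp_env K) = (if s = t then 1 else 0)"
  proof (cases "s = t")
    case True
    have "(\<lambda>w. (w s - 1) * (w t - 1)) = (\<lambda>w. (w s - 1 :: real)\<^sup>2)"
      by (simp add: True power2_eq_square)
    then show ?thesis
      using exp_env_component[OF K(2), of "\<lambda>x. (x - 1)\<^sup>2"] exp1_moments(2,4) True by simp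
  next
    case False
    define f :: "'a \<Rightarrow> real \<Rightarrow> real" where "f i x = (if i \<in> {s, t} then x - 1 else 1)" for i x
    have i0: "integrable (expd 1) (\<lambda>x. x - 1)" "(\<integral>x. x - 1 \<partial>expd 1) = 0"
      using exp1_moments(1,3) using exp1.prob_space by simp_all
    have fi: "integrable (expd 1) (f i)" for i
      using i0(1) by (cases "i \<in> {s, t}") (simp_all add: f_def[abs_def])
    have e: "(\<Prod>i\<in>K. f i (w i)) = (w s - 1) * (w t - 1)" for w
    proof -
      have "(\<Prod>i\<in>K. f i (w i)) = (\<Prod>i\<in>{s, t}. f i (w i))"
        using K by (intro prod.mono_neutral_right) (simp_all add: f_def)
      also have "\<dots> = (w s - 1) * (w t - 1)" using False by (simp add: f_def)
      finally show ?thesis .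
    qed
    have "(\<integral>x. f s x \<partial>expd 1) = 0" using i0(2) by (simp add: f_def)
    then have "(\<Prod>i\<in>K. \<integral>x. f i x \<partial>expd 1) = 0"
      using K(1,2) by (intro prod_zero bexI[of _ s])
    then show ?thesis
      using exp1_prod.product_integrable_prod[OF K(1), of f, OF fi]
        exp1_prod.product_integral_prod[OF K(1), of f, OF fi] False
      by (simp add: e)
  qed
  then show "integrable (exp_env K) (\<lambda>w. (w s - 1) * (w t - 1))"
    "(\<integral>w. (w s - 1) * (w t - 1) \<partial>exp_env K) = (if s = t then 1 else 0)" by auto
qed

lemma exp_env_sum_deviation:
  assumes K: "finite K" "S \<subseteq> K"
  shows "integrable (exp_env K) (\<lambda>w. \<Sum>s\<in>S. w s)"
    "(\<integral>w. \<bar>(\<Sum>s\<in>S. w s) - card S\<bar> \<partial>exp_env K) \<le> sqrt (card S)"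
proof -
  interpret P: prob_space "exp_env K" by (rule prob_space_exp_env)
  have fS: "finite S" by (rule finite_subset[OF K(2,1)])
  have "integrable (exp_env K) (\<lambda>w. w s)" if "s \<in> S" for s
    by (rule iffD2[OF exp_env_component(1)[OF subsetD[OF K(2) that], of "\<lambda>x. x"] exp1_moments(1)]) simp
  then show int: "integrable (exp_env K) (\<lambda>w. \<Sum>s\<in>S. w s)" by auto
  show "(\<integral>w. \<bar>(\<Sum>s\<in>S. w s) - card S\<bar> \<partial>exp_env K) \<le> sqrt (card S)"
  proof (cases "S = {}")
    case False
    define n where "n = card S"
    have n: "n > 0" using False fS by (auto simp: n_def card_gt_0_iff)
    define Y where "Y w = (\<Sum>s\<in>S. w s) - real n" for w
    have Y: "(Y w)\<^sup>2 = (\<Sum>s\<in>S. \<Sum>t\<in>S. (w s - 1) * (w t - 1))" for w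
    proof -
      have "Y w = (\<Sum>s\<in>S. w s - 1)" by (simp add: Y_def sum_subtractf n_def)
      then show ?thesis by (simp add: power2_eq_square sum_product)
    qed
    have c1: "integrable (exp_env K) (\<lambda>w. (w s - 1) * (w t - 1))" if "s \<in> S" "t \<in> S" for s t
      using that K by (intro exp_env_covariance) auto
    have c2: "(\<integral>w. (w s - 1) * (w t - 1) \<partial>exp_env K) = (if s = t then 1 else 0)" if "s \<in> S" "t \<in> S" for s t
      using that K by (intro exp_env_covariance) auto
    have c3: "integrable (exp_env K) (\<lambda>w. \<Sum>t\<in>S. (w s - 1) * (w t - 1))" if "s \<in> S" for s
      by (rule Bochner_Integration.integrable_sum) (rule c1[OF that])
    have iY2: "integrable (exp_env K) (\<lambda>w. (Y w)\<^sup>2)"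
      unfolding Y by (rule Bochner_Integration.integrable_sum) (rule c3)
    have "(\<integral>w. (Y w)\<^sup>2 \<partial>exp_env K) = (\<Sum>s\<in>S. \<integral>w. (\<Sum>t\<in>S. (w s - 1) * (w t - 1)) \<partial>exp_env K)"
      unfolding Y by (rule Bochner_Integration.integral_sum) (rule c3)
    also have "\<dots> = (\<Sum>s\<in>S. \<Sum>t\<in>S. if s = t then 1 else 0)"
    proof (rule sum.cong[OF refl])
      fix s assume s: "s \<in> S"
      have "(\<integral>w. (\<Sum>t\<in>S. (w s - 1) * (w t - 1)) \<partial>exp_env K) = (\<Sum>t\<in>S. \<integral>w. (w s - 1) * (w t - 1) \<partial>exp_env K)"
        by (rule Bochner_Integration.integral_sum) (rule c1[OF s])
      then show "(\<integral>w. (\<Sum>t\<in>S. (w s - 1) * (w t - 1)) \<partial>exp_env K) = (\<Sum>t\<in>S. if s = t then 1 else 0)"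
        using c2[OF s] by simp
    qed
    finally have EY2: "(\<integral>w. (Y w)\<^sup>2 \<partial>exp_env K) = n"
      using fS by (simp add: n_def)
    have "(\<integral>w. \<bar>Y w\<bar> \<partial>exp_env K) \<le> (\<integral>w. ((Y w)\<^sup>2 / sqrt n + sqrt n) / 2 \<partial>exp_env K)"
    proof (rule integral_mono)
      show "integrable (exp_env K) (\<lambda>w. \<bar>Y w\<bar>)" using int by (auto simp: Y_def)
      show "integrable (exp_env K) (\<lambda>w. ((Y w)\<^sup>2 / sqrt n + sqrt n) / 2)" using iY2 by auto
      fix w
      \<comment> \<open>This expands to |Y| <= (Y^2 / sqrt n + sqrt n) / 2, a linearised
        Cauchy-Schwarz inequality whose mean is \<open>sqrt n\<close> because Y has variance
        n.\<close>
      have "0 \<le> (\<bar>Y w\<bar> - sqrt n)\<^sup>2" by simp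
      then have "2 * \<bar>Y w\<bar> * sqrt n \<le> (Y w)\<^sup>2 + n" by (simp add: power2_diff)
      then show "\<bar>Y w\<bar> \<le> ((Y w)\<^sup>2 / sqrt n + sqrt n) / 2"
        using n by (simp add: field_simps)
    qed
    also have "\<dots> = sqrt n"
      using iY2 EY2 n by (simp add: P.prob_space field_simps)
    finally show ?thesis by (simp add: Y_def n_def)
  qed simp
qed

text \<open>Since \<open>burke_rows\<close> preserves the measure, the increments along row
  \<open>n\<close> of the sweep have the same law as the initial axis weights; the triangle
  inequality then reduces the claim to two sums of independent variables.\<close>

lemma stat_lpp_deviation:
  assumes \<rho>: "0 < \<rho>" "\<rho> < 1" and K: "finite K" "{..n} \<times> {..m} \<subseteq> K"
  shows "integrable (exp_env K) (\<lambda>w. stat_lpp \<rho> w n m)"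
    "(\<integral>w. \<bar>stat_lpp \<rho> w n m - (n / (1 - \<rho>) + m / \<rho>)\<bar> \<partial>exp_env K) \<le> sqrt n / (1 - \<rho>) + sqrt m / \<rho>"
proof -
  define S where "S = (\<lambda>l. (0::nat, Suc l)) ` {..<m}"
  define T where "T = (\<lambda>k. (Suc k, 0::nat)) ` {..<n}"
  have S: "S \<subseteq> K" "card S = m" "\<And>f. (\<Sum>s\<in>S. f s) = (\<Sum>l<m. f (0, Suc l))"
    using K unfolding S_def by (auto simp: card_image inj_on_def sum.reindex)
  have T: "T \<subseteq> K" "card T = n" "\<And>f. (\<Sum>s\<in>T. f s) = (\<Sum>l<n. f (Suc l, 0))"
    using K unfolding T_def by (auto simp: card_image inj_on_def sum.reindex)
  note mp [measurable] = burke_rows_measure_preserving[OF \<rho> K]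
  note dS = exp_env_sum_deviation[OF K(1) S(1)] and dT = exp_env_sum_deviation[OF K(1) T(1)]
  let ?B = "burke_rows \<rho> n m"
  have Tm [measurable]: "(\<lambda>w. \<Sum>s\<in>T. w s) \<in> borel_measurable (exp_env K)" using dT(1) by auto
  have iB: "integrable (exp_env K) (\<lambda>w. \<Sum>s\<in>T. ?B w s)"
    using integrable_distr_eq[OF mp(1), of "\<lambda>w. \<Sum>s\<in>T. w s"] dT(1) Tm by (simp add: mp(2))
  have eB: "(\<integral>w. \<bar>(\<Sum>s\<in>T. ?B w s) - n\<bar> \<partial>exp_env K) \<le> sqrt n"
    using integral_distr[OF mp(1), of "\<lambda>w. \<bar>(\<Sum>s\<in>T. w s) - n\<bar>"] dT(2) by (simp add: mp(2) T(2))
  have eq: "stat_lpp \<rho> w n m = (\<Sum>s\<in>S. w s) / \<rho> + (\<Sum>s\<in>T. ?B w s) / (1 - \<rho>)" for w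
    unfolding stat_lpp_eq_increments[OF \<rho>] S(3) T(3) ..
  show int: "integrable (exp_env K) (\<lambda>w. stat_lpp \<rho> w n m)"
    unfolding eq using dS(1) iB by auto
  have "(\<integral>w. \<bar>stat_lpp \<rho> w n m - (n / (1 - \<rho>) + m / \<rho>)\<bar> \<partial>exp_env K)
    \<le> (\<integral>w. \<bar>(\<Sum>s\<in>S. w s) - m\<bar> / \<rho> + \<bar>(\<Sum>s\<in>T. ?B w s) - n\<bar> / (1 - \<rho>) \<partial>exp_env K)"
  proof (rule integral_mono)
    interpret P: prob_space "exp_env K" by (rule prob_space_exp_env)
    show "integrable (exp_env K) (\<lambda>w. \<bar>stat_lpp \<rho> w n m - (n / (1 - \<rho>) + m / \<rho>)\<bar>)"
      using int by auto
    show "integrable (exp_env K) (\<lambda>w. \<bar>(\<Sum>s\<in>S. w s) - m\<bar> / \<rho> + \<bar>(\<Sum>s\<in>T. ?B w s) - n\<bar> / (1 - \<rho>))"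
      using dS(1) iB by auto
    fix w :: "nat \<times> nat \<Rightarrow> real"
    have "stat_lpp \<rho> w n m - (n / (1 - \<rho>) + m / \<rho>) = ((\<Sum>s\<in>S. w s) - m) / \<rho> + ((\<Sum>s\<in>T. ?B w s) - n) / (1 - \<rho>)"
      unfolding eq by (simp add: diff_divide_distrib)
    also have "\<bar>\<dots>\<bar> \<le> \<bar>((\<Sum>s\<in>S. w s) - m) / \<rho>\<bar> + \<bar>((\<Sum>s\<in>T. ?B w s) - n) / (1 - \<rho>)\<bar>"
      by (rule abs_triangle_ineq)
    finally show "\<bar>stat_lpp \<rho> w n m - (n / (1 - \<rho>) + m / \<rho>)\<bar>
      \<le> \<bar>(\<Sum>s\<in>S. w s) - m\<bar> / \<rho> + \<bar>(\<Sum>s\<in>T. ?B w s) - n\<bar> / (1 - \<rho>)"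
      using \<rho> by simp
  qed
  also have "\<dots> = (\<integral>w. \<bar>(\<Sum>s\<in>S. w s) - m\<bar> \<partial>exp_env K) / \<rho> + (\<integral>w. \<bar>(\<Sum>s\<in>T. ?B w s) - n\<bar> \<partial>exp_env K) / (1 - \<rho>)"
  proof -
    interpret P: prob_space "exp_env K" by (rule prob_space_exp_env)
    show ?thesis using dS(1) iB by (subst Bochner_Integration.integral_add) auto
  qed
  also have "\<dots> \<le> sqrt m / \<rho> + sqrt n / (1 - \<rho>)"
    using dS(2) eB \<rho> by (intro add_mono divide_right_mono) (auto simp: S(2))
  finally show "(\<integral>w. \<bar>stat_lpp \<rho> w n m - (n / (1 - \<rho>) + m / \<rho>)\<bar> \<partial>exp_env K) \<le> sqrt n / (1 - \<rho>) + sqrt m / \<rho>"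
    by simp
qed

subsection \<open>The homogeneous model\<close>

lemma exp_env_mean:
  assumes "k \<in> K"
  shows "integrable (exp_env K) (\<lambda>w. w k)" "(\<integral>w. w k \<partial>exp_env K) = 1"
proof -
  note c = exp_env_component[OF assms, of "\<lambda>x. x"]
  show "integrable (exp_env K) (\<lambda>w. w k)"
    by (rule iffD2[OF c(1) exp1_moments(1)]) simp
  show "(\<integral>w. w k \<partial>exp_env K) = 1"
    by (rule trans[OF c(2) exp1_moments(3)]) simp
qed

lemma exp_env_reindex:
  assumes "inj_on t I" "t \<in> I \<rightarrow> K"
  shows "distr (exp_env K) (exp_env I) (\<lambda>w. \<lambda>i\<in>I. w (t i)) = exp_env I"
  using distr_PiM_reindex[of K "\<lambda>_. expd 1" t I] assms prob_space_exp1 by simp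

lemma measurable_exp_env_reindex:
  "t \<in> I \<rightarrow> K \<Longrightarrow> (\<lambda>w. \<lambda>i\<in>I. w (t i)) \<in> exp_env K \<rightarrow>\<^sub>M exp_env I"
  by (intro measurable_restrict measurable_component_singleton) auto

lemma exp_env_reindex_integral:
  fixes f :: "_ \<Rightarrow> real"
  assumes t: "inj_on t I" "t \<in> I \<rightarrow> K" and f: "f \<in> borel_measurable (exp_env I)"
  shows "integrable (exp_env K) (\<lambda>w. f (\<lambda>i\<in>I. w (t i))) \<longleftrightarrow> integrable (exp_env I) f"
    "(\<integral>w. f (\<lambda>i\<in>I. w (t i)) \<partial>exp_env K) = (\<integral>w. f w \<partial>exp_env I)"
  using integrable_distr_eq[OF measurable_exp_env_reindex[OF t(2)] f] integral_distr[OF measurable_exp_env_reindex[OF t(2)] f]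
  by (simp_all add: exp_env_reindex[OF t])

text \<open>Transfers to an infinite index set what the Burke argument yields on finite boxes, for
  functions of finitely many coordinates in particular.\<close>

lemma exp_env_restrict:
  fixes f :: "_ \<Rightarrow> real"
  assumes K: "K \<subseteq> L" and f: "f \<in> borel_measurable (exp_env K)" and loc: "\<And>w. f (restrict w K) = f w"
  shows "integrable (exp_env L) f \<longleftrightarrow> integrable (exp_env K) f"
    "(\<integral>w. f w \<partial>exp_env L) = (\<integral>w. f w \<partial>exp_env K)"
proof -
  have t: "inj_on (\<lambda>i. i) K" "(\<lambda>i. i) \<in> K \<rightarrow> L" using K by auto
  show "integrable (exp_env L) f \<longleftrightarrow> integrable (exp_env K) f"
    "(\<integral>w. f w \<partial>exp_env L) = (\<integral>w. f w \<partial>exp_env K)"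
    using exp_env_reindex_integral[OF t f] by (simp_all add: loc restrict_def flip: restrict_def)
qed

lemma stat_lpp_cong:
  assumes "\<And>k. k \<in> {..n} \<times> {..m} \<Longrightarrow> w k = w' k"
  shows "stat_lpp \<rho> w n m = stat_lpp \<rho> w' n m"
  using assms by (induction \<rho> w n m rule: stat_lpp.induct) auto

lemma stat_lpp_deviation_UNIV:
  assumes \<rho>: "0 < \<rho>" "\<rho> < 1"
  shows "integrable (exp_env UNIV) (\<lambda>w. stat_lpp \<rho> w n m)"
    "(\<integral>w. \<bar>stat_lpp \<rho> w n m - (n / (1 - \<rho>) + m / \<rho>)\<bar> \<partial>exp_env UNIV) \<le> sqrt n / (1 - \<rho>) + sqrt m / \<rho>"
proof -
  let ?K = "{..n} \<times> {..m}"
  note d = stat_lpp_deviation[OF \<rho>, of ?K n m, simplified]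
  have loc: "stat_lpp \<rho> (restrict w ?K) n m = stat_lpp \<rho> w n m" for w
    by (rule stat_lpp_cong) auto
  show "integrable (exp_env UNIV) (\<lambda>w. stat_lpp \<rho> w n m)"
    using exp_env_restrict(1)[of ?K UNIV "\<lambda>w. stat_lpp \<rho> w n m"] d(1) loc by auto
  show "(\<integral>w. \<bar>stat_lpp \<rho> w n m - (n / (1 - \<rho>) + m / \<rho>)\<bar> \<partial>exp_env UNIV) \<le> sqrt n / (1 - \<rho>) + sqrt m / \<rho>"
    using exp_env_restrict(2)[of ?K UNIV "\<lambda>w. \<bar>stat_lpp \<rho> w n m - (n / (1 - \<rho>) + m / \<rho>)\<bar>"] d loc by auto
qed

lemma exp_env_sum_deviation_UNIV:
  assumes S: "finite S"
  shows "integrable (exp_env UNIV) (\<lambda>w. \<Sum>s\<in>S. w s)"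
    "(\<integral>w. \<bar>(\<Sum>s\<in>S. w s) - card S\<bar> \<partial>exp_env UNIV) \<le> sqrt (card S)"
    "(\<integral>w. (\<Sum>s\<in>S. w s) \<partial>exp_env UNIV) = card S"
proof -
  note d = exp_env_sum_deviation[OF S order.refl]
  show "integrable (exp_env UNIV) (\<lambda>w. \<Sum>s\<in>S. w s)"
    using exp_env_restrict(1)[of S UNIV "\<lambda>w. \<Sum>s\<in>S. w s"] d(1) by auto
  show "(\<integral>w. \<bar>(\<Sum>s\<in>S. w s) - card S\<bar> \<partial>exp_env UNIV) \<le> sqrt (card S)"
    using exp_env_restrict(2)[of S UNIV "\<lambda>w. \<bar>(\<Sum>s\<in>S. w s) - card S\<bar>"] d by auto
  show "(\<integral>w. (\<Sum>s\<in>S. w s) \<partial>exp_env UNIV) = card S"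
    by (subst Bochner_Integration.integral_sum) (auto simp: exp_env_mean)
qed

section \<open>Exit points of stationary geodesics and the homogeneous mean\<close>

text \<open>Passage time from (1, 1) with the end weight counted, extended by 0 to the axes: this
  extension obeys the recursion of \<open>stat_lpp\<close> off the axes.\<close>

definition bulk :: "(nat \<times> nat \<Rightarrow> real) \<Rightarrow> nat \<Rightarrow> nat \<Rightarrow> real" where
  "bulk w a b = (if a = 0 \<or> b = 0 then 0 else lpp (\<lambda>i j. w (Suc i, Suc j)) (a - 1) (b - 1) + w (a, b))"

lemma bulk_axis [simp]: "bulk w a 0 = 0" "bulk w 0 b = 0"
  by (auto simp: bulk_def)

lemma bulk_nonneg: "(\<And>k. 0 \<le> w k) \<Longrightarrow> 0 \<le> bulk w a b"
  by (auto simp: bulk_def intro!: add_nonneg_nonneg lpp_nonneg)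

text \<open>Nonnegative weights make the value 0 on an axis lose the maximum, so it does not disturb
  the recursion in the first row and column.\<close>

lemma bulk_rec:
  assumes "\<And>k. 0 \<le> w k"
  shows "bulk w (Suc a) (Suc b) = w (Suc a, Suc b) + max (bulk w a (Suc b)) (bulk w (Suc a) b)"
proof -
  have "0 \<le> lpp (\<lambda>i j. w (Suc i, Suc j)) c d + w k" for c d k
    using assms by (intro add_nonneg_nonneg lpp_nonneg)
  then show ?thesis by (cases a; cases b) (simp_all add: bulk_def max_absorb1 max_absorb2)
qed

lemma bulk_le_stat_lpp:
  assumes "\<And>k. 0 \<le> w k" "0 < \<rho>" "\<rho> < 1"
  shows "0 \<le> stat_lpp \<rho> w a b \<and> bulk w a b \<le> stat_lpp \<rho> w a b"
  using assms
proof (induction \<rho> w a b rule: stat_lpp.induct)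
  case (4 \<rho> w a b)
  then show ?case using bulk_rec[of w a b] by (auto simp: max_def)
qed simp_all

text \<open>The geodesic of the stationary model leaves the axes either before distance \<open>p\<close>, or it leaves the
horizontal (vertical) axis after distance \<open>p\<close>; in the latter case raising (lowering) \<open>\<rho>\<close> gains on
at least the first \<open>p\<close> weights of that axis.\<close>

lemma stat_lpp_exit:
  assumes w: "\<And>k. 0 \<le> w k" and d: "0 \<le> d" "d < 1 / 2"
  defines "c \<equiv> 1 / (1 / 2 - d) - 2"
  defines "H \<equiv> \<lambda>p. \<Sum>k<p. w (Suc k, 0)" and "V \<equiv> \<lambda>p. \<Sum>l<p. w (0, Suc l)"
  shows "stat_lpp (1/2) w a b \<le> max (2 * H p + 2 * V p + bulk w a b)
    (max (stat_lpp (1/2 + d) w a b - c * H p) (stat_lpp (1/2 - d) w a b - c * V p))"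
    (is "?s a b \<le> max (?A a b) (max (?B a b) (?C a b))")
proof -
  have mono: "H k \<le> H l" "V k \<le> V l" if "k \<le> l" for k l
    unfolding H_def V_def using w that by (auto intro!: sum_mono2)
  have nonneg: "0 \<le> H k" "0 \<le> V k" for k unfolding H_def V_def using w by (auto intro: sum_nonneg)
  \<comment> \<open>\<open>c\<close> is the growth of the horizontal factor 1 / (1 - \<rho>) when
    \<rho> rises from 1/2 to 1/2 + d, and equally of the vertical factor 1 / \<rho> when \<rho>
    falls to 1/2 - d.\<close>
  have c: "0 \<le> c" using d by (auto simp: c_def field_simps)
  have hor: "stat_lpp r w a 0 = H a / (1 - r)" for r a
    by (induction a) (auto simp: H_def add_divide_distrib)
  have ver: "stat_lpp r w 0 b = V b / r" for r b
    by (induction b) (auto simp: V_def add_divide_distrib)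
  have axis1: "?s a 0 \<le> max (?A a 0) (max (?B a 0) (?C a 0))" for a
  proof (cases "a \<le> p")
    case True
    then have "?s a 0 \<le> ?A a 0" using mono(1)[OF True] nonneg(2)[of p] by (simp add: hor)
    then show ?thesis by linarith
  next
    case False
    have "?B a 0 - ?s a 0 = c * (H a - H p)"
      by (simp add: hor c_def diff_divide_distrib algebra_simps)
    then have "?s a 0 \<le> ?B a 0" using c mono(1)[of p a] False by (smt (verit) mult_nonneg_nonneg nat_le_linear)
    then show ?thesis by linarith
  qed
  have axis2: "?s 0 b \<le> max (?A 0 b) (max (?B 0 b) (?C 0 b))" for b
  proof (cases "b \<le> p")
    case True
    then have "?s 0 b \<le> ?A 0 b" using mono(2)[OF True] nonneg(1)[of p] by (simp add: ver)
    then show ?thesis by linarith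
  next
    case False
    have "?C 0 b - ?s 0 b = c * (V b - V p)"
      by (simp add: ver c_def diff_divide_distrib algebra_simps)
    then have "?s 0 b \<le> ?C 0 b" using c mono(2)[of p b] False by (smt (verit) mult_nonneg_nonneg nat_le_linear)
    then show ?thesis by linarith
  qed
  show ?thesis
  proof (induction "a + b" arbitrary: a b rule: less_induct)
    case less
    show ?case
    proof (cases "a = 0 \<or> b = 0")
      case True then show ?thesis using axis1 axis2 by auto
    next
      case False
      then obtain a' b' where ab: "a = Suc a'" "b = Suc b'" by (metis not0_implies_Suc)
      have 1: "?s a' b \<le> max (?A a' b) (max (?B a' b) (?C a' b))" by (rule less) (simp add: ab)
      have 2: "?s a b' \<le> max (?A a b') (max (?B a b') (?C a b'))" by (rule less) (simp add: ab)
      \<comment> \<open>All four quantities satisfy the same recursion, since the subtracted or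
        added axis sums are constants; the inequality therefore spreads from the axes.\<close>
      have "?s a b = w (a, b) + max (?s a' b) (?s a b')"
        "?A a b = w (a, b) + max (?A a' b) (?A a b')"
        "?B a b = w (a, b) + max (?B a' b) (?B a b')"
        "?C a b = w (a, b) + max (?C a' b) (?C a b')"
        using bulk_rec[of w a' b'] w by (auto simp: ab max_def)
      then show ?thesis using 1 2 by linarith
    qed
  qed
qed

lemma borel_measurable_hom_lpp [measurable]:
  "(\<lambda>w. lpp (\<lambda>i j. w (t i j)) a b) \<in> borel_measurable (exp_env UNIV)"
  by (intro borel_measurable_lpp) simp

lemma integrable_hom_lpp: "integrable (exp_env UNIV) (\<lambda>w. lpp (\<lambda>i j. w (t i j)) a b)"
proof (rule Bochner_Integration.integrable_bound)
  show "integrable (exp_env UNIV) (\<lambda>w. \<Sum>i\<le>a. \<Sum>j\<le>b. w (t i j))"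
    by (intro Bochner_Integration.integrable_sum exp_env_mean) simp
  have "AE w in exp_env UNIV. 0 \<le> w (t i j)" for i j
    by (rule AE_PiM_component) (auto simp: prob_space_exp1 exp1_AE_nonneg)
  then have "AE w in exp_env UNIV. \<forall>i j. 0 \<le> w (t i j)"
    by (simp add: AE_all_countable)
  then show "AE w in exp_env UNIV. norm (lpp (\<lambda>i j. w (t i j)) a b) \<le> norm (\<Sum>i\<le>a. \<Sum>j\<le>b. w (t i j))"
  proof eventually_elim
    case (elim w)
    then show ?case
      using lpp_le_sum[of "\<lambda>i j. w (t i j)" a b] lpp_nonneg[of "\<lambda>i j. w (t i j)" a b] by auto
  qed
qed simp

text \<open>Only the law of the weights matters, so every injective placement of the lattice gives the same law.\<close>

lemma hom_lpp_reindex: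
  fixes t :: "nat \<Rightarrow> nat \<Rightarrow> 'i" and g :: "real \<Rightarrow> real"
  assumes t: "\<And>i j i' j'. t i j = t i' j' \<Longrightarrow> i = i' \<and> j = j'" and [measurable]: "g \<in> borel_measurable borel"
  shows "(\<integral>w. g (lpp (\<lambda>i j. w (t i j)) a b) \<partial>exp_env UNIV) = (\<integral>w. g (lpp (\<lambda>i j. w (i, j)) a b) \<partial>exp_env UNIV)"
proof -
  have inj: "inj_on (\<lambda>(i, j). t i j) UNIV" using t by (auto simp: inj_on_def)
  have "(\<lambda>w. g (lpp (\<lambda>i j. w (i, j)) a b)) \<in> borel_measurable (exp_env UNIV)" by measurable
  from exp_env_reindex_integral(2)[OF inj _ this, of UNIV] show ?thesis by simp
qed

text \<open>Moved by (1, 1), the homogeneous model is the bulk of the stationary one with \<rho> =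
  1/2, whose mean at \<open>(a + 1, b + 1)\<close> is 2a + 2b + 4. The mean excess is kept, not only
  the mean, because it later supplies uniform integrability.\<close>

lemma hom_lpp_upper:
  "(\<integral>w. max 0 (lpp (\<lambda>i j. w (i, j)) a b - (2 * a + 2 * b + 4)) \<partial>exp_env UNIV) \<le> 2 * sqrt (a + 1) + 2 * sqrt (b + 1)"
proof -
  have "(\<integral>w. max 0 (lpp (\<lambda>i j. w (i, j)) a b - (2 * a + 2 * b + 4)) \<partial>exp_env UNIV)
    = (\<integral>w. max 0 (lpp (\<lambda>i j. w (Suc i, Suc j)) a b - (2 * a + 2 * b + 4)) \<partial>exp_env UNIV)"
    using hom_lpp_reindex[of "\<lambda>i j. (Suc i, Suc j)" "\<lambda>x. max 0 (x - (2 * a + 2 * b + 4))" a b] by simp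
  also have "\<dots> \<le> (\<integral>w. \<bar>stat_lpp (1/2) w (Suc a) (Suc b) - (Suc a / (1 - 1/2) + Suc b / (1/2))\<bar> \<partial>exp_env UNIV)"
  proof (rule integral_mono_AE)
    interpret P: prob_space "exp_env (UNIV :: (nat \<times> nat) set)" by (rule prob_space_exp_env)
    show "integrable (exp_env UNIV) (\<lambda>w. max 0 (lpp (\<lambda>i j. w (Suc i, Suc j)) a b - (2 * a + 2 * b + 4)))"
      using integrable_hom_lpp[of "\<lambda>i j. (Suc i, Suc j)" a b] by auto
    show "integrable (exp_env UNIV) (\<lambda>w. \<bar>stat_lpp (1/2) w (Suc a) (Suc b) - (Suc a / (1 - 1/2) + Suc b / (1/2))\<bar>)"
      using stat_lpp_deviation_UNIV(1)[of "1/2" "Suc a" "Suc b"] by auto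
    have "AE w in exp_env UNIV. \<forall>k::nat \<times> nat. 0 \<le> w k"
      using AE_exp_env_nonneg[of "UNIV :: (nat \<times> nat) set"] by simp
    then show "AE w in exp_env UNIV. max 0 (lpp (\<lambda>i j. w (Suc i, Suc j)) a b - (2 * a + 2 * b + 4))
      \<le> \<bar>stat_lpp (1/2) w (Suc a) (Suc b) - (Suc a / (1 - 1/2) + Suc b / (1/2))\<bar>"
    proof eventually_elim
      case (elim w)
      have "0 \<le> w (Suc a, Suc b)" using elim by simp
      moreover have "lpp (\<lambda>i j. w (Suc i, Suc j)) a b + w (Suc a, Suc b) \<le> stat_lpp (1/2) w (Suc a) (Suc b)"
        using bulk_le_stat_lpp[of w "1/2" "Suc a" "Suc b"] elim by (simp add: bulk_def del: stat_lpp.simps)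
      ultimately have "lpp (\<lambda>i j. w (Suc i, Suc j)) a b \<le> stat_lpp (1/2) w (Suc a) (Suc b)"
        by linarith
      then show ?case by simp
    qed
  qed
  also have "\<dots> \<le> sqrt (Suc a) / (1 - 1/2) + sqrt (Suc b) / (1/2)"
    by (rule stat_lpp_deviation_UNIV) auto
  finally show ?thesis by (simp add: mult.commute add.commute)
qed

lemma hom_lpp_mean_upper:
  "(\<integral>w. lpp (\<lambda>i j. w (i, j)) a b \<partial>exp_env UNIV) \<le> 2 * a + 2 * b + 4 + 2 * sqrt (a + 1) + 2 * sqrt (b + 1)"
proof -
  interpret P: prob_space "exp_env (UNIV :: (nat \<times> nat) set)" by (rule prob_space_exp_env)
  have "(\<integral>w. lpp (\<lambda>i j. w (i, j)) a b - (2 * a + 2 * b + 4) \<partial>exp_env UNIV)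
    \<le> (\<integral>w. max 0 (lpp (\<lambda>i j. w (i, j)) a b - (2 * a + 2 * b + 4)) \<partial>exp_env UNIV)"
    using integrable_hom_lpp[of "\<lambda>i j. (i, j)" a b] by (intro integral_mono) auto
  then show ?thesis
    using hom_lpp_upper[of a b] integrable_hom_lpp[of "\<lambda>i j. (i, j)" a b] P.prob_space by (simp add: add.commute[of 1])
qed

text \<open>\<open>L\<close> is the allowed exit distance, a fraction 1/M of \<open>N\<close>.
  Exiting later would require a deviation of order N while fluctuations in mean are of order sqrt N;
  exiting earlier costs at most the first \<open>L\<close> weights of each axis, with total mean
  \<open>4 * L\<close>.\<close>

lemma hom_bulk_lower:
  fixes M L :: nat
  assumes M: "M \<ge> 1" and L: "L \<ge> 1"
  defines "N \<equiv> M * L"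
  shows "4 * real N - 4 * real L - (20 + 256 * M\<^sup>2) * sqrt N \<le> (\<integral>w. bulk w N N \<partial>exp_env UNIV)"
proof -
  interpret P: prob_space "exp_env (UNIV :: (nat \<times> nat) set)" by (rule prob_space_exp_env)
  \<comment> \<open>To leading order the tilted models are typically larger than 4N by 16 d^2 N, and
    removing the first \<open>L\<close> axis weights takes away c L, about 4 d L. This
    \<open>d\<close> gives L = 8 d N, so the removal 32 d^2 N is twice the rise.\<close>
  define d where "d = 1 / (8 * real M)"
  have M0: "0 < real M" and L0: "0 < real L" using M L by auto
  have d: "0 < d" "d \<le> 1/8" using M by (auto simp: d_def field_simps)
  have N: "real N = real M * real L" "1 \<le> N" using M L by (auto simp: N_def)
  define c where "c = 1 / (1 / 2 - d) - 2"
  have c_eq: "c = 4 * d / (1 - 2 * d)" using d by (simp add: c_def field_simps)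
  have c: "0 \<le> c" "c \<le> 1" unfolding c_eq using d by (auto simp: field_simps)
  define H :: "(nat \<times> nat \<Rightarrow> real) \<Rightarrow> real" where "H w = (\<Sum>k<L. w (Suc k, 0))" for w
  define V :: "(nat \<times> nat \<Rightarrow> real) \<Rightarrow> real" where "V w = (\<Sum>k<L. w (0, Suc k))" for w
  define SH where "SH = (\<lambda>k. (Suc k, 0::nat)) ` {..<L}"
  define SV where "SV = (\<lambda>k. (0::nat, Suc k)) ` {..<L}"
  have Hs: "H = (\<lambda>w. sum w SH)" "card SH = L" "finite SH"
    by (auto simp: H_def SH_def sum.reindex inj_on_def card_image)
  have Vs: "V = (\<lambda>w. sum w SV)" "card SV = L" "finite SV"
    by (auto simp: V_def SV_def sum.reindex inj_on_def card_image)
  have Hd: "integrable (exp_env UNIV) H" "(\<integral>w. \<bar>H w - L\<bar> \<partial>exp_env UNIV) \<le> sqrt L" "(\<integral>w. H w \<partial>exp_env UNIV) = L"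
    unfolding Hs(1) Hs(2)[symmetric] by (rule exp_env_sum_deviation_UNIV[OF Hs(3)])+
  have Vd: "integrable (exp_env UNIV) V" "(\<integral>w. \<bar>V w - L\<bar> \<partial>exp_env UNIV) \<le> sqrt L" "(\<integral>w. V w \<partial>exp_env UNIV) = L"
    unfolding Vs(1) Vs(2)[symmetric] by (rule exp_env_sum_deviation_UNIV[OF Vs(3)])+
  \<comment> \<open>The common mean of both tilted models at \<open>(N, N)\<close>; the next line's
    \<open>g\<close> is the gap by which a late exit typically falls short of 4N.\<close>
  define m where "m = N / (1/2 - d) + N / (1/2 + d)"
  define g where "g = 4 * N - (m - c * L)"
  define A where "A w = 2 * H w + 2 * V w + bulk w N N" for w
  define G where "G w = stat_lpp (1/2) w N N" for w
  define B where "B w = stat_lpp (1/2 + d) w N N" for w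
  define C where "C w = stat_lpp (1/2 - d) w N N" for w
  have m_eq: "m = 4 * N / (1 - 4 * d\<^sup>2)"
    using d by (simp add: m_def field_simps power2_eq_square)
  have g_ge: "16 * d\<^sup>2 * N \<le> g"
  proof -
    have q: "0 < 1 - 4 * d\<^sup>2" "0 < 1 - 2 * d"
    proof -
      have "d * d \<le> 1/8 * (1/8)" using d by (intro mult_mono) auto
      then show "0 < 1 - 4 * d\<^sup>2" by (simp add: power2_eq_square)
    qed (use d in auto)
    have "L = 8 * d * N" using M0 by (simp add: d_def N)
    then have "c * L = 32 * d\<^sup>2 * N / (1 - 2 * d)" by (simp add: c_eq power2_eq_square)
    moreover have "32 * d\<^sup>2 * N / (1 - 4 * d\<^sup>2) \<le> 32 * d\<^sup>2 * N / (1 - 2 * d)"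
    proof (rule divide_left_mono)
      have "2 * d * (2 * d) \<le> 1 * (2 * d)" using d by (intro mult_right_mono) auto
      then show "1 - 2 * d \<le> 1 - 4 * d\<^sup>2" by (simp add: power2_eq_square)
    qed (use q in auto)
    moreover have "4 * N - m = - (16 * d\<^sup>2 * N / (1 - 4 * d\<^sup>2))"
      unfolding m_eq using q by (simp add: field_simps)
    moreover have "16 * d\<^sup>2 * N \<le> 16 * d\<^sup>2 * N / (1 - 4 * d\<^sup>2)"
      using q by (simp add: field_simps mult_left_mono)
    ultimately show ?thesis unfolding g_def by linarith
  qed
  have g0: "0 < g" using g_ge d N by (smt (verit) mult_pos_pos of_nat_0_less_iff less_le_trans zero_less_one zero_less_power)
  \<comment> \<open>All deviations in one variable: unless the exit is early (G <= A), they must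
    bridge the gap, g <= D.\<close>
  define D where "D w = \<bar>G w - 4 * N\<bar> + (\<bar>B w - m\<bar> + c * \<bar>H w - L\<bar>) + (\<bar>C w - m\<bar> + c * \<bar>V w - L\<bar>)" for w
  have Gi: "integrable (exp_env UNIV) G" "(\<integral>w. \<bar>G w - 4 * N\<bar> \<partial>exp_env UNIV) \<le> 4 * sqrt N"
    using stat_lpp_deviation_UNIV[of "1/2" N N] by (simp_all add: G_def[abs_def] mult.commute)
  have Bi: "integrable (exp_env UNIV) B" "(\<integral>w. \<bar>B w - m\<bar> \<partial>exp_env UNIV) \<le> 5 * sqrt N"
  proof -
    have "sqrt N / (1/2 - d) + sqrt N / (1/2 + d) \<le> 3 * sqrt N + 2 * sqrt N"
    proof (rule add_mono)
      have "1 / (1/2 - d) \<le> 3" using d by (simp add: field_simps)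
      then show "sqrt N / (1/2 - d) \<le> 3 * sqrt N" using mult_right_mono[of "1 / (1/2 - d)" 3 "sqrt N"] by simp
      have "1 / (1/2 + d) \<le> 2" using d by (simp add: field_simps)
      then show "sqrt N / (1/2 + d) \<le> 2 * sqrt N" using mult_right_mono[of "1 / (1/2 + d)" 2 "sqrt N"] by simp
    qed
    then show "integrable (exp_env UNIV) B" "(\<integral>w. \<bar>B w - m\<bar> \<partial>exp_env UNIV) \<le> 5 * sqrt N"
      using stat_lpp_deviation_UNIV[of "1/2 + d" N N] d by (simp_all add: B_def[abs_def] m_def)
  qed
  have Ci: "integrable (exp_env UNIV) C" "(\<integral>w. \<bar>C w - m\<bar> \<partial>exp_env UNIV) \<le> 5 * sqrt N"
  proof -
    have "sqrt N / (1/2 + d) + sqrt N / (1/2 - d) \<le> 2 * sqrt N + 3 * sqrt N"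
    proof (rule add_mono)
      have "1 / (1/2 - d) \<le> 3" using d by (simp add: field_simps)
      then show "sqrt N / (1/2 - d) \<le> 3 * sqrt N" using mult_right_mono[of "1 / (1/2 - d)" 3 "sqrt N"] by simp
      have "1 / (1/2 + d) \<le> 2" using d by (simp add: field_simps)
      then show "sqrt N / (1/2 + d) \<le> 2 * sqrt N" using mult_right_mono[of "1 / (1/2 + d)" 2 "sqrt N"] by simp
    qed
    then show "integrable (exp_env UNIV) C" "(\<integral>w. \<bar>C w - m\<bar> \<partial>exp_env UNIV) \<le> 5 * sqrt N"
      using stat_lpp_deviation_UNIV[of "1/2 - d" N N] d by (simp_all add: C_def[abs_def] m_def add.commute)
  qed
  have Ai: "integrable (exp_env UNIV) (\<lambda>w. bulk w N N)"
    using integrable_hom_lpp[of "\<lambda>i j. (Suc i, Suc j)" "N - 1" "N - 1"] exp_env_mean(1)[of "(N, N)" UNIV]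
    using N(2) by (simp add: bulk_def[abs_def])
  have iD: "integrable (exp_env UNIV) D"
    using Gi(1) Bi(1) Ci(1) Hd(1) Vd(1) by (auto simp: D_def[abs_def])
  have "1 * real L \<le> real M * real L" using M by (intro mult_right_mono) auto
  then have LN: "sqrt L \<le> sqrt N" using N(1) by simp
  \<comment> \<open>The 16 is 4 + 5 + 5 from the three stationary models and 1 + 1 from the two axis
    sums.\<close>
  have ED: "(\<integral>w. D w \<partial>exp_env UNIV) \<le> 16 * sqrt N"
  proof -
    have "(\<integral>w. D w \<partial>exp_env UNIV) = (\<integral>w. \<bar>G w - 4 * N\<bar> \<partial>exp_env UNIV) +
      ((\<integral>w. \<bar>B w - m\<bar> \<partial>exp_env UNIV) + c * (\<integral>w. \<bar>H w - L\<bar> \<partial>exp_env UNIV)) +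
      ((\<integral>w. \<bar>C w - m\<bar> \<partial>exp_env UNIV) + c * (\<integral>w. \<bar>V w - L\<bar> \<partial>exp_env UNIV))"
      unfolding D_def using Gi(1) Bi(1) Ci(1) Hd(1) Vd(1) by simp
    moreover have "c * (\<integral>w. \<bar>H w - L\<bar> \<partial>exp_env UNIV) \<le> 1 * sqrt N" "c * (\<integral>w. \<bar>V w - L\<bar> \<partial>exp_env UNIV) \<le> 1 * sqrt N"
      using mult_mono[OF c(2) order_trans[OF Hd(2) LN]] mult_mono[OF c(2) order_trans[OF Vd(2) LN]] by simp_all
    ultimately show ?thesis using Gi(2) Bi(2) Ci(2) by linarith
  qed
  have "(\<integral>w. G w \<partial>exp_env UNIV) \<le> (\<integral>w. A w + (1 + 4 * N / g) * D w \<partial>exp_env UNIV)"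
  proof (rule integral_mono_AE)
    show "integrable (exp_env UNIV) (\<lambda>w. A w + (1 + 4 * N / g) * D w)"
      using Ai iD Hd(1) Vd(1) by (auto simp: A_def[abs_def])
    have "AE w in exp_env UNIV. \<forall>k::nat \<times> nat. 0 \<le> w k"
      using AE_exp_env_nonneg[of "UNIV :: (nat \<times> nat) set"] by simp
    then show "AE w in exp_env UNIV. G w \<le> A w + (1 + 4 * N / g) * D w"
    proof eventually_elim
      case (elim w)
      have "0 \<le> H w" "0 \<le> V w" "0 \<le> bulk w N N"
        using elim by (auto simp: H_def V_def intro!: sum_nonneg bulk_nonneg)
      then have A0: "0 \<le> A w" by (simp add: A_def)
      have D0: "0 \<le> D w" using c by (simp add: D_def)
      have D1: "\<bar>G w - 4 * N\<bar> \<le> D w" using c by (simp add: D_def)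
      have N0: "0 \<le> 4 * N / g" using g0 by simp
      have exit: "G w \<le> max (A w) (max (B w - c * H w) (C w - c * V w))"
        unfolding G_def A_def B_def C_def c_def H_def V_def by (rule stat_lpp_exit) (use elim d in auto)
      show ?case
      proof (cases "G w \<le> A w")
        case True
        then show ?thesis using D0 N0 by (smt (verit) mult_nonneg_nonneg)
      next
        \<comment> \<open>Here 1 <= D / g, so the typical size 4N is paid for by (4N / g) D and the
          deviation of G from it by one more D. This is where the factor
          \<open>1 + 4 * N / g\<close> comes from.\<close>
        case False
        have "B w - c * H w - (m - c * L) \<le> \<bar>B w - m\<bar> + c * \<bar>H w - L\<bar>"
        proof -
          have "0 \<le> c * (H w + \<bar>H w - L\<bar> - L)" using c(1) by (intro mult_nonneg_nonneg) auto
          then have "c * L \<le> c * H w + c * \<bar>H w - L\<bar>" by (simp add: algebra_simps)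
          then show ?thesis by linarith
        qed
        moreover have "C w - c * V w - (m - c * L) \<le> \<bar>C w - m\<bar> + c * \<bar>V w - L\<bar>"
        proof -
          have "0 \<le> c * (V w + \<bar>V w - L\<bar> - L)" using c(1) by (intro mult_nonneg_nonneg) auto
          then have "c * L \<le> c * V w + c * \<bar>V w - L\<bar>" by (simp add: algebra_simps)
          then show ?thesis by linarith
        qed
        moreover have "0 \<le> c * \<bar>H w - L\<bar>" "0 \<le> c * \<bar>V w - L\<bar>" using c by auto
        moreover have "G w \<le> B w - c * H w \<or> G w \<le> C w - c * V w" using False exit by linarith
        moreover have "4 * real N - \<bar>G w - 4 * N\<bar> \<le> G w" by linarith
        moreover have "0 \<le> \<bar>B w - m\<bar>" "0 \<le> \<bar>C w - m\<bar>" by auto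
        ultimately have "g \<le> D w" unfolding g_def D_def by argo
        then have "4 * N / g * g \<le> 4 * N / g * D w" using N0 by (intro mult_left_mono) auto
        then have "4 * N \<le> 4 * N / g * D w" using g0 by simp
        then show ?thesis using A0 D1 by (simp add: algebra_simps)
      qed
    qed
  qed (fact Gi(1))
  also have "\<dots> = (\<integral>w. A w \<partial>exp_env UNIV) + (1 + 4 * N / g) * (\<integral>w. D w \<partial>exp_env UNIV)"
    using Ai iD Hd(1) Vd(1) by (simp add: A_def[abs_def])
  also have "(\<integral>w. A w \<partial>exp_env UNIV) = 4 * L + (\<integral>w. bulk w N N \<partial>exp_env UNIV)"
    using Ai Hd Vd by (simp add: A_def[abs_def])
  also have "(1 + 4 * N / g) * (\<integral>w. D w \<partial>exp_env UNIV) \<le> (1 + 16 * M\<^sup>2) * (16 * sqrt N)"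
  proof (rule mult_mono)
    have "4 * N / g \<le> 4 * N / (16 * d\<^sup>2 * N)"
      using g_ge g0 d N by (intro divide_left_mono mult_pos_pos) auto
    also have "\<dots> = 16 * M\<^sup>2"
      using N M0 L0 by (simp add: d_def power2_eq_square field_simps)
    finally show "1 + 4 * N / g \<le> 1 + 16 * M\<^sup>2" by simp
    show "0 \<le> (\<integral>w. D w \<partial>exp_env UNIV)" using c by (intro integral_nonneg_AE) (auto simp: D_def)
  qed (use ED in auto)
  finally have 1: "(\<integral>w. G w \<partial>exp_env UNIV) \<le> 4 * L + (\<integral>w. bulk w N N \<partial>exp_env UNIV) + (1 + 16 * M\<^sup>2) * (16 * sqrt N)"
    by simp
  have "4 * N - (\<integral>w. G w \<partial>exp_env UNIV) = (\<integral>w. 4 * N - G w \<partial>exp_env UNIV)"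
    using Gi(1) P.prob_space by simp
  also have "\<dots> \<le> (\<integral>w. \<bar>G w - 4 * N\<bar> \<partial>exp_env UNIV)"
    using Gi(1) by (intro integral_mono) auto
  finally have "4 * N - 4 * sqrt N \<le> (\<integral>w. G w \<partial>exp_env UNIV)" using Gi(2) by linarith
  then show ?thesis using 1 by (simp add: algebra_simps)
qed

lemma hom_lpp_lower:
  fixes e :: real
  assumes e: "0 < e" "e < 4"
  obtains n :: nat where "0 < n" "(4 - e) * n \<le> (\<integral>w. lpp (\<lambda>i j. w (i, j)) n n \<partial>exp_env UNIV)"
proof -
  interpret P: prob_space "exp_env (UNIV :: (nat \<times> nat) set)" by (rule prob_space_exp_env)
  \<comment> \<open>M >= 8/e makes the early-exit cost 4L at most (e/2) N.\<close>
  define M :: nat where "M = Suc (nat \<lceil>8 / e\<rceil>)"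
  have M: "1 \<le> M" "8 / e \<le> M" unfolding M_def by linarith+
  \<comment> \<open>One more than the constant 20 of the previous bound: the extra sqrt N absorbs
    the end weight, of mean 1, that \<open>bulk\<close> counts and \<open>lpp\<close> does
    not.\<close>
  define K where "K = 21 + 256 * (real M)\<^sup>2"
  \<comment> \<open>Large enough that K sqrt N takes at most the other half of the error, (e/2)
    N.\<close>
  define L :: nat where "L = 2 + nat \<lceil>(2 * K / e)\<^sup>2\<rceil>"
  have L: "2 \<le> L" "(2 * K / e)\<^sup>2 \<le> L" unfolding L_def by linarith+
  define N where "N = M * L"
  have LN: "L \<le> N" using M by (simp add: N_def)
  have N: "1 \<le> sqrt N" "2 \<le> N" using L LN by auto
  have "(2 * K / e)\<^sup>2 \<le> N" using L(2) LN by linarith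
  then have "2 * K / e \<le> sqrt N" by (rule real_le_rsqrt)
  then have "K \<le> e / 2 * sqrt N" using e by (simp add: field_simps)
  then have "K * sqrt N \<le> e / 2 * sqrt N * sqrt N" by (intro mult_right_mono) auto
  also have "\<dots> = e / 2 * N" by (simp add: mult.assoc)
  finally have 1: "K * sqrt N \<le> e / 2 * N" .
  have "8 / e * L \<le> M * L" unfolding of_nat_mult using M by (intro mult_right_mono) auto
  then have 2: "4 * L \<le> e / 2 * N" using e by (simp add: N_def field_simps)
  have "4 * real N - 4 * real L - (20 + 256 * M\<^sup>2) * sqrt N \<le> (\<integral>w. bulk w N N \<partial>exp_env UNIV)"
    unfolding N_def using M L by (intro hom_bulk_lower) auto
  moreover have "(20 + 256 * M\<^sup>2) * sqrt N + 1 \<le> K * sqrt N"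
    using N(1) by (simp add: K_def algebra_simps)
  moreover have "(\<integral>w. bulk w N N \<partial>exp_env UNIV) = (\<integral>w. lpp (\<lambda>i j. w (Suc i, Suc j)) (N - 1) (N - 1) \<partial>exp_env UNIV) + 1"
    using N(2) integrable_hom_lpp[of "\<lambda>i j. (Suc i, Suc j)" "N - 1" "N - 1"] exp_env_mean[of "(N, N)" UNIV]
    by (simp add: bulk_def[abs_def])
  moreover have "(\<integral>w. lpp (\<lambda>i j. w (Suc i, Suc j)) (N - 1) (N - 1) \<partial>exp_env UNIV) = (\<integral>w. lpp (\<lambda>i j. w (i, j)) (N - 1) (N - 1) \<partial>exp_env UNIV)"
    using hom_lpp_reindex[of "\<lambda>i j. (Suc i, Suc j)" "\<lambda>x. x" "N - 1" "N - 1"] by simp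
  ultimately have "4 * N - e * N \<le> (\<integral>w. lpp (\<lambda>i j. w (i, j)) (N - 1) (N - 1) \<partial>exp_env UNIV)"
    using 1 2 by linarith
  moreover have "(4 - e) * (N - 1) \<le> (4 - e) * N" using e by (intro mult_left_mono) auto
  ultimately have "(4 - e) * real (N - 1) \<le> (\<integral>w. lpp (\<lambda>i j. w (i, j)) (N - 1) (N - 1) \<partial>exp_env UNIV)"
    by (simp add: algebra_simps)
  then show ?thesis using N(2) by (intro that[of "N - 1"]) auto
qed

subsection \<open>Speeding up a column\<close>

text \<open>If \<open>X\<close> is exponential with rate 1 and \<open>Z\<close>, independent of \<open>X\<close>, vanishes with probability \<open>p\<close>
and is exponential with rate 1 otherwise, then \<open>p X + Z\<close> is exponential with rate 1.\<close>

definition slack :: "real \<Rightarrow> real measure" where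
  "slack p = distr (measure_pmf (bernoulli_pmf p) \<Otimes>\<^sub>M expd 1) borel (\<lambda>(b, x). if b then 0 else x)"

lemma slack_measurable [measurable]:
  "(\<lambda>(b, x). if b then 0 else x) \<in> borel_measurable (measure_pmf (bernoulli_pmf p) \<Otimes>\<^sub>M expd 1)"
proof -
  have [measurable]: "fst \<in> measure_pmf (bernoulli_pmf p) \<Otimes>\<^sub>M expd 1 \<rightarrow>\<^sub>M count_space UNIV"
    using measurable_fst[of "measure_pmf (bernoulli_pmf p)" "expd 1"] by (simp cong: measurable_cong_sets)
  have [measurable]: "snd \<in> borel_measurable (measure_pmf (bernoulli_pmf p) \<Otimes>\<^sub>M expd 1)"
    using measurable_snd[of "measure_pmf (bernoulli_pmf p)" "expd 1"] by (simp cong: measurable_cong_sets)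
  have "(\<lambda>z. if fst z then 0 else snd z) \<in> borel_measurable (measure_pmf (bernoulli_pmf p) \<Otimes>\<^sub>M expd 1)"
    by measurable
  then show ?thesis by (simp add: case_prod_beta')
qed

lemma sets_slack [simp, measurable_cong]: "sets (slack p) = sets borel"
  by (simp add: slack_def)

lemma prob_space_slack: "prob_space (slack p)"
proof -
  interpret pair_prob_space "measure_pmf (bernoulli_pmf p)" "expd 1"
    by standard
  show ?thesis unfolding slack_def by (intro P.prob_space_distr slack_measurable)
qed

lemma nn_integral_slack:
  assumes p: "0 \<le> p" "p \<le> 1" and [measurable]: "f \<in> borel_measurable borel"
  shows "(\<integral>\<^sup>+z. f z \<partial>slack p) = ennreal p * f 0 + ennreal (1 - p) * (\<integral>\<^sup>+x. f x \<partial>expd 1)"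
proof -
  have m: "(\<lambda>z. f ((\<lambda>(b, x). if b then 0 else x) z)) \<in> borel_measurable (measure_pmf (bernoulli_pmf p) \<Otimes>\<^sub>M expd 1)"
    using measurable_compose[OF slack_measurable[of p] assms(3)] .
  have "(\<integral>\<^sup>+z. f z \<partial>slack p) = (\<integral>\<^sup>+z. f ((\<lambda>(b, x). if b then 0 else x) z) \<partial>(measure_pmf (bernoulli_pmf p) \<Otimes>\<^sub>M expd 1))"
    unfolding slack_def by (rule nn_integral_distr[OF slack_measurable]) simp
  also have "\<dots> = (\<integral>\<^sup>+b. \<integral>\<^sup>+x. f (if b then 0 else x) \<partial>expd 1 \<partial>measure_pmf (bernoulli_pmf p))"
    using exp1.nn_integral_fst[OF m] by simp
  also have "\<dots> = ennreal p * f 0 + ennreal (1 - p) * (\<integral>\<^sup>+x. f x \<partial>expd 1)"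
    using p exp1.emeasure_space_1 by (simp add: mult.commute)
  finally show ?thesis .
qed

lemma slack_mean:
  assumes p: "0 \<le> p" "p \<le> 1"
  shows "integrable (slack p) (\<lambda>z. z)" "(\<integral>z. z \<partial>slack p) = 1 - p"
proof -
  have 1: "(\<integral>\<^sup>+x. ennreal x \<partial>expd 1) = 1"
    using nn_integral_eq_integral[OF exp1_moments(1) exp1_AE_nonneg] exp1_moments(3) by simp
  have i: "(\<integral>\<^sup>+z. ennreal z \<partial>slack p) = ennreal (1 - p)"
    using p by (subst nn_integral_slack) (auto simp: 1)
  have "(\<integral>\<^sup>+z. (if z < 0 then 1 else 0) \<partial>slack p) = ennreal (1 - p) * (\<integral>\<^sup>+x. (if x < 0 then 1 else 0) \<partial>expd 1)"
    using p by (subst nn_integral_slack) auto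
  also have "(\<integral>\<^sup>+x. (if x < 0 then 1 else 0) \<partial>expd 1) = (\<integral>\<^sup>+x. 0 \<partial>expd 1)"
    by (intro nn_integral_cong_AE eventually_mono[OF exp1_AE_nonneg]) auto
  finally have "(\<integral>\<^sup>+z. (if z < 0 then 1 else 0) \<partial>slack p) = (0::ennreal)" by simp
  then have "AE z in slack p. (if z < 0 then 1 else 0 :: ennreal) = 0"
    by (subst (asm) nn_integral_0_iff_AE) auto
  then have ae: "AE z in slack p. 0 \<le> z" by eventually_elim (auto split: if_splits)
  show "integrable (slack p) (\<lambda>z. z)"
    by (rule integrableI_nn_integral_finite[OF _ ae i]) simp
  show "(\<integral>z. z \<partial>slack p) = 1 - p"
    by (rule integral_eq_nn_integral[OF _ ae, THEN trans]) (use p in \<open>auto simp: i\<close>)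
qed

text \<open>The density of p X + Y for independent unit exponentials X and Y, a hypoexponential
  law.\<close>

lemma exp_convolution_density:
  assumes p: "0 < p" "p < 1"
  shows "(\<integral>\<^sup>+x. ennreal (exponential_density (1 / p) x) * ennreal (exponential_density 1 (u - x)) \<partial>lborel)
    = (if 0 \<le> u then ennreal ((exp (- u) - exp (- u / p)) / (1 - p)) else 0)"
proof (cases "0 \<le> u")
  case True
  define F where "F x = - exp (- u) * exp (- x * (1 / p - 1)) / (1 - p)" for x
  define f where "f x = 1 / p * exp (- x / p) * exp (- (u - x))" for x
  have "(\<integral>\<^sup>+x. ennreal (exponential_density (1 / p) x) * ennreal (exponential_density 1 (u - x)) \<partial>lborel)
    = (\<integral>\<^sup>+x. ennreal (f x) * indicator {0..u} x \<partial>lborel)"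
    using p by (intro nn_integral_cong)
      (auto simp: exponential_density_def f_def indicator_def ennreal_mult'[symmetric] intro!: arg_cong[where f = ennreal])
  also have "\<dots> = F u - F 0"
  proof (rule nn_integral_FTC_Icc)
    show "f \<in> borel_measurable borel" unfolding f_def by measurable
    show "0 \<le> f x" for x using p by (simp add: f_def)
    show "0 \<le> u" by fact
    fix x
    have "(F has_real_derivative - exp (- u) * (exp (- x * (1 / p - 1)) * (- (1 / p - 1))) / (1 - p)) (at x)"
      unfolding F_def using p by (auto intro!: derivative_eq_intros)
    moreover have "- exp (- u) * (exp (- x * (1 / p - 1)) * (- (1 / p - 1))) / (1 - p) = f x"
    proof -
      have "exp (- u) * exp (- x * (1 / p - 1)) = exp (- x / p) * exp (- (u - x))"
        by (simp add: algebra_simps flip: exp_add)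
      moreover have "(1 / p - 1) / (1 - p) = 1 / p" using p by (simp add: field_simps)
      moreover have "- A * (B * (- c)) / d = (c / d) * (A * B)" for A B c d :: real by simp
      ultimately show ?thesis by (simp only: f_def mult.assoc)
    qed
    ultimately show "DERIV F x :> f x" by simp
  qed
  also have "F u - F 0 = (exp (- u) - exp (- u / p)) / (1 - p)"
  proof -
    have "exp (- u) * exp (- u * (1 / p - 1)) = exp (- u / p)"
      by (simp add: algebra_simps flip: exp_add)
    then show ?thesis by (simp add: F_def diff_divide_distrib)
  qed
  finally show ?thesis using True by simp
next
  case False
  have "ennreal (exponential_density (1 / p) x) * ennreal (exponential_density 1 (u - x)) = 0" for x
    using False by (auto simp: exponential_density_def)
  then have "(\<lambda>x. ennreal (exponential_density (1 / p) x) * ennreal (exponential_density 1 (u - x))) = (\<lambda>x. 0)"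
    by (rule ext)
  then show ?thesis using False by simp
qed

lemma exp_thinning:
  assumes p: "0 < p" "p \<le> 1" and f [measurable]: "f \<in> borel_measurable borel"
  shows "(\<integral>\<^sup>+x. \<integral>\<^sup>+z. f (p * x + z) \<partial>slack p \<partial>expd 1) = (\<integral>\<^sup>+x. f x \<partial>expd 1)"
proof (cases "p = 1")
  case True
  then show ?thesis by (simp add: nn_integral_slack)
next
  case False
  then have p1: "p < 1" using p by simp
  have p': "0 < 1 / p" using p by simp
  have [measurable]: "(\<lambda>x. \<integral>\<^sup>+y. f (x + y) \<partial>expd 1) \<in> borel_measurable borel"
    by measurable
  have "(\<integral>\<^sup>+x. \<integral>\<^sup>+y. f (p * x + y) \<partial>expd 1 \<partial>expd 1) = (\<integral>\<^sup>+x. \<integral>\<^sup>+y. f (x + y) \<partial>expd 1 \<partial>expd (1 / p))"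
    by (subst nn_integral_expd_scale[OF p']) (simp_all add: mult.commute)
  also have "\<dots> = (\<integral>\<^sup>+x. \<integral>\<^sup>+y. ennreal (exponential_density (1 / p) x) * (ennreal (exponential_density 1 y) * f (x + y)) \<partial>lborel \<partial>lborel)"
    by (simp add: nn_integral_density nn_integral_cmult)
  also have "\<dots> = (\<integral>\<^sup>+x. \<integral>\<^sup>+u. ennreal (exponential_density (1 / p) x) * (ennreal (exponential_density 1 (u - x)) * f u) \<partial>lborel \<partial>lborel)"
  proof (rule nn_integral_cong)
    fix x :: real
    show "(\<integral>\<^sup>+y. ennreal (exponential_density (1 / p) x) * (ennreal (exponential_density 1 y) * f (x + y)) \<partial>lborel)
      = (\<integral>\<^sup>+u. ennreal (exponential_density (1 / p) x) * (ennreal (exponential_density 1 (u - x)) * f u) \<partial>lborel)"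
      by (subst nn_integral_real_affine[of _ 1 "- x"]) auto
  qed
  also have "\<dots> = (\<integral>\<^sup>+u. \<integral>\<^sup>+x. ennreal (exponential_density (1 / p) x) * (ennreal (exponential_density 1 (u - x)) * f u) \<partial>lborel \<partial>lborel)"
    by (rule lborel_pair.Fubini') measurable
  also have "\<dots> = (\<integral>\<^sup>+u. (\<integral>\<^sup>+x. ennreal (exponential_density (1 / p) x) * ennreal (exponential_density 1 (u - x)) \<partial>lborel) * f u \<partial>lborel)"
    by (simp add: nn_integral_multc flip: mult.assoc)
  also have "\<dots> = (\<integral>\<^sup>+u. (if 0 \<le> u then ennreal ((exp (- u) - exp (- u / p)) / (1 - p)) else 0) * f u \<partial>lborel)"
    unfolding exp_convolution_density[OF p(1) p1] ..
  finally have conv: "(\<integral>\<^sup>+x. \<integral>\<^sup>+y. f (p * x + y) \<partial>expd 1 \<partial>expd 1)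
    = (\<integral>\<^sup>+u. (if 0 \<le> u then ennreal ((exp (- u) - exp (- u / p)) / (1 - p)) else 0) * f u \<partial>lborel)" .
  have single: "(\<integral>\<^sup>+x. f (p * x) \<partial>expd 1) = (\<integral>\<^sup>+u. ennreal (exponential_density (1 / p) u) * f u \<partial>lborel)"
    using nn_integral_expd_scale[OF p' f] nn_integral_expd[OF f, of "1 / p"] by (simp add: mult.commute)
  have "(\<integral>\<^sup>+x. \<integral>\<^sup>+z. f (p * x + z) \<partial>slack p \<partial>expd 1)
    = (\<integral>\<^sup>+x. ennreal p * f (p * x) + ennreal (1 - p) * (\<integral>\<^sup>+y. f (p * x + y) \<partial>expd 1) \<partial>expd 1)"
    using p p1 by (simp add: nn_integral_slack)
  also have "\<dots> = ennreal p * (\<integral>\<^sup>+x. f (p * x) \<partial>expd 1) + ennreal (1 - p) * (\<integral>\<^sup>+x. \<integral>\<^sup>+y. f (p * x + y) \<partial>expd 1 \<partial>expd 1)"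
    by (simp add: nn_integral_add nn_integral_cmult)
  also have "\<dots> = (\<integral>\<^sup>+u. ennreal p * (ennreal (exponential_density (1 / p) u) * f u) + ennreal (1 - p) *
      ((if 0 \<le> u then ennreal ((exp (- u) - exp (- u / p)) / (1 - p)) else 0) * f u) \<partial>lborel)"
    unfolding single conv by (simp add: nn_integral_add nn_integral_cmult)
  also have "\<dots> = (\<integral>\<^sup>+u. ennreal (exponential_density 1 u) * f u \<partial>lborel)"
  proof (rule nn_integral_cong)
    fix u :: real
    \<comment> \<open>The mixture telescopes for u >= 0: the atom of \<open>slack p\<close> at 0
      contributes exp(-u/p), the rest exp(-u) - exp(-u/p). The division by 1 - p inside is why p = 1
      was treated apart.\<close>
    have E: "ennreal p * ennreal (exponential_density (1 / p) u) + ennreal (1 - p) *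
      (if 0 \<le> u then ennreal ((exp (- u) - exp (- u / p)) / (1 - p)) else 0) = ennreal (exponential_density 1 u)"
    proof (cases "0 \<le> u")
      case True
      have "- u / p \<le> - u" using p p1 True mult_right_mono[of p 1 u] by (simp add: field_simps)
      then have d: "0 \<le> exp (- u) - exp (- (u / p))" by simp
      then have "ennreal (exp (- (u / p))) + ennreal (exp (- u) - exp (- (u / p))) = ennreal (exp (- u))"
        by (subst ennreal_plus[symmetric]) auto
      then show ?thesis using True p p1 d
        by (simp add: exponential_density_def ennreal_mult'[symmetric])
    qed (auto simp: exponential_density_def)
    show "ennreal p * (ennreal (exponential_density (1 / p) u) * f u) + ennreal (1 - p) *
      ((if 0 \<le> u then ennreal ((exp (- u) - exp (- u / p)) / (1 - p)) else 0) * f u) = ennreal (exponential_density 1 u) * f u"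
      unfolding E[symmetric] by (simp only: distrib_right mult.assoc)
  qed
  also have "\<dots> = (\<integral>\<^sup>+x. f x \<partial>expd 1)" by (rule nn_integral_expd[symmetric]) simp
  finally show ?thesis .
qed

lemma exp_env_thinning:
  assumes K: "finite K" and q: "\<And>k. k \<in> K \<Longrightarrow> 0 < q k \<and> q k \<le> 1"
  shows "distr (exp_env K \<Otimes>\<^sub>M PiM K (\<lambda>k. slack (q k))) (exp_env K) (\<lambda>(x, z). \<lambda>k\<in>K. q k * x k + z k) = exp_env K"
proof (rule exp1_prod.PiM_eqI[OF K])
  interpret Z: product_sigma_finite "\<lambda>k. slack (q k)"
    by (intro product_sigma_finite.intro prob_space_imp_sigma_finite prob_space_slack)
  interpret PZ: prob_space "PiM K (\<lambda>k. slack (q k))" by (intro prob_space_PiM prob_space_slack)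
  have Zm [measurable]: "(\<lambda>z. z k) \<in> borel_measurable (PiM K (\<lambda>k. slack (q k)))" if "k \<in> K" for k
    using measurable_component_singleton[OF that, of "\<lambda>k. slack (q k)"] measurable_cong_sets[OF refl sets_slack] by blast
  have m [measurable]: "(\<lambda>(x, z). \<lambda>k\<in>K. q k * x k + z k) \<in> exp_env K \<Otimes>\<^sub>M PiM K (\<lambda>k. slack (q k)) \<rightarrow>\<^sub>M exp_env K"
    unfolding case_prod_beta' by (rule measurable_restrict) measurable
  show "sets (distr (exp_env K \<Otimes>\<^sub>M PiM K (\<lambda>k. slack (q k))) (exp_env K) (\<lambda>(x, z). \<lambda>k\<in>K. q k * x k + z k)) = sets (exp_env K)"
    by simp
  fix A :: "'a \<Rightarrow> real set" assume A: "\<And>i. i \<in> K \<Longrightarrow> A i \<in> sets (expd 1)"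
  then have Am: "A i \<in> sets borel" if "i \<in> K" for i using that by simp
  have ind: "(indicator (Pi\<^sub>E K A) (\<lambda>k\<in>K. q k * x k + z k) :: ennreal) = (\<Prod>k\<in>K. indicator (A k) (q k * x k + z k))" for x z
  proof (cases "\<forall>k\<in>K. q k * x k + z k \<in> A k")
    case False
    then obtain k where "k \<in> K" "q k * x k + z k \<notin> A k" by auto
    then have "(\<Prod>k\<in>K. indicator (A k) (q k * x k + z k) :: ennreal) = 0"
      using K by (intro prod_zero bexI[of _ k]) auto
    then show ?thesis using False by (auto simp: indicator_def PiE_iff)
  qed (auto simp: indicator_def)
  have [measurable]: "Pi\<^sub>E K A \<in> sets (exp_env K)" using K A by (intro sets_PiM_I_finite) auto
  have mi: "(\<lambda>(x, z). \<Prod>k\<in>K. indicator (A k) (q k * x k + z k) :: ennreal) \<in> borel_measurable (exp_env K \<Otimes>\<^sub>M PiM K (\<lambda>k. slack (q k)))"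
    unfolding case_prod_beta'
    by (intro borel_measurable_prod_ennreal measurable_compose[OF _ borel_measurable_indicator[OF Am]]) measurable
  have [measurable]: "(\<lambda>z. indicator (A k) (c + z) :: ennreal) \<in> borel_measurable borel" if "k \<in> K" for k c
    by (intro measurable_compose[OF _ borel_measurable_indicator[OF Am[OF that]]]) measurable
  have "emeasure (distr (exp_env K \<Otimes>\<^sub>M PiM K (\<lambda>k. slack (q k))) (exp_env K) (\<lambda>(x, z). \<lambda>k\<in>K. q k * x k + z k)) (Pi\<^sub>E K A)
    = (\<integral>\<^sup>+xz. indicator (Pi\<^sub>E K A) ((\<lambda>(x, z). \<lambda>k\<in>K. q k * x k + z k) xz) \<partial>(exp_env K \<Otimes>\<^sub>M PiM K (\<lambda>k. slack (q k))))"
    by (subst nn_integral_distr[OF m, symmetric]) simp_all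
  also have "\<dots> = (\<integral>\<^sup>+x. \<integral>\<^sup>+z. (\<Prod>k\<in>K. indicator (A k) (q k * x k + z k)) \<partial>PiM K (\<lambda>k. slack (q k)) \<partial>exp_env K)"
    using PZ.nn_integral_fst[OF mi] by (simp add: case_prod_beta' ind)
  also have "\<dots> = (\<integral>\<^sup>+x. (\<Prod>k\<in>K. \<integral>\<^sup>+z. indicator (A k) (q k * x k + z) \<partial>slack (q k)) \<partial>exp_env K)"
    by (intro nn_integral_cong Z.product_nn_integral_prod[OF K]) (simp add: measurable_cong_sets[OF sets_slack refl])
  also have "\<dots> = (\<Prod>k\<in>K. \<integral>\<^sup>+x. \<integral>\<^sup>+z. indicator (A k) (q k * x + z) \<partial>slack (q k) \<partial>expd 1)"
  proof (rule exp1_prod.product_nn_integral_prod[OF K])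
    fix k assume k: "k \<in> K"
    have "(\<lambda>(x, z). indicator (A k) (q k * x + z) :: ennreal) \<in> borel_measurable (expd 1 \<Otimes>\<^sub>M slack (q k))"
      unfolding case_prod_beta' by (intro measurable_compose[OF _ borel_measurable_indicator[OF Am[OF k]]]) measurable
    then show "(\<lambda>x. \<integral>\<^sup>+z. indicator (A k) (q k * x + z) \<partial>slack (q k)) \<in> borel_measurable (expd 1)"
      by (rule sigma_finite_measure.borel_measurable_nn_integral[OF prob_space_imp_sigma_finite[OF prob_space_slack]])
  qed
  also have "\<dots> = (\<Prod>k\<in>K. emeasure (expd 1) (A k))"
  proof (rule prod.cong[OF refl])
    fix k assume k: "k \<in> K"
    show "(\<integral>\<^sup>+x. \<integral>\<^sup>+z. indicator (A k) (q k * x + z) \<partial>slack (q k) \<partial>expd 1) = emeasure (expd 1) (A k)"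
      using exp_thinning[of "q k" "indicator (A k)"] q[OF k] Am[OF k] by simp
  qed
  finally show "emeasure (distr (exp_env K \<Otimes>\<^sub>M PiM K (\<lambda>k. slack (q k))) (exp_env K) (\<lambda>(x, z). \<lambda>k\<in>K. q k * x k + z k)) (Pi\<^sub>E K A)
    = (\<Prod>k\<in>K. emeasure (expd 1) (A k))" .
qed

text \<open>A passage time is a maximum of sums, hence convex in the weights; inductively, the
  maximum of two means is at most the mean of the maximum. Integrability is proved alongside and is
  often what the lemma is quoted for.\<close>

lemma lpp_jensen:
  assumes "\<And>i j. i \<le> a \<Longrightarrow> j \<le> b \<Longrightarrow> integrable M (\<lambda>z. W z i j)"
  shows "integrable M (\<lambda>z. lpp (W z) a b) \<and> lpp (\<lambda>i j. \<integral>z. W z i j \<partial>M) a b \<le> (\<integral>z. lpp (W z) a b \<partial>M)"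
  using assms
proof (induction "a + b" arbitrary: a b rule: less_induct)
  case less
  have IH: "integrable M (\<lambda>z. lpp (W z) i j + W z i j) \<and>
    lpp (\<lambda>i j. \<integral>z. W z i j \<partial>M) i j + (\<integral>z. W z i j \<partial>M) \<le> (\<integral>z. lpp (W z) i j + W z i j \<partial>M)"
    if "i \<le> a" "j \<le> b" "i + j < a + b" for i j
  proof -
    have W: "integrable M (\<lambda>z. W z i j)" by (rule less(2)[OF that(1,2)])
    have "integrable M (\<lambda>z. lpp (W z) i j) \<and> lpp (\<lambda>i j. \<integral>z. W z i j \<partial>M) i j \<le> (\<integral>z. lpp (W z) i j \<partial>M)"
      by (rule less(1)[OF that(3)], rule less(2)) (use that in linarith)+
    then show ?thesis using W by simp
  qed
  show ?case
  proof (cases a)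
    case 0
    show ?thesis
    proof (cases b)
      case 0
      then show ?thesis using \<open>a = 0\<close> by simp
    next
      case (Suc b')
      then show ?thesis using IH[of 0 b'] \<open>a = 0\<close> by simp
    qed
  next
    case (Suc a')
    show ?thesis
    proof (cases b)
      case 0
      then show ?thesis using IH[of a' 0] Suc by simp
    next
      case (Suc b')
      let ?f = "\<lambda>z. lpp (W z) a' b + W z a' b" and ?g = "\<lambda>z. lpp (W z) a b' + W z a b'"
      have 1: "integrable M ?f \<and> lpp (\<lambda>i j. \<integral>z. W z i j \<partial>M) a' b + (\<integral>z. W z a' b \<partial>M) \<le> (\<integral>z. ?f z \<partial>M)"
        using \<open>a = Suc a'\<close> by (intro IH) simp_all
      have 2: "integrable M ?g \<and> lpp (\<lambda>i j. \<integral>z. W z i j \<partial>M) a b' + (\<integral>z. W z a b' \<partial>M) \<le> (\<integral>z. ?g z \<partial>M)"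
        using Suc by (intro IH) simp_all
      have i: "integrable M (\<lambda>z. max (?f z) (?g z))" using 1 2 by (intro integrable_max) blast+
      have "(\<integral>z. ?f z \<partial>M) \<le> (\<integral>z. max (?f z) (?g z) \<partial>M)" using 1 i by (intro integral_mono) simp_all
      moreover have "(\<integral>z. ?g z \<partial>M) \<le> (\<integral>z. max (?f z) (?g z) \<partial>M)" using 2 i by (intro integral_mono) simp_all
      ultimately have "max (lpp (\<lambda>i j. \<integral>z. W z i j \<partial>M) a' b + (\<integral>z. W z a' b \<partial>M)) (lpp (\<lambda>i j. \<integral>z. W z i j \<partial>M) a b' + (\<integral>z. W z a b' \<partial>M))
        \<le> (\<integral>z. max (?f z) (?g z) \<partial>M)"
        using 1 2 by linarith
      then show ?thesis using i unfolding \<open>a = Suc a'\<close> Suc lpp.simps by blast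
    qed
  qed
qed

text \<open>In law w = q x + z by thinning. Applying Jensen to z alone, with x frozen, replaces z by
  its mean 1 - q. The box \<open>?K\<close> is there because thinning was shown for finite
  products.\<close>

lemma lpp_mean_thinning:
  assumes q: "\<And>k. 0 < q k \<and> q k \<le> 1"
  shows "(\<integral>w. lpp (\<lambda>i j. q (i, j) * w (i, j) + (1 - q (i, j))) a b \<partial>exp_env UNIV) \<le> (\<integral>w. lpp (\<lambda>i j. w (i, j)) a b \<partial>exp_env UNIV)"
proof -
  let ?K = "{..a} \<times> {..b}"
  let ?Z = "PiM ?K (\<lambda>k. slack (q k))"
  interpret PX: prob_space "exp_env ?K" by (rule prob_space_exp_env)
  interpret PZ: prob_space ?Z by (intro prob_space_PiM prob_space_slack)
  interpret pair_prob_space "exp_env ?K" ?Z by standard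
  have Zm [measurable]: "(\<lambda>z. z k) \<in> borel_measurable ?Z" if "k \<in> ?K" for k
    using measurable_component_singleton[OF that, of "\<lambda>k. slack (q k)"] measurable_cong_sets[OF refl sets_slack] by blast
  have Zi: "integrable ?Z (\<lambda>z. z k)" "(\<integral>z. z k \<partial>?Z) = 1 - q k" if k: "k \<in> ?K" for k
  proof -
    have d: "distr ?Z (slack (q k)) (\<lambda>z. z k) = slack (q k)"
      using k by (intro distr_PiM_component prob_space_slack)
    have mk: "(\<lambda>z. z k) \<in> ?Z \<rightarrow>\<^sub>M slack (q k)" using k by (rule measurable_component_singleton)
    note s = slack_mean[of "q k"]
    have "(\<lambda>x. x) \<in> borel_measurable (slack (q k))" by (simp add: measurable_cong_sets[OF sets_slack refl])
    show "integrable ?Z (\<lambda>z. z k)"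
      using integrable_distr[OF mk, of "\<lambda>x. x"] s(1) q[of k] by (simp add: d)
    show "(\<integral>z. z k \<partial>?Z) = 1 - q k"
      using integral_distr[OF mk \<open>(\<lambda>x. x) \<in> borel_measurable (slack (q k))\<close>] s(2) q[of k] by (simp add: d)
  qed
  have loc1: "lpp (\<lambda>i j. restrict w ?K (i, j)) a b = lpp (\<lambda>i j. w (i, j)) a b" for w
    by (rule lpp_cong) auto
  have loc2: "lpp (\<lambda>i j. q (i, j) * restrict w ?K (i, j) + (1 - q (i, j))) a b = lpp (\<lambda>i j. q (i, j) * w (i, j) + (1 - q (i, j))) a b" for w
    by (rule lpp_cong) auto
  have m1: "(\<lambda>w. lpp (\<lambda>i j. w (i, j)) a b) \<in> borel_measurable (exp_env ?K)"
    by (intro borel_measurable_lpp borel_measurable_exp_env) auto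
  have m2: "(\<lambda>w. lpp (\<lambda>i j. q (i, j) * w (i, j) + (1 - q (i, j))) a b) \<in> borel_measurable (exp_env ?K)"
    by (intro borel_measurable_lpp borel_measurable_add borel_measurable_times borel_measurable_exp_env) auto
  have i1: "integrable (exp_env ?K) (\<lambda>w. lpp (\<lambda>i j. w (i, j)) a b)"
    using exp_env_restrict(1)[of ?K UNIV, OF _ m1] loc1 integrable_hom_lpp[of "\<lambda>i j. (i, j)" a b] by auto
  have m: "(\<lambda>(x, z). \<lambda>k\<in>?K. q k * x k + z k) \<in> exp_env ?K \<Otimes>\<^sub>M ?Z \<rightarrow>\<^sub>M exp_env ?K"
    unfolding case_prod_beta' by (rule measurable_restrict) measurable
  have th: "distr (exp_env ?K \<Otimes>\<^sub>M ?Z) (exp_env ?K) (\<lambda>(x, z). \<lambda>k\<in>?K. q k * x k + z k) = exp_env ?K"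
    by (rule exp_env_thinning) (use q in auto)
  have loc3: "lpp (\<lambda>i j. (\<lambda>k\<in>?K. q k * x k + z k) (i, j)) a b = lpp (\<lambda>i j. q (i, j) * x (i, j) + z (i, j)) a b" for x z
    by (rule lpp_cong) auto
  define f where "f = (\<lambda>(x, z). lpp (\<lambda>i j. q (i, j) * x (i, j) + z (i, j)) a b)"
  have f_eq: "f = (\<lambda>xz. lpp (\<lambda>i j. (\<lambda>(x, z). \<lambda>k\<in>?K. q k * x k + z k) xz (i, j)) a b)"
    unfolding f_def case_prod_beta' loc3 ..
  have i2: "integrable (exp_env ?K \<Otimes>\<^sub>M ?Z) f"
    using integrable_distr[OF m, of "\<lambda>w. lpp (\<lambda>i j. w (i, j)) a b"] i1 unfolding th
    unfolding f_eq by blast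
  have e2: "(\<integral>w. lpp (\<lambda>i j. w (i, j)) a b \<partial>exp_env ?K) = (\<integral>xz. f xz \<partial>(exp_env ?K \<Otimes>\<^sub>M ?Z))"
    using integral_distr[OF m m1] unfolding th f_eq by blast
  have j: "lpp (\<lambda>i j. q (i, j) * x (i, j) + (1 - q (i, j))) a b \<le> (\<integral>z. f (x, z) \<partial>?Z)" for x
  proof -
    have "lpp (\<lambda>i j. \<integral>z. q (i, j) * x (i, j) + z (i, j) \<partial>?Z) a b \<le> (\<integral>z. f (x, z) \<partial>?Z)"
      unfolding f_def using lpp_jensen[of a b ?Z "\<lambda>z i j. q (i, j) * x (i, j) + z (i, j)"] Zi by auto
    also have "lpp (\<lambda>i j. \<integral>z. q (i, j) * x (i, j) + z (i, j) \<partial>?Z) a b = lpp (\<lambda>i j. q (i, j) * x (i, j) + (1 - q (i, j))) a b"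
      by (rule lpp_cong) (simp add: Zi PZ.prob_space)
    finally show ?thesis .
  qed
  have i3: "integrable (exp_env ?K) (\<lambda>w. lpp (\<lambda>i j. q (i, j) * w (i, j) + (1 - q (i, j))) a b)"
    using lpp_jensen[of a b "exp_env ?K" "\<lambda>w i j. q (i, j) * w (i, j) + (1 - q (i, j))"] exp_env_mean[of _ ?K] by auto
  have "(\<integral>w. lpp (\<lambda>i j. q (i, j) * w (i, j) + (1 - q (i, j))) a b \<partial>exp_env UNIV)
    = (\<integral>w. lpp (\<lambda>i j. q (i, j) * w (i, j) + (1 - q (i, j))) a b \<partial>exp_env ?K)"
    by (rule exp_env_restrict(2)[OF _ m2 loc2]) simp
  also have "\<dots> \<le> (\<integral>x. \<integral>z. f (x, z) \<partial>?Z \<partial>exp_env ?K)"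
    using i3 integrable_fst'[OF i2] j by (intro integral_mono) auto
  also have "\<dots> = (\<integral>xz. f xz \<partial>(exp_env ?K \<Otimes>\<^sub>M ?Z))" by (rule integral_fst'[OF i2])
  also have "\<dots> = (\<integral>w. lpp (\<lambda>i j. w (i, j)) a b \<partial>exp_env UNIV)"
    unfolding e2[symmetric] by (rule exp_env_restrict(2)[OF _ m1 loc1, symmetric]) simp
  finally show ?thesis .
qed

lemma lpp_mean_savings:
  fixes \<alpha> :: "int \<Rightarrow> real"
  assumes r: "0 < r" and \<alpha>: "\<And>i. r \<le> \<alpha> i"
  shows "(\<integral>X. lpp (\<lambda>i j. X (int i - int j, int j) / \<alpha> (int i - int j)) a b \<partial>exp_env UNIV)
      + (\<Sum>i\<in>cols_between (int a - int b). 1 / r - 1 / \<alpha> i)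
    \<le> (2 * real a + 2 * real b + 4 + 2 * sqrt (real a + 1) + 2 * sqrt (real b + 1)) / r"
proof -
  have pos: "0 < \<alpha> i" for i using r \<alpha>[of i] by simp
  \<comment> \<open>The thinning parameter leading from rate \<open>r\<close> to rate \<alpha>:
    after division by \<open>r\<close>, the kept part q X becomes X / \<alpha> and the mean slack 1
    - q becomes 1/r - 1/\<alpha>.\<close>
  define q where "q = (\<lambda>(i, j). r / \<alpha> (int i - int j))"
  have q: "0 < q k \<and> q k \<le> 1" for k
    using r \<alpha> pos by (auto simp: q_def case_prod_beta')
  let ?e = "\<lambda>i. 1 - r / \<alpha> i"
  have e: "0 \<le> ?e i" for i using r \<alpha>[of i] pos[of i] by simp
  let ?P = "exp_env (UNIV :: (nat \<times> nat) set)"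
  interpret P: prob_space ?P by (rule prob_space_exp_env)
  define t :: "nat \<times> nat \<Rightarrow> int \<times> int" where "t = (\<lambda>(i, j). (int i - int j, int j))"
  have t: "inj_on t UNIV" "t \<in> UNIV \<rightarrow> UNIV" by (auto simp: t_def inj_on_def)
  have m: "(\<lambda>w. lpp (\<lambda>i j. w (i, j) / \<alpha> (int i - int j)) a b) \<in> borel_measurable ?P"
    by (intro borel_measurable_lpp) simp
  have "(\<integral>X. lpp (\<lambda>i j. X (int i - int j, int j) / \<alpha> (int i - int j)) a b \<partial>exp_env UNIV)
    = (\<integral>w. lpp (\<lambda>i j. w (i, j) / \<alpha> (int i - int j)) a b \<partial>?P)"
    using exp_env_reindex_integral(2)[OF t m] by (simp add: t_def)
  also have "\<dots> = (\<integral>w. (1 / r) * lpp (\<lambda>i j. q (i, j) * w (i, j)) a b \<partial>?P)"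
  proof (rule Bochner_Integration.integral_cong[OF refl])
    fix w :: "nat \<times> nat \<Rightarrow> real"
    have "(\<lambda>i j. w (i, j) / \<alpha> (int i - int j)) = (\<lambda>i j. (1 / r) * (q (i, j) * w (i, j)))"
      using r pos by (auto simp: q_def fun_eq_iff)
    then show "lpp (\<lambda>i j. w (i, j) / \<alpha> (int i - int j)) a b = (1 / r) * lpp (\<lambda>i j. q (i, j) * w (i, j)) a b"
      using lpp_scale[of "1 / r" "\<lambda>i j. q (i, j) * w (i, j)" a b] r by simp
  qed
  also have "\<dots> = (1 / r) * (\<integral>w. lpp (\<lambda>i j. q (i, j) * w (i, j)) a b \<partial>?P)"
    by simp
  finally have 1: "(\<integral>X. lpp (\<lambda>i j. X (int i - int j, int j) / \<alpha> (int i - int j)) a b \<partial>exp_env UNIV)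
    = (1 / r) * (\<integral>w. lpp (\<lambda>i j. q (i, j) * w (i, j)) a b \<partial>?P)" .
  have i1: "integrable ?P (\<lambda>w. lpp (\<lambda>i j. q (i, j) * w (i, j)) a b)"
    using lpp_jensen[of a b ?P "\<lambda>w i j. q (i, j) * w (i, j)"] exp_env_mean[of _ "UNIV :: (nat \<times> nat) set"] by simp
  have i2: "integrable ?P (\<lambda>w. lpp (\<lambda>i j. q (i, j) * w (i, j) + (1 - q (i, j))) a b)"
    using lpp_jensen[of a b ?P "\<lambda>w i j. q (i, j) * w (i, j) + (1 - q (i, j))"] exp_env_mean[of _ "UNIV :: (nat \<times> nat) set"] by simp
  have "(\<integral>w. lpp (\<lambda>i j. q (i, j) * w (i, j)) a b \<partial>?P) + sum ?e (cols_between (int a - int b))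
    = (\<integral>w. lpp (\<lambda>i j. q (i, j) * w (i, j)) a b + sum ?e (cols_between (int a - int b)) \<partial>?P)"
    using i1 P.prob_space by simp
  also have "\<dots> \<le> (\<integral>w. lpp (\<lambda>i j. q (i, j) * w (i, j) + (1 - q (i, j))) a b \<partial>?P)"
  proof (rule integral_mono)
    fix w :: "nat \<times> nat \<Rightarrow> real"
    show "lpp (\<lambda>i j. q (i, j) * w (i, j)) a b + sum ?e (cols_between (int a - int b))
      \<le> lpp (\<lambda>i j. q (i, j) * w (i, j) + (1 - q (i, j))) a b"
      using lpp_add_columns[of ?e "\<lambda>i j. q (i, j) * w (i, j)" a b, OF e] by (simp add: q_def)
  qed (use i1 i2 in auto)
  also have "\<dots> \<le> (\<integral>w. lpp (\<lambda>i j. w (i, j)) a b \<partial>?P)"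
    by (rule lpp_mean_thinning[OF q])
  also have "\<dots> \<le> 2 * real a + 2 * real b + 4 + 2 * sqrt (real a + 1) + 2 * sqrt (real b + 1)"
    by (rule hom_lpp_mean_upper)
  finally have "((\<integral>w. lpp (\<lambda>i j. q (i, j) * w (i, j)) a b \<partial>?P) + sum ?e (cols_between (int a - int b))) / r
    \<le> (2 * real a + 2 * real b + 4 + 2 * sqrt (real a + 1) + 2 * sqrt (real b + 1)) / r"
    using r by (intro divide_right_mono) auto
  moreover have "sum ?e (cols_between (int a - int b)) / r = (\<Sum>i\<in>cols_between (int a - int b). 1 / r - 1 / \<alpha> i)"
    unfolding sum_divide_distrib using r by (intro sum.cong) (auto simp: field_simps)
  ultimately show ?thesis unfolding 1 by (simp only: add_divide_distrib[of "\<integral>w. lpp (\<lambda>i j. q (i, j) * w (i, j)) a b \<partial>?P"] times_divide_eq_left mult_1_left)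
qed

subsection \<open>A superadditive ergodic theorem\<close>

lemma frequently_of_less_Limsup:
  fixes f :: "'a \<Rightarrow> ereal"
  assumes "y < Limsup F f"
  shows "\<exists>\<^sub>F x in F. y < f x"
proof (rule ccontr)
  assume "\<not> (\<exists>\<^sub>F x in F. y < f x)"
  then have "\<forall>\<^sub>F x in F. f x \<le> y" by (simp add: not_frequently not_less)
  then have "Limsup F f \<le> y" by (rule Limsup_bounded)
  then show False using assms by simp
qed

text \<open>A greedy chain of good blocks: starting from a good point, jump over a block of length at most
\<open>N\<close> whose mean is at least \<open>\<phi>\<close>; at a bad point move on by one.\<close>

lemma greedy_chain:
  fixes S :: "nat \<Rightarrow> 'a \<Rightarrow> real"
  assumes S0: "\<And>n x. 0 \<le> S n x"
    and super: "\<And>m n x. S m x + S n ((T ^^ m) x) \<le> S (m + n) x"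
    and \<phi>: "0 \<le> \<phi>"
    and bad: "\<And>x. \<not> bad x \<Longrightarrow> \<exists>n. 1 \<le> n \<and> n \<le> N \<and> \<phi> * real n \<le> S n x"
  shows "\<phi> * (real n - real N - real (card {k. k < n \<and> bad ((T ^^ k) x)})) \<le> S n x"
proof (induction n arbitrary: x rule: less_induct)
  case (less n)
  show ?case
  proof (cases "n \<le> N")
    case True
    then have "\<phi> * (real n - real N - real (card {k. k < n \<and> bad ((T ^^ k) x)})) \<le> 0"
      using \<phi> by (intro mult_nonneg_nonpos) auto
    then show ?thesis using S0[of n x] by linarith
  next
    case False
    define C where "C n x = {k. k < n \<and> bad ((T ^^ k) x)}" for n x
    have finC: "finite (C n x)" for n x by (simp add: C_def)
    \<comment> \<open>\<open>m\<close> is the length of the jump and \<open>d\<close> the number of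
      bad points it is charged for: d = 1 for a unit step off a bad point, d = 0 for a good
      block.\<close>
    have step: "\<phi> * (real n - real N - real (card (C n x))) \<le> S n x"
      if m: "1 \<le> m" "m \<le> n" and c: "card (C (n - m) ((T ^^ m) x)) + d \<le> card (C n x)" "\<phi> * (real m - real d) \<le> S m x" for m d
    proof -
      have "\<phi> * (real (n - m) - real N - real (card (C (n - m) ((T ^^ m) x)))) \<le> S (n - m) ((T ^^ m) x)"
        unfolding C_def by (rule less) (use m False in auto)
      then have "\<phi> * (real m - real d) + \<phi> * (real (n - m) - real N - real (card (C (n - m) ((T ^^ m) x)))) \<le> S n x"
        using c super[of m x "n - m"] m by simp
      moreover have "\<phi> * (real n - real N - real (card (C n x))) \<le>
        \<phi> * ((real m - real d) + (real (n - m) - real N - real (card (C (n - m) ((T ^^ m) x)))))"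
        using c(1) m by (intro mult_left_mono \<phi>) linarith
      ultimately show ?thesis by (simp add: distrib_left)
    qed
    have sub: "(\<lambda>k. k + m) ` C (n - m) ((T ^^ m) x) \<subseteq> C n x" for m
      by (auto simp: C_def funpow_add)
    have cardi: "card ((\<lambda>k. k + m) ` C (n - m) ((T ^^ m) x)) = card (C (n - m) ((T ^^ m) x))" for m
      by (intro card_image) (auto simp: inj_on_def)
    show ?thesis
    proof (cases "bad x")
      case True
      have "insert 0 ((\<lambda>k. k + 1) ` C (n - 1) ((T ^^ 1) x)) \<subseteq> C n x"
        using sub[of 1] True False by (auto simp: C_def)
      then have "card (insert 0 ((\<lambda>k. k + 1) ` C (n - 1) ((T ^^ 1) x))) \<le> card (C n x)"
        by (intro card_mono finC)
      then have "card (C (n - 1) ((T ^^ 1) x)) + 1 \<le> card (C n x)"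
        using cardi[of 1] finC by (subst (asm) card_insert_disjoint) auto
      then show ?thesis using step[of 1 1] S0[of 1 x] False by (auto simp: C_def)
    next
      case good: False
      then obtain m where m: "1 \<le> m" "m \<le> N" "\<phi> * real m \<le> S m x" using bad by blast
      have "card (C (n - m) ((T ^^ m) x)) \<le> card (C n x)"
        using card_mono[OF finC sub[of m]] cardi[of m] by simp
      then show ?thesis using step[of m 0] m False by (auto simp: C_def)
    qed
  qed
qed

lemma funpow_measure_preserving:
  assumes T: "T \<in> M \<rightarrow>\<^sub>M M" "distr M M T = M"
  shows "T ^^ k \<in> M \<rightarrow>\<^sub>M M" "distr M M (T ^^ k) = M"
proof (induction k)
  case 0
  { case 1 show ?case by (simp add: id_def)
  next case 2 show ?case by (simp add: id_def distr_id2) }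
next
  case (Suc k)
  { case 1 show ?case using measurable_comp[OF Suc.IH(1) T(1)] by (simp add: comp_def)
  next case 2 show ?case
      unfolding funpow.simps(2) using distr_distr[OF T(1) Suc.IH(1)] Suc.IH(2) T(2) by metis }
qed

lemma AE_measure_preserving:
  assumes "T \<in> M \<rightarrow>\<^sub>M M" "distr M M T = M" "AE x in M. P x"
  shows "AE x in M. P (T x)"
  by (rule AE_distrD[OF assms(1)], subst assms(2), rule assms(3))

text \<open>Since n / (n + 1) tends to 1, the index shift does not affect growth rates. The argument
  goes by contradiction with real levels s' < t' between the two limsups, because these may be
  infinite.\<close>

lemma limsup_shift_le:
  fixes S :: "nat \<Rightarrow> 'a \<Rightarrow> real"
  assumes S0: "\<And>n x. 0 \<le> S n x" and shift: "\<And>n. S n y \<le> S (Suc n) x"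
  shows "limsup (\<lambda>n. ereal (S n y / n)) \<le> limsup (\<lambda>n. ereal (S n x / n))"
proof (rule ccontr)
  assume "\<not> ?thesis"
  then have "limsup (\<lambda>n. ereal (S n x / n)) < limsup (\<lambda>n. ereal (S n y / n))" by simp
  then obtain t where t: "limsup (\<lambda>n. ereal (S n x / n)) < t" "t < limsup (\<lambda>n. ereal (S n y / n))"
    using dense by blast
  obtain s where s: "limsup (\<lambda>n. ereal (S n x / n)) < s" "s < t" using dense[OF t(1)] by blast
  have "0 \<le> limsup (\<lambda>n. ereal (S n x / n))"
    by (rule order_trans[OF _ Liminf_le_Limsup]) (auto intro!: Liminf_bounded simp: S0)
  then have "0 \<le> s" "s < \<infinity>" "t < \<infinity>" using s t by auto
  then obtain s' t' where st: "s = ereal s'" "t = ereal t'" using s t by (cases s; cases t) auto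
  have ev: "\<forall>\<^sub>F n in sequentially. ereal (S n x / n) < s" by (rule Limsup_lessD[OF s(1)])
  then have ev: "\<forall>\<^sub>F n in sequentially. S (Suc n) x / Suc n < s'"
    by (subst (asm) eventually_sequentially_Suc[symmetric]) (simp add: st)
  have "\<exists>\<^sub>F n in sequentially. t < ereal (S n y / n)" by (rule frequently_of_less_Limsup[OF t(2)])
  then have fr: "\<exists>\<^sub>F n in sequentially. t' < S n y / n" by (simp add: st)
  have ts: "s' < t'" using s st by simp
  have "\<forall>\<^sub>F n::nat in sequentially. s' / (t' - s') < n"
    by (rule eventually_gt_at_top[THEN filterlim_real_sequentially[unfolded filterlim_iff, rule_format]])
  then have "\<forall>\<^sub>F n in sequentially. \<not> t' < S n y / n"
    using ev eventually_gt_at_top[of 0]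
  proof eventually_elim
    case (elim n)
    show ?case
    proof
      assume "t' < S n y / n"
      then have "t' * n < S n y" using elim by (simp add: field_simps)
      also have "\<dots> \<le> S (Suc n) x" by (rule shift)
      also have "\<dots> < s' * Suc n" using elim(2) by (simp add: field_simps)
      finally have "(t' - s') * n < s'" by (simp add: algebra_simps)
      moreover have "s' < (t' - s') * n" using elim(1) ts by (simp add: field_simps)
      ultimately show False by simp
    qed
  qed
  then show False using fr by (simp add: frequently_def)
qed

text \<open>No ergodicity of \<open>T\<close> is assumed; the hypothesis \<open>lower\<close> takes
  its place. The truncated limsup F satisfies F(T x) <= F x with equal integrals, so it is almost
  surely invariant. A greedy chain along orbits, as in the Katznelson-Weiss proof of the ergodic
  theorem, then yields that the mean of F is at most c, and c <= F forces F = c.\<close>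

lemma superadditive_ergodic:
  fixes S :: "nat \<Rightarrow> 'a \<Rightarrow> real" and c :: real
  assumes "prob_space M"
    and T: "T \<in> M \<rightarrow>\<^sub>M M" "distr M M T = M"
    and S0: "\<And>n x. 0 \<le> S n x"
    and super: "\<And>m n x. S m x + S n ((T ^^ m) x) \<le> S (m + n) x"
    and int: "\<And>n. integrable M (S n)"
    and mean: "\<And>n. (\<integral>x. S n x \<partial>M) \<le> c * n"
    and lower: "AE x in M. ereal c \<le> liminf (\<lambda>n. ereal (S n x / n))"
  shows "AE x in M. (\<lambda>n. S n x / n) \<longlonglongrightarrow> c"
proof -
  interpret prob_space M by fact
  have [measurable]: "S n \<in> borel_measurable M" for n using int[of n] by auto
  note Tk [measurable] = funpow_measure_preserving[OF T]
  have "0 \<le> (\<integral>x. S 1 x \<partial>M)" by (intro integral_nonneg_AE) (simp add: S0)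
  then have c0: "0 \<le> c" using mean[of 1] by simp
  \<comment> \<open>Cutting at a level strictly above \<open>c\<close> makes F bounded while F = c
    still identifies the untruncated limsup.\<close>
  define K where "K = c + 1"
  define U where "U x = limsup (\<lambda>n. ereal (S n x / n))" for x
  have [measurable]: "U \<in> borel_measurable M" unfolding U_def by measurable
  have U0: "0 \<le> U x" for x
    unfolding U_def by (rule order_trans[OF _ Liminf_le_Limsup]) (auto intro!: Liminf_bounded simp: S0)
  define F where "F x = real_of_ereal (min (U x) (ereal K))" for x
  have [measurable]: "F \<in> borel_measurable M" unfolding F_def by measurable
  have F: "ereal (F x) = min (U x) (ereal K)" for x
    unfolding F_def using U0[of x] c0 by (cases "U x") (auto simp: K_def min_def)
  have F0: "0 \<le> F x" "F x \<le> K" for x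
  proof -
    have "0 \<le> ereal (F x)" "ereal (F x) \<le> ereal K"
      unfolding F using U0[of x] c0 by (auto simp: K_def)
    then show "0 \<le> F x" "F x \<le> K" by auto
  qed
  have K0: "0 \<le> K" using c0 by (simp add: K_def)
  have intF: "integrable M F"
    by (rule integrable_const_bound[of _ K]) (use F0 in auto)
  have shift: "S n (T x) \<le> S (Suc n) x" for n x
    using super[of 1 x n] S0[of 1 x] by simp
  have FT: "F (T x) \<le> F x" for x
  proof -
    have "ereal (F (T x)) \<le> ereal (F x)"
      unfolding F using limsup_shift_le[of S "T x" x, OF S0 shift] unfolding U_def by (rule min.mono) simp
    then show ?thesis by simp
  qed
  have intFT: "integrable M (\<lambda>x. F (T x))"
    by (rule integrable_const_bound[of _ K]) (use F0 T(1) in auto)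
  have "(\<integral>x. F (T x) \<partial>M) = (\<integral>x. F x \<partial>M)"
    using integral_distr[OF T(1), of F] T(2) by simp
  then have "(\<integral>x. F x - F (T x) \<partial>M) = 0" using intF intFT by simp
  then have "AE x in M. F x - F (T x) = 0"
    using FT intF intFT by (subst (asm) integral_nonneg_eq_0_iff_AE) auto
  then have "AE x in M. F (T x) = F x" by eventually_elim simp
  then have "AE x in M. F (T ((T ^^ k) x)) = F ((T ^^ k) x)" for k
    by (rule AE_measure_preserving[OF Tk])
  then have "AE x in M. \<forall>k. F (T ((T ^^ k) x)) = F ((T ^^ k) x)" by (simp add: AE_all_countable)
  then have inv: "AE x in M. \<forall>k. F ((T ^^ k) x) = F x"
  proof eventually_elim
    case (elim x)
    have "F ((T ^^ k) x) = F x" for k by (induction k) (use elim in auto)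
    then show ?case by simp
  qed
  have upper: "(\<integral>x. F x \<partial>M) \<le> c + e" if e: "0 < e" for e
  proof -
    \<comment> \<open>Lowered by \<open>e\<close>, the level is attained at some finite time from
      every point, so the probability of having to wait longer than N tends to 0.\<close>
    define \<phi> where "\<phi> x = max 0 (F x - e)" for x
    have \<phi>0: "0 \<le> \<phi> x" "\<phi> x \<le> K" for x using F0[of x] e K0 by (auto simp: \<phi>_def)
    have [measurable]: "\<phi> \<in> borel_measurable M" unfolding \<phi>_def by measurable
    have int\<phi>: "integrable M \<phi>"
      by (rule integrable_const_bound[of _ K]) (use \<phi>0 in auto)
    define bad where "bad N x \<longleftrightarrow> (\<forall>n\<in>{1..N}. S n x < \<phi> x * n)" for N :: nat and x
    define p where "p N = prob {x \<in> space M. bad N x}" for N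
    have [measurable]: "Measurable.pred M (bad N)" for N unfolding bad_def by measurable
    have ex: "\<exists>n\<ge>1. \<phi> x * n \<le> S n x" for x
    proof (cases "F x - e \<le> 0")
      case True
      then show ?thesis using S0[of 1 x] by (intro exI[of _ 1]) (simp add: \<phi>_def)
    next
      case False
      have "ereal (F x - e) < ereal (F x)" using e by simp
      also have "\<dots> \<le> U x" unfolding F by simp
      finally have "\<exists>\<^sub>F n in sequentially. ereal (F x - e) < ereal (S n x / n)"
        unfolding U_def by (rule frequently_of_less_Limsup)
      then have "\<exists>\<^sub>F n in sequentially. ereal (F x - e) < ereal (S n x / n) \<and> 0 < n"
        using eventually_gt_at_top[of "0::nat"] by (rule frequently_eventually_frequently)
      then obtain n where "F x - e < S n x / n" "0 < n" by (auto dest: frequently_ex)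
      then show ?thesis using False by (intro exI[of _ n]) (auto simp: \<phi>_def field_simps)
    qed
    have plim: "p \<longlonglongrightarrow> 0"
    proof -
      have "(\<lambda>N. prob {x \<in> space M. bad N x}) \<longlonglongrightarrow> prob (\<Inter>N. {x \<in> space M. bad N x})"
        by (rule finite_Lim_measure_decseq) (auto simp: decseq_def bad_def)
      moreover have "(\<Inter>N. {x \<in> space M. bad N x}) = {}"
      proof (rule equals0I)
        fix x assume x: "x \<in> (\<Inter>N. {x \<in> space M. bad N x})"
        obtain n where "n \<ge> 1" "\<phi> x * n \<le> S n x" using ex by blast
        moreover have "bad n x" using x by blast
        ultimately show False unfolding bad_def by force
      qed
      ultimately show ?thesis unfolding p_def by simp
    qed
    have ineq: "(real n - real N) * (\<integral>x. \<phi> x \<partial>M) - K * (n * p N) \<le> c * n" for n N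
    proof -
      define B where "B x = (\<Sum>k<n. indicator {x \<in> space M. bad N x} ((T ^^ k) x) :: real)" for x
      have bk: "integrable M (\<lambda>x. indicator {x \<in> space M. bad N x} ((T ^^ k) x) :: real)"
        "(\<integral>x. indicator {x \<in> space M. bad N x} ((T ^^ k) x) \<partial>M) = p N" for k
      proof -
        show "integrable M (\<lambda>x. indicator {x \<in> space M. bad N x} ((T ^^ k) x) :: real)"
          by (rule integrable_const_bound[of _ 1]) auto
        show "(\<integral>x. indicator {x \<in> space M. bad N x} ((T ^^ k) x) \<partial>M) = p N"
          using integral_distr[OF Tk(1)[of k], of "indicator {x \<in> space M. bad N x} :: _ \<Rightarrow> real"]
          unfolding Tk(2) p_def by simp
      qed
      have B: "integrable M B" "(\<integral>x. B x \<partial>M) = n * p N"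
        unfolding B_def using bk by (auto simp: Bochner_Integration.integral_sum)
      have "(\<integral>x. (real n - real N) * \<phi> x - K * B x \<partial>M) \<le> (\<integral>x. S n x \<partial>M)"
      proof (rule integral_mono_AE)
        show "integrable M (\<lambda>x. (real n - real N) * \<phi> x - K * B x)" using int\<phi> B by auto
        show "AE x in M. (real n - real N) * \<phi> x - K * B x \<le> S n x"
          using inv AE_space
        proof eventually_elim
          case (elim x)
          have orbit: "(T ^^ k) x \<in> space M" for k using measurable_space[OF Tk(1)] elim(2) .
          \<comment> \<open>The greedy chain needs one level along the whole orbit, that of its
            starting point \<open>x\<close>; invariance of F identifies the resulting bad points
            with those of \<open>bad N\<close>.\<close>
          define bad' where "bad' y \<longleftrightarrow> (\<forall>n\<in>{1..N}. S n y < \<phi> x * n)" for y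
          have same: "bad' ((T ^^ k) x) \<longleftrightarrow> bad N ((T ^^ k) x)" for k
            using elim(1) by (simp add: bad'_def bad_def \<phi>_def)
          have "\<phi> x * (real n - real N - real (card {k. k < n \<and> bad' ((T ^^ k) x)})) \<le> S n x"
          proof (rule greedy_chain[OF S0 super \<phi>0(1)])
            fix y assume "\<not> bad' y"
            then obtain m where "m \<in> {1..N}" "\<not> S m y < \<phi> x * m" unfolding bad'_def by blast
            then show "\<exists>n. 1 \<le> n \<and> n \<le> N \<and> \<phi> x * real n \<le> S n y"
              by (intro exI[of _ m]) auto
          qed
          moreover have "real (card {k. k < n \<and> bad' ((T ^^ k) x)}) = B x"
            unfolding B_def same indicator_def using orbit
            by (simp add: sum.If_cases Int_def flip: of_bool_def)
          ultimately have "\<phi> x * (real n - real N - B x) \<le> S n x" by simp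
          moreover have "\<phi> x * B x \<le> K * B x"
            using \<phi>0(2)[of x] by (intro mult_right_mono) (auto simp: B_def intro: sum_nonneg)
          ultimately show ?case by (simp add: algebra_simps)
        qed
      qed (fact int)
      also have "\<dots> \<le> c * n" by (rule mean)
      finally show ?thesis using int\<phi> B by simp
    qed
    have ineq2: "(\<integral>x. \<phi> x \<partial>M) - K * p N \<le> c" for N
    proof -
      have "(\<lambda>n. ((\<integral>x. \<phi> x \<partial>M) - K * p N) - real N * (\<integral>x. \<phi> x \<partial>M) * (1 / n)) \<longlonglongrightarrow> ((\<integral>x. \<phi> x \<partial>M) - K * p N) - real N * (\<integral>x. \<phi> x \<partial>M) * 0"
        by (intro tendsto_intros lim_1_over_n)
      moreover have "\<forall>\<^sub>F n in sequentially. ((\<integral>x. \<phi> x \<partial>M) - K * p N) - real N * (\<integral>x. \<phi> x \<partial>M) * (1 / n) \<le> c"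
        using eventually_gt_at_top[of "0::nat"]
      proof eventually_elim
        case (elim n)
        have "(((\<integral>x. \<phi> x \<partial>M) - K * p N) - real N * (\<integral>x. \<phi> x \<partial>M) * (1 / n)) * n \<le> c * n"
          using ineq[of n N] elim by (simp add: algebra_simps)
        then show ?case using elim by simp
      qed
      ultimately show ?thesis
        using tendsto_upperbound[of _ _ sequentially c] by force
    qed
    have "(\<lambda>N. (\<integral>x. \<phi> x \<partial>M) - K * p N) \<longlonglongrightarrow> (\<integral>x. \<phi> x \<partial>M) - K * 0"
      by (intro tendsto_intros plim)
    then have "(\<integral>x. \<phi> x \<partial>M) \<le> c"
      using ineq2 by (intro tendsto_upperbound[of _ _ sequentially c]) auto
    moreover have "(\<integral>x. F x - e \<partial>M) \<le> (\<integral>x. \<phi> x \<partial>M)"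
      using intF int\<phi> by (intro integral_mono) (auto simp: \<phi>_def)
    ultimately show ?thesis using intF prob_space by simp
  qed
  then have EF: "(\<integral>x. F x \<partial>M) \<le> c" by (rule field_le_epsilon)
  have ge: "AE x in M. c \<le> F x"
    using lower
  proof eventually_elim
    case (elim x)
    have "ereal c \<le> U x" using elim unfolding U_def by (rule order_trans) (rule Liminf_le_Limsup, simp)
    then have "ereal c \<le> ereal (F x)" unfolding F by (simp add: K_def)
    then show ?case by simp
  qed
  have "(\<integral>x. F x - c \<partial>M) \<le> 0" using EF intF prob_space by simp
  moreover have "0 \<le> (\<integral>x. F x - c \<partial>M)" using ge by (intro integral_nonneg_AE) auto
  ultimately have "(\<integral>x. F x - c \<partial>M) = 0" by simp
  then have "AE x in M. F x - c = 0"
    using ge intF by (subst (asm) integral_nonneg_eq_0_iff_AE) auto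
  then show ?thesis using lower
  proof eventually_elim
    case (elim x)
    have "min (U x) (ereal K) = ereal c" using F[of x] elim(1) by simp
    then have "U x = ereal c" by (auto simp: K_def min_def split: if_splits)
    moreover have "liminf (\<lambda>n. ereal (S n x / n)) \<le> U x"
      unfolding U_def by (rule Liminf_le_Limsup) simp
    ultimately have "(\<lambda>n. ereal (S n x / n)) \<longlonglongrightarrow> ereal c"
      using elim(2) by (subst tendsto_iff_Liminf_eq_Limsup) (auto simp: U_def)
    then show ?case by simp
  qed
qed

subsection \<open>Independent blocks\<close>

text \<open>Hoeffding's inequality bounds the failure probability at n by q^n with q < 1;
  Borel-Cantelli concludes.\<close>

lemma bounded_indep_lower:
  fixes X :: "nat \<Rightarrow> 'a \<Rightarrow> real"
  assumes "prob_space M" and indep: "prob_space.indep_vars M (\<lambda>_. borel) X UNIV"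
    and X: "\<And>l x. 0 \<le> X l x \<and> X l x \<le> K" and K: "0 < K"
    and mean: "\<And>l. (\<integral>x. X l x \<partial>M) = \<mu>" and e: "0 < e"
  shows "AE x in M. \<forall>\<^sub>F n in sequentially. real n * (\<mu> - e) \<le> (\<Sum>l<n. X l x)"
proof -
  interpret prob_space M by fact
  have [measurable]: "X l \<in> borel_measurable M" for l using indep unfolding indep_vars_def by auto
  define A where "A n = {x \<in> space M. (\<Sum>l<n. X l x) \<le> real n * \<mu> - real n * e}" for n
  define q where "q = exp (- 2 * e\<^sup>2 / K\<^sup>2)"
  have q: "0 \<le> q" "q < 1" using e K by (auto simp: q_def)
  have bound: "prob (A n) \<le> q ^ n" for n
  proof (cases "n = 0")
    case False
    interpret H: Hoeffding_ineq M "{..<n}" X "\<lambda>_. 0" "\<lambda>_. K" "\<Sum>l<n. expectation (X l)"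
      by unfold_locales (auto intro: indep_vars_subset[OF indep] simp: X)
    have "prob (A n) \<le> exp (- 2 * (real n * e)\<^sup>2 / (\<Sum>l<n. (K - 0)\<^sup>2))"
      using H.Hoeffding_ineq_le[of "real n * e"] e K False by (simp add: A_def mean)
    also have "- 2 * (real n * e)\<^sup>2 / (\<Sum>l<n. (K - 0)\<^sup>2) = real n * (- 2 * e\<^sup>2 / K\<^sup>2)"
      using False K by (simp add: power_mult_distrib power2_eq_square[of "real n"])
    finally show ?thesis by (simp only: q_def exp_of_nat_mult)
  qed simp
  have [measurable]: "A n \<in> sets M" for n unfolding A_def by measurable
  have "summable (\<lambda>n. prob (A n))"
    by (rule summable_comparison_test'[OF summable_geometric, of q 0]) (use q bound in auto)
  then have "AE x in M. \<forall>\<^sub>F n in sequentially. x \<in> space M - A n"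
    by (intro borel_cantelli_AE1) (auto simp: emeasure_eq_measure)
  then show ?thesis
  proof eventually_elim
    case (elim x)
    then show ?case by eventually_elim (auto simp: A_def algebra_simps)
  qed
qed

lemma indep_vars_coordinates:
  assumes "\<And>k. prob_space (N k)"
  shows "prob_space.indep_vars (PiM UNIV N) N (\<lambda>k w. w k) UNIV"
proof -
  interpret prob_space "PiM UNIV N" by (intro prob_space_PiM assms)
  have "distr (PiM UNIV N) (N k) (\<lambda>w. w k) = N k" for k
    by (intro distr_PiM_component assms) simp
  moreover have "distr (PiM UNIV N) (PiM UNIV N) (\<lambda>x. \<lambda>i\<in>UNIV. x i) = PiM UNIV N"
    by (simp add: distr_id2 restrict_def)
  ultimately show ?thesis
    by (subst indep_vars_iff_distr_eq_PiM') auto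
qed

lemma indep_vars_blocks:
  fixes g :: "'l \<Rightarrow> ('k \<Rightarrow> 'c) \<Rightarrow> real"
  assumes N: "\<And>k. prob_space (N k)" and A: "disjoint_family A"
    and g: "\<And>l. g l \<in> borel_measurable (PiM (A l) N)" "\<And>l w. g l (restrict w (A l)) = g l w"
  shows "prob_space.indep_vars (PiM UNIV N) (\<lambda>_. borel) g UNIV"
proof -
  interpret prob_space "PiM UNIV N" by (intro prob_space_PiM N)
  have "indep_vars (\<lambda>l. PiM (A l) N) (\<lambda>l w. restrict (\<lambda>k. w k) (A l)) UNIV"
    using A by (intro indep_vars_restrict[OF indep_vars_coordinates[OF N]]) auto
  from indep_vars_compose2[OF this, of g "\<lambda>_. borel"] g show ?thesis by simp
qed

subsection \<open>The random environment\<close>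

locale disorder_law =
  fixes L :: "real measure" and r :: real
  assumes prob_L: "prob_space L" and sets_L [measurable_cong]: "sets L = sets borel"
    and r_pos: "0 < r" and L_ge: "AE a in L. r \<le> a"
begin

interpretation L: prob_space L by (rule prob_L)

text \<open>\<open>Inl i\<close> indexes the rate of column i, \<open>Inr (i, j)\<close> a unit
  exponential clock, divided by the rate afterwards. The clocks' law is thus free of the disorder,
  and a translation acts on both at once.\<close>

definition env_law :: "int + int \<times> int \<Rightarrow> real measure" where
  "env_law = case_sum (\<lambda>_. L) (\<lambda>_. expd 1)"

definition env :: "(int + int \<times> int \<Rightarrow> real) measure" where
  "env = PiM UNIV env_law"

lemma prob_env_law: "prob_space (env_law k)"
  by (cases k) (auto simp: env_law_def prob_L prob_space_exp1)

lemma prob_env: "prob_space env"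
  unfolding env_def by (intro prob_space_PiM prob_env_law)

interpretation env: prob_space env by (rule prob_env)

lemma sets_env_law: "sets (env_law k) = sets borel"
  by (cases k) (auto simp: env_law_def sets_L)

lemma measurable_env_component: "k \<in> A \<Longrightarrow> (\<lambda>w. w k) \<in> borel_measurable (PiM A env_law)"
  using measurable_component_singleton[of k A env_law] measurable_cong_sets[OF refl sets_env_law] by blast

text \<open>The truncations only matter on a null set; they make the weights nonnegative everywhere.\<close>

definition wt :: "(int + int \<times> int \<Rightarrow> real) \<Rightarrow> nat \<Rightarrow> nat \<Rightarrow> real" where
  "wt w a b = max 0 (w (Inr (int a - int b, int b))) / max r (w (Inl (int a - int b)))"

lemma wt_nonneg: "0 \<le> wt w a b"
  using r_pos by (auto simp: wt_def)

text \<open>Translation of the quadrant by \<open>(c, d)\<close> moves columns by c - d. For c = d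
  every column stays in place and only the clocks are renewed, the case in which blocks are not
  independent.\<close>

definition shift :: "nat \<Rightarrow> nat \<Rightarrow> (int + int \<times> int \<Rightarrow> real) \<Rightarrow> int + int \<times> int \<Rightarrow> real" where
  "shift c d w = (\<lambda>k. w (case k of Inl i \<Rightarrow> Inl (i + (int c - int d)) | Inr (i, j) \<Rightarrow> Inr (i + (int c - int d), j + int d)))"

lemma wt_shift: "wt (shift c d w) a b = wt w (c + a) (d + b)"
  by (simp add: wt_def shift_def algebra_simps)

lemma wt_shift_funpow: "wt ((shift c d ^^ k) w) a b = wt w (k * c + a) (k * d + b)"
  by (induction k arbitrary: a b) (auto simp: wt_shift algebra_simps)

lemma shift_measure_preserving:
  "shift c d \<in> env \<rightarrow>\<^sub>M env" "distr env env (shift c d) = env"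
proof -
  define \<sigma> where "\<sigma> k = (case k of Inl i \<Rightarrow> Inl (i + (int c - int d)) | Inr (i, j) \<Rightarrow> Inr (i + (int c - int d), j + int d))" for k :: "int + int \<times> int"
  have \<sigma>: "inj \<sigma>" by (auto simp: \<sigma>_def inj_def split: sum.splits prod.splits)
  have law: "env_law (\<sigma> k) = env_law k" for k by (auto simp: \<sigma>_def env_law_def split: sum.splits prod.splits)
  have s: "shift c d = (\<lambda>w. \<lambda>k\<in>UNIV. w (\<sigma> k))" by (auto simp: shift_def \<sigma>_def fun_eq_iff)
  show "distr env env (shift c d) = env"
    using distr_PiM_reindex[of UNIV env_law \<sigma> UNIV] \<sigma> prob_env_law unfolding law s env_def by simp
  show "shift c d \<in> env \<rightarrow>\<^sub>M env"
    unfolding s env_def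
  proof (rule measurable_restrict)
    fix k :: "int + int \<times> int"
    show "(\<lambda>w. w (\<sigma> k)) \<in> Pi\<^sub>M UNIV env_law \<rightarrow>\<^sub>M env_law k"
      using measurable_component_singleton[of "\<sigma> k" UNIV env_law] by (simp add: law)
  qed
qed

text \<open>The columns that paths from \<open>k (c, d)\<close> to \<open>(k + m) (c, d)\<close> can meet.\<close>

definition cols :: "nat \<Rightarrow> nat \<Rightarrow> nat \<Rightarrow> nat \<Rightarrow> int set" where
  "cols c d k m = {int k * (int c - int d) - int (m * d) .. int k * (int c - int d) + int (m * c)}"

definition block :: "nat \<Rightarrow> nat \<Rightarrow> nat \<Rightarrow> nat \<Rightarrow> (int + int \<times> int \<Rightarrow> real) \<Rightarrow> real" where
  "block c d k m w = lpp (\<lambda>i j. wt w (k * c + i) (k * d + j)) (m * c) (m * d)"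

lemma block_nonneg: "0 \<le> block c d k m w"
  unfolding block_def by (intro lpp_nonneg wt_nonneg)

lemma block_eq: "block c d k m w = lpp (wt ((shift c d ^^ k) w)) (m * c) (m * d)"
  unfolding block_def wt_shift_funpow ..

lemma block_cols:
  assumes "i \<le> m * c" "j \<le> m * d"
  shows "int (k * c + i) - int (k * d + j) \<in> cols c d k m"
  using assms by (auto simp: cols_def algebra_simps) (metis of_nat_le_iff of_nat_mult add_increasing of_nat_0_le_iff)+

lemma block_restrict:
  "block c d k m (restrict w (Inl ` cols c d k m \<union> Inr ` (cols c d k m \<times> UNIV))) = block c d k m w"
  unfolding block_def
proof (rule lpp_cong)
  fix i j assume "i \<le> m * c" "j \<le> m * d"
  from block_cols[OF this, of k]
  show "wt (restrict w (Inl ` cols c d k m \<union> Inr ` (cols c d k m \<times> UNIV))) (k * c + i) (k * d + j) = wt w (k * c + i) (k * d + j)"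
    unfolding wt_def by (auto simp: image_iff)
qed

lemma measurable_block:
  "block c d k m \<in> borel_measurable (PiM (Inl ` cols c d k m \<union> Inr ` (cols c d k m \<times> UNIV)) env_law)"
  unfolding block_def
proof (rule borel_measurable_lpp)
  fix i j assume "i \<le> m * c" "j \<le> m * d"
  note bc = block_cols[OF this, of k]
  show "(\<lambda>w. wt w (k * c + i) (k * d + j)) \<in> borel_measurable (PiM (Inl ` cols c d k m \<union> Inr ` (cols c d k m \<times> UNIV)) env_law)"
    unfolding wt_def
    by (intro borel_measurable_divide borel_measurable_max borel_measurable_const measurable_env_component) (use bc in auto)
qed

lemma measurable_wt [measurable]: "(\<lambda>w. wt w a b) \<in> borel_measurable env"
  unfolding wt_def env_def
  by (intro borel_measurable_divide borel_measurable_max borel_measurable_const measurable_env_component) auto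

lemma measurable_lpp_wt [measurable]: "(\<lambda>w. lpp (\<lambda>i j. wt w (a' + i) (b' + j)) a b) \<in> borel_measurable env"
  by (intro borel_measurable_lpp) simp

lemma measurable_lpp_wt0 [measurable]: "(\<lambda>w. lpp (wt w) a b) \<in> borel_measurable env"
  using measurable_lpp_wt[of 0 0 a b] by simp

lemma env_exp_reindex:
  fixes f :: "(nat \<times> nat \<Rightarrow> real) \<Rightarrow> real"
  assumes f: "f \<in> borel_measurable (exp_env UNIV)"
  shows "integrable env (\<lambda>w. f (\<lambda>(i, j). w (Inr (int i - int j, int j)))) \<longleftrightarrow> integrable (exp_env UNIV) f"
    "(\<integral>w. f (\<lambda>(i, j). w (Inr (int i - int j, int j))) \<partial>env) = (\<integral>w. f w \<partial>exp_env UNIV)"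
proof -
  define t :: "nat \<times> nat \<Rightarrow> int + int \<times> int" where "t = (\<lambda>(i, j). Inr (int i - int j, int j))"
  have t: "inj t" by (auto simp: t_def inj_def)
  have law: "env_law (t k) = expd 1" for k by (auto simp: t_def env_law_def split: prod.splits)
  have d: "distr env (exp_env UNIV) (\<lambda>w. \<lambda>k\<in>UNIV. w (t k)) = exp_env UNIV"
    using distr_PiM_reindex[of UNIV env_law t UNIV] t prob_env_law unfolding law env_def by simp
  have m: "(\<lambda>w. \<lambda>k\<in>UNIV. w (t k)) \<in> env \<rightarrow>\<^sub>M exp_env UNIV"
    unfolding env_def
  proof (rule measurable_restrict)
    fix k :: "nat \<times> nat"
    show "(\<lambda>w. w (t k)) \<in> Pi\<^sub>M UNIV env_law \<rightarrow>\<^sub>M expd 1"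
      using measurable_component_singleton[of "t k" UNIV env_law] by (simp add: law)
  qed
  have e: "(\<lambda>k\<in>UNIV. w (t k)) = (\<lambda>(i, j). w (Inr (int i - int j, int j)))" for w :: "int + int \<times> int \<Rightarrow> real"
    by (auto simp: t_def fun_eq_iff)
  show "integrable env (\<lambda>w. f (\<lambda>(i, j). w (Inr (int i - int j, int j)))) \<longleftrightarrow> integrable (exp_env UNIV) f"
    "(\<integral>w. f (\<lambda>(i, j). w (Inr (int i - int j, int j))) \<partial>env) = (\<integral>w. f w \<partial>exp_env UNIV)"
    using integrable_distr_eq[OF m f] integral_distr[OF m f] unfolding d by (simp_all only: e)
qed

text \<open>All rates are at least \<open>r\<close>, so the homogeneous model of rate
  \<open>r\<close> dominates.\<close>

lemma lpp_wt_mean: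
  shows "integrable env (\<lambda>w. lpp (wt w) a b)"
    and "(\<integral>w. lpp (wt w) a b \<partial>env) \<le> (2 * real a + 2 * real b + 4 + 2 * sqrt (real a + 1) + 2 * sqrt (real b + 1)) / r"
proof -
  define f where "f = (\<lambda>w :: nat \<times> nat \<Rightarrow> real. lpp (\<lambda>i j. max 0 (w (i, j))) a b)"
  have [measurable]: "f \<in> borel_measurable (exp_env UNIV)"
    unfolding f_def by (intro borel_measurable_lpp) simp
  have "AE w in exp_env UNIV. \<forall>k::nat \<times> nat. 0 \<le> w k"
    using AE_exp_env_nonneg[of "UNIV :: (nat \<times> nat) set"] by simp
  then have ae: "AE w in exp_env UNIV. f w = lpp (\<lambda>i j. w (i, j)) a b"
    by eventually_elim (simp add: f_def max_absorb2)
  have fi: "integrable (exp_env UNIV) f"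
    using integrable_hom_lpp[of "\<lambda>i j. (i, j)" a b] ae by (subst integrable_cong_AE) auto
  have fe: "(\<integral>w. f w \<partial>exp_env UNIV) = (\<integral>w. lpp (\<lambda>i j. w (i, j)) a b \<partial>exp_env UNIV)"
    by (rule integral_cong_AE[OF _ _ ae]) auto
  define g where "g w = f (\<lambda>(i, j). w (Inr (int i - int j, int j)))" for w :: "int + int \<times> int \<Rightarrow> real"
  have g: "integrable env g" "(\<integral>w. g w \<partial>env) = (\<integral>w. f w \<partial>exp_env UNIV)"
    unfolding g_def using env_exp_reindex[of f] fi by auto
  have le: "lpp (wt w) a b \<le> (1 / r) * g w" for w
  proof -
    have "lpp (wt w) a b \<le> lpp (\<lambda>i j. (1 / r) * max 0 (w (Inr (int i - int j, int j)))) a b"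
      using r_pos by (intro lpp_mono_weights) (auto simp: wt_def intro!: divide_left_mono mult_pos_pos simp: less_max_iff_disj)
    also have "\<dots> = (1 / r) * g w"
      using r_pos by (subst lpp_scale) (auto simp: g_def f_def)
    finally show ?thesis .
  qed
  show int: "integrable env (\<lambda>w. lpp (wt w) a b)"
  proof (rule Bochner_Integration.integrable_bound)
    show "integrable env (\<lambda>w. (1 / r) * g w)" using g by auto
    show "AE w in env. norm (lpp (wt w) a b) \<le> norm ((1 / r) * g w)"
    proof (rule AE_I2)
      fix w
      show "norm (lpp (wt w) a b) \<le> norm ((1 / r) * g w)"
        using le[of w] lpp_nonneg[of "wt w" a b, OF wt_nonneg] unfolding real_norm_def by linarith
    qed
  qed simp
  have "(\<integral>w. lpp (wt w) a b \<partial>env) \<le> (\<integral>w. (1 / r) * g w \<partial>env)"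
    using le g int by (intro integral_mono) auto
  also have "\<dots> = (\<integral>w. lpp (\<lambda>i j. w (i, j)) a b \<partial>exp_env UNIV) / r"
    using g fe by simp
  also have "\<dots> \<le> (2 * real a + 2 * real b + 4 + 2 * sqrt (real a + 1) + 2 * sqrt (real b + 1)) / r"
    using r_pos by (intro divide_right_mono hom_lpp_mean_upper) auto
  finally show "(\<integral>w. lpp (wt w) a b \<partial>env) \<le> (2 * real a + 2 * real b + 4 + 2 * sqrt (real a + 1) + 2 * sqrt (real b + 1)) / r" .
qed

section \<open>Limits along lattice directions off the diagonal\<close>

text \<open>A block spans m (c + d) columns, while the starting columns of blocks k and k' are m |c
  - d| (k' - k) apart. As |c - d| >= 1, an index gap of c + d + 1 separates them strictly.\<close>

lemma cols_disjoint:
  assumes cd: "c \<noteq> d" and k: "k + (c + d + 1) \<le> k'" and m: "1 \<le> m"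
  shows "cols c d (k * m) m \<inter> cols c d (k' * m) m = {}"
proof -
  define x where "x = int c - int d"
  have "int m * (int c + int d) < int m * ((int k' - int k) * \<bar>x\<bar>)"
  proof (intro mult_strict_left_mono)
    have "int (k + (c + d + 1)) \<le> int k'" using k by (simp only: of_nat_le_iff)
    then have "int c + int d < (int k' - int k) * 1" by simp
    also have "\<dots> \<le> (int k' - int k) * \<bar>x\<bar>" using k cd by (intro mult_left_mono) (auto simp: x_def)
    finally show "int c + int d < (int k' - int k) * \<bar>x\<bar>" .
  qed (use m in auto)
  moreover have "(int k' * int m) * x - (int k * int m) * x = int m * ((int k' - int k) * x)"
    by (simp add: algebra_simps)
  moreover have "\<bar>int m * ((int k' - int k) * x)\<bar> = int m * ((int k' - int k) * \<bar>x\<bar>)"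
    using k by (simp add: abs_mult)
  moreover have "int m * (int c + int d) = int m * int c + int m * int d" by (simp add: distrib_left)
  ultimately have *: "int m * int c + int m * int d < \<bar>(int k' * int m) * x - (int k * int m) * x\<bar>"
    by simp
  show ?thesis
    unfolding cols_def x_def[symmetric] using * by auto
qed

text \<open>Consecutive blocks share columns and are dependent. Split by index modulo
  \<open>D\<close>, each class uses disjoint columns and is independent; the cut at \<open>K\<close>
  makes Hoeffding applicable. Superadditivity puts the sum of all classes below the passage
  time.\<close>

lemma block_lower:
  assumes cd: "c \<noteq> d" and m: "1 \<le> m" and K: "0 < K" and e: "0 < e"
  defines "\<mu> \<equiv> (\<integral>w. min K (block c d 0 m w) \<partial>env)"
  shows "AE w in env. ereal ((\<mu> - e) / real m) \<le> liminf (\<lambda>n. ereal (lpp (wt w) (n * c) (n * d) / n))"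
proof -
  define D where "D = c + d + 1"
  define f where "f k w = min K (block c d (k * m) m w)" for k w
  have f0: "0 \<le> f k w \<and> f k w \<le> K" for k w using K block_nonneg by (simp add: f_def)
  have fm [measurable]: "f k \<in> borel_measurable env" for k
    unfolding f_def block_def by measurable
  have fmean: "(\<integral>w. f k w \<partial>env) = \<mu>" for k
  proof -
    note T = funpow_measure_preserving[OF shift_measure_preserving, of "k * m" c d]
    have "(\<integral>w. f 0 ((shift c d ^^ (k * m)) w) \<partial>env) = (\<integral>w. f 0 w \<partial>env)"
      using integral_distr[OF T(1), of "f 0"] T(2) by simp
    then show ?thesis by (simp add: f_def \<mu>_def block_eq)
  qed
  have "AE w in env. \<forall>\<^sub>F n in sequentially. real n * (\<mu> - e) \<le> (\<Sum>l<n. f (s + D * l) w)" for s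
  proof (rule bounded_indep_lower[OF prob_env _ f0 K fmean e])
    let ?A = "\<lambda>l. Inl ` cols c d ((s + D * l) * m) m \<union> Inr ` (cols c d ((s + D * l) * m) m \<times> (UNIV :: int set))"
    have disj: "cols c d ((s + D * l) * m) m \<inter> cols c d ((s + D * l') * m) m = {}" if "l < l'" for l l'
    proof (rule cols_disjoint[OF cd _ m])
      have "D * Suc l \<le> D * l'" using that by (intro mult_left_mono) auto
      then show "s + D * l + (c + d + 1) \<le> s + D * l'" by (simp add: D_def)
    qed
    have "disjoint_family ?A"
      unfolding disjoint_family_on_def
    proof (intro ballI impI)
      fix l l' :: nat assume "l \<noteq> l'"
      then have "cols c d ((s + D * l) * m) m \<inter> cols c d ((s + D * l') * m) m = {}"
        using disj[of l l'] disj[of l' l] by (cases "l < l'") auto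
      then show "?A l \<inter> ?A l' = {}" by blast
    qed
    then show "env.indep_vars (\<lambda>_. borel) (\<lambda>l. f (s + D * l)) UNIV"
      unfolding env_def
    proof (rule indep_vars_blocks[OF prob_env_law])
      fix l w
      show "f (s + D * l) \<in> borel_measurable (PiM (?A l) env_law)"
        unfolding f_def by (intro borel_measurable_min borel_measurable_const measurable_block)
      show "f (s + D * l) (restrict w (?A l)) = f (s + D * l) w"
        unfolding f_def block_restrict ..
    qed
  qed
  then have "AE w in env. \<forall>s. \<forall>\<^sub>F n in sequentially. real n * (\<mu> - e) \<le> (\<Sum>l<n. f (s + D * l) w)"
    by (simp add: AE_all_countable)
  then show ?thesis
  proof eventually_elim
    case (elim w)
    define S where "S n = lpp (wt w) (n * c) (n * d)" for n
    have S0: "0 \<le> S n" for n unfolding S_def by (intro lpp_nonneg wt_nonneg)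
    have Sm: "S n \<le> S n'" if "n \<le> n'" for n n'
      unfolding S_def using that by (intro lpp_mono wt_nonneg mult_right_mono) auto
    have chain: "(\<Sum>k<n. f k w) \<le> S (n * m)" for n
    proof (induction n)
      case 0 show ?case using S0 by simp
    next
      case (Suc n)
      have "f n w \<le> lpp (\<lambda>i j. wt w (n * m * c + i) (n * m * d + j)) (m * c) (m * d)"
        by (simp add: f_def block_def)
      then show ?case
        using Suc lpp_superadd[of "wt w" "n * m * c" "n * m * d" "m * c" "m * d"]
        by (simp add: S_def algebra_simps)
    qed
    have "\<forall>\<^sub>F n in sequentially. \<forall>s\<in>{..<D}. real n * (\<mu> - e) \<le> (\<Sum>l<n. f (s + D * l) w)"
      using elim by (intro eventually_ball_finite) auto
    then have "\<forall>\<^sub>F n in sequentially. real D * real n * (\<mu> - e) \<le> S (D * n * m)"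
    proof eventually_elim
      case (elim n)
      have "real D * real n * (\<mu> - e) = (\<Sum>s<D. real n * (\<mu> - e))" by simp
      also have "\<dots> \<le> (\<Sum>s<D. \<Sum>l<n. f (s + D * l) w)" using elim by (intro sum_mono) auto
      also have "\<dots> = (\<Sum>l<n. \<Sum>s<D. f (s + D * l) w)" by (rule sum.swap)
      also have "\<dots> = (\<Sum>l<n. \<Sum>k = l * D..<l * D + D. f k w)"
      proof (rule sum.cong[OF refl])
        fix l
        show "(\<Sum>s<D. f (s + D * l) w) = (\<Sum>k = l * D..<l * D + D. f k w)"
          using sum.shift_bounds_nat_ivl[of "\<lambda>k. f k w" 0 "l * D" D]
          by (simp add: atLeast0LessThan add.commute mult.commute)
      qed
      also have "\<dots> = (\<Sum>k<n * D. f k w)" by (rule sum.nat_group)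
      also have "\<dots> \<le> S (D * n * m)" using chain[of "n * D"] by (simp add: mult.commute)
      finally show ?case .
    qed
    then obtain n0 where n0: "\<And>n. n0 \<le> n \<Longrightarrow> real D * real n * (\<mu> - e) \<le> S (D * n * m)"
      by (auto simp: eventually_sequentially)
    have D0: "0 < D * m" using m by (simp add: D_def)
    \<comment> \<open>The positive part allows rounding n up to the next multiple of D m; negative
      values are harmless since passage times are nonnegative.\<close>
    define u where "u = max 0 (\<mu> - e)"
    have ev: "\<forall>\<^sub>F n in sequentially. u / m - (D * u) * (1 / n) \<le> S n / n"
      using eventually_ge_at_top[of "n0 * (D * m) + 1"]
    proof eventually_elim
      case (elim n)
      define q where "q = n div (D * m)"
      have q: "n0 \<le> q" using elim D0 by (simp add: q_def less_eq_div_iff_mult_less_eq)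
      have "n < (q + 1) * (D * m)" using D0 unfolding q_def by (metis Suc_eq_plus1 div_less_iff_less_mult lessI)
      then have "real n < real ((q + 1) * (D * m))" by (rule of_nat_less_iff[THEN iffD2])
      then have "real n \<le> (real q + 1) * (real D * real m)" by (simp add: distrib_right)
      then have "u * (n / m) \<le> u * (real D * (real q + 1))"
        using m by (intro mult_left_mono) (auto simp: u_def field_simps)
      then have "u * (n / m) - D * u \<le> real D * real q * u" by (simp add: algebra_simps)
      also have "\<dots> \<le> S (D * q * m)"
        using n0[OF q] S0[of "D * q * m"] by (auto simp: u_def max_def)
      also have "\<dots> \<le> S n"
      proof (rule Sm)
        have "q * (D * m) \<le> n" by (simp add: q_def)
        then show "D * q * m \<le> n" by (simp add: ac_simps)
      qed
      finally have "u * (n / m) - D * u \<le> S n" .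
      then have "(u * (n / m) - D * u) / n \<le> S n / n" by (intro divide_right_mono) auto
      moreover have "(u * (n / m) - D * u) / n = u / m - (D * u) * (1 / n)"
        using elim by (simp add: diff_divide_distrib)
      ultimately show ?case by simp
    qed
    have "(\<lambda>n. u / m - (D * u) * (1 / n)) \<longlonglongrightarrow> u / m - (D * u) * 0"
      by (intro tendsto_intros lim_1_over_n)
    then have "liminf (\<lambda>n. ereal (u / m - (D * u) * (1 / n))) = ereal (u / m)"
      by (intro lim_imp_Liminf) (auto simp del: times_divide_eq_right)
    moreover have "liminf (\<lambda>n. ereal (u / m - (D * u) * (1 / n))) \<le> liminf (\<lambda>n. ereal (S n / n))"
      using ev by (intro Liminf_mono) (auto elim: eventually_mono)
    moreover have "(\<mu> - e) / m \<le> u / m" by (intro divide_right_mono) (auto simp: u_def)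
    ultimately show ?case unfolding S_def by (metis ereal_less_eq(3) order_trans)
  qed
qed

text \<open>The limit \<open>g\<close> is the supremum of the normalised means. Means never exceed g
  n, and \<open>block_lower\<close> reaches every value below \<open>g\<close> through a
  near-optimal block length, a high truncation and a small error.\<close>

lemma lattice_direction_limit:
  assumes cd: "c \<noteq> d"
  obtains g where "0 \<le> g" "g \<le> 12 * real (c + d) / r" "AE w in env. (\<lambda>n. lpp (wt w) (n * c) (n * d) / n) \<longlonglongrightarrow> g"
proof -
  define S where "S n w = lpp (wt w) (n * c) (n * d)" for n w
  have S0: "0 \<le> S n w" for n w unfolding S_def by (intro lpp_nonneg wt_nonneg)
  have int: "integrable env (S n)" for n unfolding S_def by (rule lpp_wt_mean)
  \<comment> \<open>With s = n (c + d) and sqrt (x + 1) <= x + 1, the bound on the mean is at most 4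
    s + 8, hence at most 12 s once s >= 1.\<close>
  define C where "C = 12 * real (c + d) / r"
  have C0: "0 \<le> C" using r_pos by (simp add: C_def)
  have bound: "(\<integral>w. S n w \<partial>env) \<le> C * n" for n
  proof (cases "n = 0")
    case False
    have s: "sqrt (real x + 1) \<le> real x + 1" for x :: nat
      by (rule real_le_lsqrt) (auto simp: power2_eq_square algebra_simps)
    have "1 * 1 \<le> real n * (real c + real d)" using False cd by (intro mult_mono) auto
    then have "2 * real (n * c) + 2 * real (n * d) + 4 + 2 * sqrt (real (n * c) + 1) + 2 * sqrt (real (n * d) + 1) \<le> 12 * (real n * (real c + real d))"
      using s[of "n * c"] s[of "n * d"] by (simp add: algebra_simps)
    then have "(2 * real (n * c) + 2 * real (n * d) + 4 + 2 * sqrt (real (n * c) + 1) + 2 * sqrt (real (n * d) + 1)) / r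
      \<le> 12 * (real n * (real c + real d)) / r"
      using r_pos by (intro divide_right_mono) auto
    also have "\<dots> = C * n" by (simp add: C_def)
    finally show ?thesis unfolding S_def using lpp_wt_mean(2)[of "n * c" "n * d"] by linarith
  qed (simp add: S_def)
  define g where "g = (SUP n\<in>{1..}. (\<integral>w. S n w \<partial>env) / real n)"
  have bdd: "bdd_above ((\<lambda>n. (\<integral>w. S n w \<partial>env) / real n) ` {1..})"
    using bound by (intro bdd_aboveI[of _ C]) (auto simp: field_simps)
  have mean: "(\<integral>w. S n w \<partial>env) \<le> g * n" for n
  proof (cases "n = 0")
    case False
    then have "(\<integral>w. S n w \<partial>env) / real n \<le> g" unfolding g_def using bdd by (intro cSUP_upper) auto
    then show ?thesis using False by (simp add: field_simps)
  qed (simp add: S_def)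
  have gC: "g \<le> C" unfolding g_def using bound by (intro cSUP_least) (auto simp: field_simps)
  have "0 \<le> (\<integral>w. S 1 w \<partial>env)" using S0 by (intro integral_nonneg_AE) auto
  then have g0: "0 \<le> g" using mean[of 1] by simp
  have trunc: "(\<lambda>K. \<integral>w. min (real K) (S m w) \<partial>env) \<longlonglongrightarrow> (\<integral>w. S m w \<partial>env)" for m
  proof (rule integral_dominated_convergence[where w = "S m"])
    show "AE w in env. (\<lambda>K. min (real K) (S m w)) \<longlonglongrightarrow> S m w"
    proof (rule AE_I2)
      fix w
      have "\<forall>\<^sub>F K in sequentially. S m w \<le> real K"
        using filterlim_real_sequentially by (simp add: filterlim_at_top)
      then have "\<forall>\<^sub>F K in sequentially. min (real K) (S m w) = S m w" by eventually_elim simp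
      then show "(\<lambda>K. min (real K) (S m w)) \<longlonglongrightarrow> S m w" by (rule tendsto_eventually)
    qed
  qed (use int S0 in \<open>auto intro!: AE_I2 simp: min_def\<close>)
  \<comment> \<open>Truncation level, block length and error all run through naturals, so that
    countably many null sets are discarded.\<close>
  have "AE w in env. ereal (((\<integral>w. min (real (Suc K)) (S (Suc m) w) \<partial>env) - 1 / real (Suc j)) / real (Suc m)) \<le> liminf (\<lambda>n. ereal (S n w / n))" for K m j
    using block_lower[OF cd, of "Suc m" "real (Suc K)" "1 / real (Suc j)"] by (simp add: S_def block_def)
  then have "AE w in env. \<forall>K m j. ereal (((\<integral>w. min (real (Suc K)) (S (Suc m) w) \<partial>env) - 1 / real (Suc j)) / real (Suc m)) \<le> liminf (\<lambda>n. ereal (S n w / n))"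
    by (simp add: AE_all_countable)
  then have lower: "AE w in env. ereal g \<le> liminf (\<lambda>n. ereal (S n w / n))"
  proof eventually_elim
    case (elim w)
    show ?case
    proof (rule ccontr)
      assume "\<not> ?case"
      then have "liminf (\<lambda>n. ereal (S n w / n)) < ereal g" by simp
      moreover have "0 \<le> liminf (\<lambda>n. ereal (S n w / n))"
        using S0 by (intro Liminf_bounded) auto
      ultimately obtain t where t: "liminf (\<lambda>n. ereal (S n w / n)) = ereal t" "t < g"
        by (cases "liminf (\<lambda>n. ereal (S n w / n))") auto
      obtain n where n: "n \<ge> 1" "t < (\<integral>w. S n w \<partial>env) / n"
        using less_cSUP_iff[OF _ bdd, of t] t(2) unfolding g_def by auto
      then obtain m where m: "n = Suc m" by (metis One_nat_def Suc_le_D)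
      define x where "x = (\<integral>w. S n w \<partial>env)"
      have "t * n < x" using n by (simp add: x_def field_simps)
      then have e: "0 < (x - t * n) / 2" by simp
      have "\<forall>\<^sub>F K in sequentially. x - (x - t * n) / 2 < (\<integral>w. min (real K) (S n w) \<partial>env)"
        using trunc[of n] e unfolding x_def by (intro order_tendstoD(1)) auto
      then obtain K0 where K0: "\<And>K. K \<ge> K0 \<Longrightarrow> x - (x - t * n) / 2 < (\<integral>w. min (real K) (S n w) \<partial>env)"
        by (auto simp: eventually_sequentially)
      obtain j where j: "1 / real (Suc j) < (x - t * n) / 2"
        using reals_Archimedean[OF e] by (auto simp: inverse_eq_divide)
      have "b < v - u" if "a - (a - b) / 2 < v" "u < (a - b) / 2" for a b u v :: real
        using that by (simp add: field_simps)
      from this[OF K0[OF le_SucI[OF order.refl]] j]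
      have "t * n < (\<integral>w. min (real (Suc K0)) (S n w) \<partial>env) - 1 / real (Suc j)" .
      moreover have "0 < real n" using n(1) by simp
      ultimately have "t < ((\<integral>w. min (real (Suc K0)) (S n w) \<partial>env) - 1 / real (Suc j)) / n"
        by (simp only: pos_less_divide_eq)
      then show False using elim[rule_format, of K0 m j] t(1) m by simp
    qed
  qed
  have "AE w in env. (\<lambda>n. S n w / n) \<longlonglongrightarrow> g"
  proof (rule superadditive_ergodic[OF prob_env shift_measure_preserving[of c d] S0 _ int mean lower])
    fix m n w
    show "S m w + S n ((shift c d ^^ m) w) \<le> S (m + n) w"
      using lpp_superadd[of "wt w" "m * c" "m * d" "n * c" "n * d"]
      by (simp add: S_def wt_shift_funpow[abs_def] add_mult_distrib)
  qed
  then show ?thesis using that g0 gC unfolding S_def C_def by blast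
qed

section \<open>From the joint environment to statements for fixed disorder\<close>

text \<open>Stationarity was used on the joint space, but the definition of the time constant fixes
  the disorder first; this identification of product measures, checked on cylinders, links the
  two.\<close>

lemma distr_env_pair:
  "(\<lambda>(\<alpha>, X). case_sum \<alpha> X) \<in> PiM UNIV (\<lambda>_. L) \<Otimes>\<^sub>M exp_env UNIV \<rightarrow>\<^sub>M env"
  "distr (PiM UNIV (\<lambda>_. L) \<Otimes>\<^sub>M exp_env UNIV) env (\<lambda>(\<alpha>, X). case_sum \<alpha> X) = env"
proof -
  let ?A = "PiM UNIV (\<lambda>_::int. L)" and ?X = "exp_env (UNIV :: (int \<times> int) set)"
  interpret A: prob_space ?A by (intro prob_space_PiM prob_L)
  interpret X: prob_space ?X by (rule prob_space_exp_env)
  interpret pair_prob_space ?A ?X by standard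
  interpret E: product_prob_space env_law UNIV
    by (intro product_prob_spaceI prob_env_law)
  show m: "(\<lambda>(\<alpha>, X). case_sum \<alpha> X) \<in> ?A \<Otimes>\<^sub>M ?X \<rightarrow>\<^sub>M env"
    unfolding env_def
  proof (rule measurable_PiM_single')
    fix k :: "int + int \<times> int"
    have "(\<lambda>z. fst z i) \<in> ?A \<Otimes>\<^sub>M ?X \<rightarrow>\<^sub>M L" for i
      by (rule measurable_compose[OF measurable_fst measurable_component_singleton]) simp
    moreover have "(\<lambda>z. snd z i) \<in> ?A \<Otimes>\<^sub>M ?X \<rightarrow>\<^sub>M expd 1" for i
      by (rule measurable_compose[OF measurable_snd measurable_component_singleton]) simp
    ultimately show "(\<lambda>z. (case z of (\<alpha>, X) \<Rightarrow> case_sum \<alpha> X) k) \<in> ?A \<Otimes>\<^sub>M ?X \<rightarrow>\<^sub>M env_law k"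
      by (cases k) (simp_all add: env_law_def case_prod_beta')
  qed (auto simp: space_PiM env_law_def space_pair_measure PiE_iff split: sum.splits)
  show "distr (?A \<Otimes>\<^sub>M ?X) env (\<lambda>(\<alpha>, X). case_sum \<alpha> X) = env"
    unfolding env_def
  proof (rule E.PiM_eq)
    fix J :: "(int + int \<times> int) set" and F
    assume J: "finite J" "J \<subseteq> UNIV" and F: "\<And>j. j \<in> J \<Longrightarrow> F j \<in> sets (env_law j)"
    define J1 where "J1 = Inl -` J"
    define J2 where "J2 = Inr -` J"
    have J12: "finite J1" "finite J2" "J = Inl ` J1 \<union> Inr ` J2"
    proof -
      show "finite J1" "finite J2" using J by (auto simp: J1_def J2_def finite_vimageI)
      show "J = Inl ` J1 \<union> Inr ` J2"
      proof (rule set_eqI)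
        fix k show "k \<in> J \<longleftrightarrow> k \<in> Inl ` J1 \<union> Inr ` J2"
          by (cases k) (auto simp: J1_def J2_def)
      qed
    qed
    have F1: "F (Inl i) \<in> sets L" if "i \<in> J1" for i using F[of "Inl i"] that by (simp add: J1_def env_law_def)
    have F2: "F (Inr i) \<in> sets (expd 1)" if "i \<in> J2" for i using F[of "Inr i"] that by (simp add: J2_def env_law_def)
    let ?E1 = "prod_emb UNIV (\<lambda>_. L) J1 (\<Pi>\<^sub>E i\<in>J1. F (Inl i))" and ?E2 = "prod_emb UNIV (\<lambda>_. expd 1) J2 (\<Pi>\<^sub>E i\<in>J2. F (Inr i))"
    have sE: "?E1 \<in> sets ?A" "?E2 \<in> sets ?X" using F1 F2 J12 by (auto intro!: sets_PiM_I)
    have pre: "(\<lambda>(\<alpha>, X). case_sum \<alpha> X) -` prod_emb UNIV env_law J (\<Pi>\<^sub>E j\<in>J. F j) \<inter> space (?A \<Otimes>\<^sub>M ?X) = ?E1 \<times> ?E2"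
    proof (rule set_eqI)
      fix z :: "(int \<Rightarrow> real) \<times> (int \<times> int \<Rightarrow> real)"
      obtain \<alpha> X where z: "z = (\<alpha>, X)" by fastforce
      have e0: "case_sum \<alpha> X \<in> prod_emb UNIV env_law J (\<Pi>\<^sub>E j\<in>J. F j) \<longleftrightarrow> (\<forall>j\<in>J. case_sum \<alpha> X j \<in> F j)"
        if "case_sum \<alpha> X \<in> space (PiM UNIV env_law)"
        using that by (simp add: prod_emb_iff space_PiM PiE_iff)
      have e1: "\<alpha> \<in> ?E1 \<longleftrightarrow> \<alpha> \<in> space ?A \<and> (\<forall>i\<in>J1. \<alpha> i \<in> F (Inl i))"
        by (auto simp: prod_emb_iff space_PiM PiE_iff)
      have e2: "X \<in> ?E2 \<longleftrightarrow> X \<in> space ?X \<and> (\<forall>i\<in>J2. X i \<in> F (Inr i))"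
        by (auto simp: prod_emb_iff space_PiM PiE_iff)
      have e3: "(\<forall>j\<in>J. case_sum \<alpha> X j \<in> F j) \<longleftrightarrow> (\<forall>i\<in>J1. \<alpha> i \<in> F (Inl i)) \<and> (\<forall>i\<in>J2. X i \<in> F (Inr i))"
        by (subst J12(3)) (simp add: ball_Un)
      have "z \<in> space (?A \<Otimes>\<^sub>M ?X) \<Longrightarrow> case_sum \<alpha> X \<in> space (PiM UNIV env_law)"
        using measurable_space[OF m, of z] by (simp add: z env_def)
      then show "z \<in> (\<lambda>(\<alpha>, X). case_sum \<alpha> X) -` prod_emb UNIV env_law J (\<Pi>\<^sub>E j\<in>J. F j) \<inter> space (?A \<Otimes>\<^sub>M ?X) \<longleftrightarrow> z \<in> ?E1 \<times> ?E2"
        using e0 e1 e2 e3 by (simp only: z Int_iff vimage_eq case_prod_conv mem_Times_iff fst_conv snd_conv space_pair_measure) blast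
    qed
    have "emeasure (distr (?A \<Otimes>\<^sub>M ?X) (PiM UNIV env_law) (\<lambda>(\<alpha>, X). case_sum \<alpha> X)) (prod_emb UNIV env_law J (\<Pi>\<^sub>E j\<in>J. F j))
      = emeasure (?A \<Otimes>\<^sub>M ?X) (?E1 \<times> ?E2)"
      using F J m unfolding pre[symmetric] env_def by (intro emeasure_distr sets_PiM_I) auto
    also have "\<dots> = emeasure ?A ?E1 * emeasure ?X ?E2"
      using sE by (rule X.emeasure_pair_measure_Times)
    also have "\<dots> = (\<Prod>i\<in>J1. emeasure L (F (Inl i))) * (\<Prod>i\<in>J2. emeasure (expd 1) (F (Inr i)))"
      using F1 F2 J12 by (simp add: emeasure_PiM_emb prob_L prob_space_exp1)
    also have "\<dots> = (\<Prod>j\<in>J. emeasure (env_law j) (F j))"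
      unfolding J12(3) using J12(1,2)
      by (subst prod.union_disjoint) (auto simp: prod.reindex env_law_def)
    finally show "emeasure (distr (?A \<Otimes>\<^sub>M ?X) (PiM UNIV env_law) (\<lambda>(\<alpha>, X). case_sum \<alpha> X)) (prod_emb UNIV env_law J (\<Pi>\<^sub>E j\<in>J. F j))
      = (\<Prod>j\<in>J. emeasure (env_law j) (F j))" .
  qed simp
qed

lemma AE_env_nested:
  assumes "AE w in env. Q w"
  shows "AE \<alpha> in disorder L. AE X in exp_env UNIV. Q (case_sum \<alpha> X)"
proof -
  let ?A = "PiM UNIV (\<lambda>_::int. L)" and ?X = "exp_env (UNIV :: (int \<times> int) set)"
  interpret A: prob_space ?A by (intro prob_space_PiM prob_L)
  interpret X: prob_space ?X by (rule prob_space_exp_env)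
  interpret pair_prob_space ?A ?X by standard
  have "AE z in ?A \<Otimes>\<^sub>M ?X. Q (case z of (\<alpha>, X) \<Rightarrow> case_sum \<alpha> X)"
    by (rule AE_distrD[OF distr_env_pair(1)], subst distr_env_pair(2), rule assms)
  then have "AE \<alpha> in ?A. AE X in ?X. Q (case (\<alpha>, X) of (\<alpha>, X) \<Rightarrow> case_sum \<alpha> X)"
    by (rule AE_pair)
  then show ?thesis unfolding disorder_def case_prod_conv .
qed

text \<open>The weights in the coordinates \<open>(a, b) = (i + j, j)\<close>, with \<open>Y(i, j) = X(i, j) / \<alpha>(i)\<close>.\<close>

definition pw :: "(int \<Rightarrow> real) \<Rightarrow> (int \<times> int \<Rightarrow> real) \<Rightarrow> nat \<Rightarrow> nat \<Rightarrow> real" where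
  "pw \<alpha> X a b = X (int a - int b, int b) / \<alpha> (int a - int b)"

definition good :: "(nat \<Rightarrow> nat \<Rightarrow> real) \<Rightarrow> (int \<Rightarrow> real) \<Rightarrow> (int \<times> int \<Rightarrow> real) \<Rightarrow> bool" where
  "good g \<alpha> X \<longleftrightarrow> (\<forall>i. r \<le> \<alpha> i) \<and> (\<forall>k. 0 \<le> X k) \<and>
     (\<forall>c d. c \<noteq> d \<longrightarrow> (\<lambda>n. lpp (pw \<alpha> X) (n * c) (n * d) / n) \<longlonglongrightarrow> g c d)"

lemma AE_good:
  obtains g where "\<And>c d. c \<noteq> d \<Longrightarrow> 0 \<le> g c d \<and> g c d \<le> 12 * real (c + d) / r"
    "AE w in env. good g (\<lambda>i. w (Inl i)) (\<lambda>k. w (Inr k))"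
    "AE \<alpha> in disorder L. AE X in exp_env UNIV. good g \<alpha> X"
proof -
  define P where "P c d g \<longleftrightarrow> 0 \<le> g \<and> g \<le> 12 * real (c + d) / r \<and>
    (AE w in env. (\<lambda>n. lpp (wt w) (n * c) (n * d) / n) \<longlonglongrightarrow> g)" for c d :: nat and g
  define G where "G c d = (SOME g. P c d g)" for c d
  have "P c d (G c d)" if cd: "c \<noteq> d" for c d
  proof -
    obtain g where "P c d g" using lattice_direction_limit[OF cd] unfolding P_def by blast
    then show ?thesis unfolding G_def by (rule someI)
  qed
  then have G: "0 \<le> G c d" "G c d \<le> 12 * real (c + d) / r"
    "AE w in env. (\<lambda>n. lpp (wt w) (n * c) (n * d) / n) \<longlonglongrightarrow> G c d" if "c \<noteq> d" for c d
    using that by (simp_all add: P_def)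
  have "AE w in env. c \<noteq> d \<longrightarrow> (\<lambda>n. lpp (wt w) (n * c) (n * d) / n) \<longlonglongrightarrow> G c d" for c d
    by (cases "c = d") (simp_all add: G(3))
  then have lim: "AE w in env. \<forall>c d. c \<noteq> d \<longrightarrow> (\<lambda>n. lpp (wt w) (n * c) (n * d) / n) \<longlonglongrightarrow> G c d"
    by (simp add: AE_all_countable)
  have "AE x in env_law (Inl i). r \<le> x" for i
    unfolding env_law_def sum.case by (rule L_ge)
  then have "AE w in env. r \<le> w (Inl i)" for i
    unfolding env_def by (rule AE_PiM_component[OF prob_env_law UNIV_I])
  then have al: "AE w in env. \<forall>i. r \<le> w (Inl i)" by (simp add: AE_all_countable)
  have "AE x in env_law (Inr k). 0 \<le> x" for k
    unfolding env_law_def sum.case by (rule exp1_AE_nonneg)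
  then have "AE w in env. 0 \<le> w (Inr k)" for k
    unfolding env_def by (rule AE_PiM_component[OF prob_env_law UNIV_I])
  then have "AE w in env. \<forall>k. 0 \<le> w (Inr k)" by (subst AE_all_countable) simp
  with lim al have gd: "AE w in env. good G (\<lambda>i. w (Inl i)) (\<lambda>k. w (Inr k))"
  proof eventually_elim
    case (elim w)
    have "wt w = pw (\<lambda>i. w (Inl i)) (\<lambda>k. w (Inr k))"
      using elim by (intro ext) (simp add: wt_def pw_def max_absorb2)
    then show ?case using elim by (simp add: good_def)
  qed
  from AE_env_nested[OF gd] have "AE \<alpha> in disorder L. AE X in exp_env UNIV. good G \<alpha> X"
    by simp
  then show ?thesis using that[of G] G gd by blast
qed

end

subsection \<open>From lattice directions to all directions\<close>

text \<open>What survives of the randomness: for a fixed realisation only monotonicity and the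
  limits along off-diagonal rays matter. A limit derived from these alone depends on
  \<open>g\<close> and is therefore deterministic.\<close>

definition has_rates :: "(nat \<Rightarrow> nat \<Rightarrow> real) \<Rightarrow> (nat \<Rightarrow> nat \<Rightarrow> real) \<Rightarrow> bool" where
  "has_rates U g \<longleftrightarrow> (\<forall>a a' b b'. a \<le> a' \<longrightarrow> b \<le> b' \<longrightarrow> U a b \<le> U a' b') \<and>
     (\<forall>c d. c \<noteq> d \<longrightarrow> (\<lambda>n. U (n * c) (n * d) / n) \<longlonglongrightarrow> g c d)"

lemma nat_ceiling_asymp:
  assumes "0 < x"
  shows "(\<lambda>n. real (nat \<lceil>x * real n\<rceil>) / n) \<longlonglongrightarrow> x" "filterlim (\<lambda>n. nat \<lceil>x * real n\<rceil>) at_top sequentially"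
proof -
  have b: "x * real n \<le> real (nat \<lceil>x * real n\<rceil>)" "real (nat \<lceil>x * real n\<rceil>) \<le> x * real n + 1" for n
  proof -
    have "0 \<le> x * real n" using assms by simp
    then show "x * real n \<le> real (nat \<lceil>x * real n\<rceil>)" "real (nat \<lceil>x * real n\<rceil>) \<le> x * real n + 1" by linarith+
  qed
  show "(\<lambda>n. real (nat \<lceil>x * real n\<rceil>) / n) \<longlonglongrightarrow> x"
  proof (rule tendsto_sandwich)
    show "\<forall>\<^sub>F n in sequentially. x \<le> real (nat \<lceil>x * real n\<rceil>) / n"
      using eventually_gt_at_top[of "0::nat"] by eventually_elim (use b in \<open>simp add: field_simps\<close>)
    show "\<forall>\<^sub>F n in sequentially. real (nat \<lceil>x * real n\<rceil>) / n \<le> x + 1 / n"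
      using eventually_gt_at_top[of "0::nat"] by eventually_elim (use b in \<open>simp add: field_simps\<close>)
    show "(\<lambda>n. x + 1 / real n) \<longlonglongrightarrow> x" using tendsto_add[OF tendsto_const lim_1_over_n, of x] by simp
  qed simp
  show "filterlim (\<lambda>n. nat \<lceil>x * real n\<rceil>) at_top sequentially"
    unfolding filterlim_at_top
  proof
    fix Z :: nat
    show "\<forall>\<^sub>F n in sequentially. Z \<le> nat \<lceil>x * real n\<rceil>"
      using eventually_ge_at_top[of "nat \<lceil>real Z / x\<rceil>"]
    proof eventually_elim
      case (elim n)
      have "real Z / x \<le> real n" using elim by linarith
      then have "real Z \<le> x * real n" using assms by (simp add: field_simps)
      then show ?case using b(1)[of n] by linarith
    qed
  qed
qed

lemma nat_floor_asymp:
  assumes "0 < x"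
  shows "(\<lambda>n. real (nat \<lfloor>x * real n\<rfloor>) / n) \<longlonglongrightarrow> x" "filterlim (\<lambda>n. nat \<lfloor>x * real n\<rfloor>) at_top sequentially"
proof -
  have b: "x * real n - 1 \<le> real (nat \<lfloor>x * real n\<rfloor>)" "real (nat \<lfloor>x * real n\<rfloor>) \<le> x * real n" for n
  proof -
    have "0 \<le> x * real n" using assms by simp
    then show "x * real n - 1 \<le> real (nat \<lfloor>x * real n\<rfloor>)" "real (nat \<lfloor>x * real n\<rfloor>) \<le> x * real n" by linarith+
  qed
  show "(\<lambda>n. real (nat \<lfloor>x * real n\<rfloor>) / n) \<longlonglongrightarrow> x"
  proof (rule tendsto_sandwich)
    show "\<forall>\<^sub>F n in sequentially. x - 1 / n \<le> real (nat \<lfloor>x * real n\<rfloor>) / n"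
      using eventually_gt_at_top[of "0::nat"]
    proof eventually_elim
      case (elim n)
      have "(x * n - 1) / n \<le> real (nat \<lfloor>x * real n\<rfloor>) / n" by (rule divide_right_mono[OF b(1)]) simp
      then show ?case using elim by (simp add: diff_divide_distrib)
    qed
    show "\<forall>\<^sub>F n in sequentially. real (nat \<lfloor>x * real n\<rfloor>) / n \<le> x"
      using eventually_gt_at_top[of "0::nat"] by eventually_elim (use b in \<open>simp add: field_simps\<close>)
    show "(\<lambda>n. x - 1 / real n) \<longlonglongrightarrow> x" using tendsto_diff[OF tendsto_const lim_1_over_n, of x] by simp
  qed simp
  show "filterlim (\<lambda>n. nat \<lfloor>x * real n\<rfloor>) at_top sequentially"
    unfolding filterlim_at_top
  proof
    fix Z :: nat
    show "\<forall>\<^sub>F n in sequentially. Z \<le> nat \<lfloor>x * real n\<rfloor>"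
      using eventually_ge_at_top[of "nat \<lceil>(real Z + 1) / x\<rceil>"]
    proof eventually_elim
      case (elim n)
      have "(real Z + 1) / x \<le> real n" using elim by linarith
      then have "real Z + 1 \<le> x * real n" using assms by (simp add: field_simps)
      then show ?case using b(1)[of n] by linarith
    qed
  qed
qed

text \<open>The error is relative, as the later sandwich uses multiples of \<open>(c, d)\<close>;
  this forces d = 0 exactly when q = 0.\<close>

lemma lattice_direction_near:
  fixes p q \<delta> :: real
  assumes p: "0 < p" and q: "0 \<le> q" and \<delta>: "0 < \<delta>" "\<delta> \<le> 1 / 2"
  obtains c d N :: nat where "c \<noteq> d" "0 < N" "(1 - \<delta>) * real c < p * real N" "p * real N < (1 + \<delta>) * real c"
    "q = 0 \<Longrightarrow> d = 0" "0 < q \<Longrightarrow> (1 - \<delta>) * real d < q * real N \<and> q * real N < (1 + \<delta>) * real d"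
proof -
  define s where "s = (if q = 0 then p else min p q)"
  have s: "0 < s" "s \<le> p" "q \<noteq> 0 \<Longrightarrow> s \<le> q" using p q by (auto simp: s_def)
  \<comment> \<open>Makes \<delta> times each nonzero scaled coordinate at least 4, leaving room for
    rounding by one in either direction.\<close>
  define N where "N = Suc (nat \<lceil>4 / (\<delta> * s)\<rceil>)"
  have "4 / (\<delta> * s) \<le> real N" unfolding N_def by linarith
  then have N4: "4 \<le> \<delta> * (s * N)" using s \<delta> by (simp add: field_simps)
  have N0: "0 < N" by (simp add: N_def)
  define d where "d = nat \<lfloor>q * N\<rfloor>"
  \<comment> \<open>Rounding may land on the diagonal, as it does when p = q; moving
    \<open>c\<close> by one leaves it within the tolerance.\<close>
  define c where "c = (if nat \<lfloor>p * N\<rfloor> = d then Suc d else nat \<lfloor>p * N\<rfloor>)"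
  have near: "(1 - \<delta>) * z < t * N \<and> t * N < (1 + \<delta>) * z" if "s \<le> t" "t * N - 1 \<le> z" "z \<le> t * N + 1" for z t :: real
  proof -
    have "\<delta> * (s * N) \<le> \<delta> * (t * N)" using that(1) \<delta> by (intro mult_left_mono mult_right_mono) auto
    then have t4: "4 \<le> \<delta> * (t * N)" using N4 by linarith
    have "(1 - \<delta>) * z \<le> (1 - \<delta>) * (t * N + 1)" using that \<delta> by (intro mult_left_mono) auto
    also have "\<dots> < t * N" using t4 \<delta> by (simp add: algebra_simps)
    finally have 1: "(1 - \<delta>) * z < t * N" .
    have "t * N < (1 + \<delta>) * (t * N - 1)" using t4 \<delta> by (simp add: algebra_simps)
    also have "\<dots> \<le> (1 + \<delta>) * z" using that \<delta> by (intro mult_left_mono) auto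
    finally show ?thesis using 1 by simp
  qed
  have qN: "0 \<le> q * N" "0 \<le> p * N" using p q by auto
  have d: "q * N - 1 \<le> d" "d \<le> q * N + 1" using qN unfolding d_def by linarith+
  have fp: "p * N - 1 \<le> real (nat \<lfloor>p * N\<rfloor>)" "real (nat \<lfloor>p * N\<rfloor>) \<le> p * N" using qN by linarith+
  have "real c = real (nat \<lfloor>p * N\<rfloor>) \<or> real c = real (nat \<lfloor>p * N\<rfloor>) + 1" by (auto simp: c_def)
  then have c: "p * N - 1 \<le> c" "c \<le> p * N + 1" using fp by linarith+
  have "c \<noteq> d" by (auto simp: c_def)
  then show ?thesis
    using that[of c d N] N0 near[OF s(2) c] near[OF s(3) d] q by (auto simp: d_def)
qed

text \<open>The point \<open>(a n, b n)\<close> eventually lies between the multiples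
  \<open>j n\<close> and \<open>k n\<close> of \<open>(c, d)\<close> in both coordinates;
  monotonicity transfers the known limit along that ray up to the factors 1 - \<delta> and 1 +
  \<delta>.\<close>

lemma has_rates_sandwich:
  fixes p q \<delta> e :: real
  assumes U: "has_rates U g" and cd: "c \<noteq> d" and N: "0 < N" and \<delta>: "0 < \<delta>" "\<delta> \<le> 1 / 2"
    and p: "(1 - \<delta>) * real c < p * real N" "p * real N < (1 + \<delta>) * real c"
    and q: "q = 0 \<Longrightarrow> d = 0" "0 < q \<Longrightarrow> (1 - \<delta>) * real d < q * real N \<and> q * real N < (1 + \<delta>) * real d" "0 \<le> q"
    and a: "(\<lambda>n. real (a n) / n) \<longlonglongrightarrow> p" and b: "(\<lambda>n. real (b n) / n) \<longlonglongrightarrow> q" and b0: "q = 0 \<Longrightarrow> \<forall>n. b n = 0"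
    and e: "0 < e"
  shows "\<forall>\<^sub>F n in sequentially. (1 - \<delta>) * (g c d / N) - e \<le> U (a n) (b n) / n \<and> U (a n) (b n) / n \<le> (1 + \<delta>) * (g c d / N) + e"
proof -
  have mono: "U a b \<le> U a' b'" if "a \<le> a'" "b \<le> b'" for a a' b b' using U that by (simp add: has_rates_def)
  have lim: "(\<lambda>n. U (n * c) (n * d) / n) \<longlonglongrightarrow> g c d" using U cd by (simp add: has_rates_def)
  have along: "(\<lambda>n. U (k n * c) (k n * d) / n) \<longlonglongrightarrow> z * g c d"
    if k: "(\<lambda>n. real (k n) / n) \<longlonglongrightarrow> z" "filterlim k at_top sequentially" for k z
  proof -
    have "(\<lambda>n. (real (k n) / n) * (U (k n * c) (k n * d) / k n)) \<longlonglongrightarrow> z * g c d"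
      by (intro tendsto_mult k(1) filterlim_compose[OF lim k(2)])
    moreover have "\<forall>\<^sub>F n in sequentially. (real (k n) / n) * (U (k n * c) (k n * d) / k n) = U (k n * c) (k n * d) / n"
      using k(2)[unfolded filterlim_at_top, rule_format, of 1] by eventually_elim simp
    ultimately show ?thesis by (blast intro: Lim_transform_eventually)
  qed
  define x where "x = (1 + \<delta>) / N"
  define y where "y = (1 - \<delta>) / N"
  have xy: "0 < x" "0 < y" using \<delta> N by (auto simp: x_def y_def)
  define k where "k n = nat \<lceil>x * real n\<rceil>" for n
  define j where "j n = nat \<lfloor>y * real n\<rfloor>" for n
  have kx: "x * real n \<le> k n" for n using xy(1) unfolding k_def by linarith
  have jy: "j n \<le> y * real n" for n
  proof -
    have "0 \<le> y * real n" using xy(2) by simp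
    then show ?thesis unfolding j_def by linarith
  qed
  have up: "\<forall>\<^sub>F n in sequentially. u n \<le> k n * z"
    if u: "(\<lambda>n. real (u n) / n) \<longlonglongrightarrow> t" "t * real N < (1 + \<delta>) * real z" for u :: "nat \<Rightarrow> nat" and t z
  proof -
    have "t < x * z" using u(2) N by (simp add: x_def field_simps)
    from order_tendstoD(2)[OF u(1) this] show ?thesis
      using eventually_gt_at_top[of "0::nat"]
    proof eventually_elim
      case (elim n)
      then have "real (u n) < (x * n) * z" by (simp add: field_simps)
      also have "\<dots> \<le> real (k n) * z" using kx[of n] by (intro mult_right_mono) auto
      finally have "real (u n) < real (k n * z)" by simp
      then show ?case by (rule less_imp_le[OF of_nat_less_imp_less])
    qed
  qed
  have down: "\<forall>\<^sub>F n in sequentially. j n * z \<le> u n"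
    if u: "(\<lambda>n. real (u n) / n) \<longlonglongrightarrow> t" "(1 - \<delta>) * real z < t * real N" for u :: "nat \<Rightarrow> nat" and t z
  proof -
    have "y * z < t" using u(2) N by (simp add: y_def field_simps)
    from order_tendstoD(1)[OF u(1) this] show ?thesis
      using eventually_gt_at_top[of "0::nat"]
    proof eventually_elim
      case (elim n)
      have "real (j n) * z \<le> (y * n) * z" using jy[of n] by (intro mult_right_mono) auto
      also have "\<dots> < u n" using elim by (simp add: field_simps)
      finally have "real (j n * z) < real (u n)" by simp
      then show ?case by (rule less_imp_le[OF of_nat_less_imp_less])
    qed
  qed
  have bk: "\<forall>\<^sub>F n in sequentially. b n \<le> k n * d" and bj: "\<forall>\<^sub>F n in sequentially. j n * d \<le> b n"
    using up[OF b] down[OF b] q b0 by (cases "q = 0"; simp)+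
  have "(\<lambda>n. U (k n * c) (k n * d) / n) \<longlonglongrightarrow> x * g c d"
    using nat_ceiling_asymp[OF xy(1)] by (intro along) (auto simp: k_def[abs_def])
  then have ku: "\<forall>\<^sub>F n in sequentially. U (k n * c) (k n * d) / n < x * g c d + e"
    using e by (intro order_tendstoD(2)) auto
  have "(\<lambda>n. U (j n * c) (j n * d) / n) \<longlonglongrightarrow> y * g c d"
    using nat_floor_asymp[OF xy(2)] by (intro along) (auto simp: j_def[abs_def])
  then have jl: "\<forall>\<^sub>F n in sequentially. y * g c d - e < U (j n * c) (j n * d) / n"
    using e by (intro order_tendstoD(1)) auto
  show ?thesis
    using up[OF a p(2)] down[OF a p(1)] bk bj ku jl
  proof eventually_elim
    case (elim n)
    have "U (a n) (b n) / n \<le> U (k n * c) (k n * d) / n" using elim by (intro divide_right_mono mono) auto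
    moreover have "U (j n * c) (j n * d) / n \<le> U (a n) (b n) / n" using elim by (intro divide_right_mono mono) auto
    ultimately show ?case using elim by (simp add: x_def y_def)
  qed
qed

text \<open>The limit \<open>l\<close> is obtained before \<open>U\<close>, \<open>a\<close> and
  \<open>b\<close>, because the sandwich bounds depend on \<open>g\<close> only. This uniformity
  makes the limit the same for almost every realisation, diagonal directions included.\<close>

lemma direction_limit:
  fixes p q C :: real
  assumes p: "0 < p" and q: "0 \<le> q" and C: "0 \<le> C"
    and g: "\<And>c d. c \<noteq> d \<Longrightarrow> 0 \<le> g c d \<and> g c d \<le> C * real (c + d)"
  obtains l where "\<And>U (a :: nat \<Rightarrow> nat) (b :: nat \<Rightarrow> nat). has_rates U g \<Longrightarrow> (\<lambda>n. real (a n) / n) \<longlonglongrightarrow> p \<Longrightarrow> (\<lambda>n. real (b n) / n) \<longlonglongrightarrow> q \<Longrightarrow>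
    (q = 0 \<Longrightarrow> \<forall>n. b n = 0) \<Longrightarrow> (\<lambda>n. U (a n) (b n) / n) \<longlonglongrightarrow> l"
proof -
  define ok where "ok U a b \<longleftrightarrow> has_rates U g \<and> (\<lambda>n. real (a n) / n) \<longlonglongrightarrow> p \<and> (\<lambda>n. real (b n) / n) \<longlonglongrightarrow> q \<and>
    (q = 0 \<longrightarrow> (\<forall>n. b n = 0))" for U and a b :: "nat \<Rightarrow> nat"
  have squeeze: "\<exists>lo hi. hi - lo \<le> e \<and> (\<forall>U a b. ok U a b \<longrightarrow>
      (\<forall>\<^sub>F n in sequentially. lo \<le> U (a n) (b n) / n \<and> U (a n) (b n) / n \<le> hi))" if e: "0 < e" for e :: real
  proof -
    \<comment> \<open>As \<delta> <= 1/2 gives c <= 2 p N and d <= 2 q N, \<open>M\<close> bounds g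
      c d / N. Then \<delta> <= e / (4 M) keeps the width 2 \<delta> G + e / 2 of the sandwich below
      e.\<close>
    define M where "M = 2 * C * (p + q) + 1"
    have M: "0 < M" using C p q by (auto simp: M_def intro!: add_nonneg_pos)
    define \<delta> where "\<delta> = min (1 / 2) (e / (4 * M))"
    have \<delta>: "0 < \<delta>" "\<delta> \<le> 1 / 2" "\<delta> \<le> e / (4 * M)" using e M by (auto simp: \<delta>_def)
    obtain c d N where cd: "c \<noteq> d" "0 < N" "(1 - \<delta>) * real c < p * real N" "p * real N < (1 + \<delta>) * real c"
      "q = 0 \<Longrightarrow> d = 0" "0 < q \<Longrightarrow> (1 - \<delta>) * real d < q * real N \<and> q * real N < (1 + \<delta>) * real d"
      using lattice_direction_near[OF p q \<delta>(1,2)] by blast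
    define G where "G = g c d / N"
    have half: "z \<le> 2 * (t * N)" if "(1 - \<delta>) * z \<le> t * N" "0 \<le> z" for z t :: real
    proof -
      have "1 / 2 * z \<le> (1 - \<delta>) * z" using \<delta> that by (intro mult_right_mono) auto
      then show ?thesis using that by linarith
    qed
    have "real c \<le> 2 * (p * N)" using cd(3) by (intro half) auto
    moreover have "real d \<le> 2 * (q * N)" using cd(5,6) q by (cases "q = 0") (auto intro!: half)
    ultimately have "C * real (c + d) \<le> C * (2 * (p + q) * N)" using C by (intro mult_left_mono) (auto simp: algebra_simps)
    then have "g c d \<le> (2 * C * (p + q)) * N" using g[OF cd(1)] by (simp add: algebra_simps)
    then have "G \<le> 2 * C * (p + q)" using cd(2) by (simp add: G_def pos_divide_le_eq)
    then have GM: "G \<le> M" "0 \<le> G" using g[OF cd(1)] by (auto simp: M_def G_def)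
    define lo where "lo = (1 - \<delta>) * G - e / 4"
    define hi where "hi = (1 + \<delta>) * G + e / 4"
    have "\<delta> * G \<le> e / (4 * M) * M" using \<delta> GM M by (intro mult_mono) auto
    then have "hi - lo \<le> e" using M by (simp add: lo_def hi_def algebra_simps)
    moreover have "\<forall>\<^sub>F n in sequentially. lo \<le> U (a n) (b n) / n \<and> U (a n) (b n) / n \<le> hi" if "ok U a b" for U a b
      unfolding lo_def hi_def G_def
      by (rule has_rates_sandwich[OF _ cd(1,2) \<delta>(1,2) cd(3,4,5,6) q]) (use that e in \<open>auto simp: ok_def\<close>)
    ultimately show ?thesis by blast
  qed
  show ?thesis
  proof (cases "\<exists>U a b. ok U a b")
    case False
    \<comment> \<open>Without any admissible triple the claim is vacuous and every number will
      do.\<close>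
    then show ?thesis using that[of 0] unfolding ok_def by blast
  next
    case True
    then obtain U0 a0 b0 where ok0: "ok U0 a0 b0" by blast
    define s where "s n = U0 (a0 n) (b0 n) / n" for n
    have "Cauchy s"
    proof (rule metric_CauchyI)
      fix e :: real assume e: "0 < e"
      obtain lo hi where lh: "hi - lo \<le> e / 2" "\<And>U a b. ok U a b \<Longrightarrow> \<forall>\<^sub>F n in sequentially. lo \<le> U (a n) (b n) / n \<and> U (a n) (b n) / n \<le> hi"
        using squeeze[of "e / 2"] e by auto
      obtain n0 where n0: "\<And>n. n \<ge> n0 \<Longrightarrow> lo \<le> s n \<and> s n \<le> hi"
        using lh(2)[OF ok0] unfolding s_def eventually_sequentially by blast
      have "dist (s m) (s n) < e" if "m \<ge> n0" "n \<ge> n0" for m n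
        using n0[OF that(1)] n0[OF that(2)] lh(1) e by (auto simp: dist_real_def)
      then show "\<exists>M. \<forall>m\<ge>M. \<forall>n\<ge>M. dist (s m) (s n) < e" by blast
    qed
    then obtain l where l: "s \<longlonglongrightarrow> l" using Cauchy_convergent unfolding convergent_def by blast
    show ?thesis
    proof (rule that[of l])
      fix U and a b :: "nat \<Rightarrow> nat"
      assume "has_rates U g" "(\<lambda>n. real (a n) / n) \<longlonglongrightarrow> p" "(\<lambda>n. real (b n) / n) \<longlonglongrightarrow> q" "q = 0 \<Longrightarrow> \<forall>n. b n = 0"
      then have ok: "ok U a b" by (auto simp: ok_def)
      show "(\<lambda>n. U (a n) (b n) / n) \<longlonglongrightarrow> l"
      proof (rule tendstoI)
        fix e :: real assume e: "0 < e"
        obtain lo hi where lh: "hi - lo \<le> e / 2" "\<And>U a b. ok U a b \<Longrightarrow> \<forall>\<^sub>F n in sequentially. lo \<le> U (a n) (b n) / n \<and> U (a n) (b n) / n \<le> hi"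
          using squeeze[of "e / 2"] e by auto
        have ev: "\<forall>\<^sub>F n in sequentially. lo \<le> s n" "\<forall>\<^sub>F n in sequentially. s n \<le> hi"
          using lh(2)[OF ok0] unfolding s_def by (auto elim: eventually_mono)
        have "lo \<le> l" "l \<le> hi"
          using tendsto_lowerbound[OF l ev(1)] tendsto_upperbound[OF l ev(2)] by auto
        then show "\<forall>\<^sub>F n in sequentially. dist (U (a n) (b n) / n) l < e"
          using lh(1) e by (intro eventually_mono[OF lh(2)[OF ok]]) (auto simp: dist_real_def)
      qed
    qed
  qed
qed

subsection \<open>The time constant\<close>

lemma AE_prob_const:
  assumes "prob_space M" "AE x in M. P"
  shows P
  using prob_space.AE_const[OF assms(1)] assms(2) by simp

lemma distr_PiM_componentwise:
  assumes N: "\<And>k. prob_space (N k)" and M: "\<And>k. prob_space (M k)"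
    and h: "\<And>k. h k \<in> N k \<rightarrow>\<^sub>M M k" "\<And>k. distr (N k) (M k) (h k) = M k"
  shows "(\<lambda>w k. h k (w k)) \<in> PiM UNIV N \<rightarrow>\<^sub>M PiM UNIV M" "distr (PiM UNIV N) (PiM UNIV M) (\<lambda>w k. h k (w k)) = PiM UNIV M"
proof -
  show m: "(\<lambda>w k. h k (w k)) \<in> PiM UNIV N \<rightarrow>\<^sub>M PiM UNIV M"
  proof (rule measurable_PiM_single')
    fix k
    show "(\<lambda>w. h k (w k)) \<in> PiM UNIV N \<rightarrow>\<^sub>M M k"
      by (rule measurable_compose[OF measurable_component_singleton[OF UNIV_I, of k N] h(1)[of k]])
  qed (auto simp: space_PiM PiE_iff dest: measurable_space[OF h(1)])
  interpret product_prob_space M UNIV by (intro product_prob_spaceI M)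
  show "distr (PiM UNIV N) (PiM UNIV M) (\<lambda>w k. h k (w k)) = PiM UNIV M"
  proof (rule PiM_eq)
    fix J F assume J: "finite J" "J \<subseteq> UNIV" and F: "\<And>j. j \<in> J \<Longrightarrow> F j \<in> sets (M j)"
    let ?G = "\<lambda>j. h j -` F j \<inter> space (N j)"
    have pre: "(\<lambda>w k. h k (w k)) -` prod_emb UNIV M J (Pi\<^sub>E J F) \<inter> space (PiM UNIV N) = prod_emb UNIV N J (Pi\<^sub>E J ?G)"
    proof (rule set_eqI)
      fix w
      have sp: "w \<in> space (PiM UNIV N) \<Longrightarrow> (\<lambda>k. h k (w k)) \<in> space (PiM UNIV M)"
        using measurable_space[OF m] by blast
      have 1: "(\<lambda>k. h k (w k)) \<in> prod_emb UNIV M J (Pi\<^sub>E J F) \<longleftrightarrow> (\<lambda>k. h k (w k)) \<in> space (PiM UNIV M) \<and> (\<forall>j\<in>J. h j (w j) \<in> F j)"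
        by (auto simp: prod_emb_iff space_PiM PiE_iff)
      have 2: "w \<in> prod_emb UNIV N J (Pi\<^sub>E J ?G) \<longleftrightarrow> w \<in> space (PiM UNIV N) \<and> (\<forall>j\<in>J. h j (w j) \<in> F j)"
        by (auto simp: prod_emb_iff space_PiM PiE_iff)
      show "w \<in> (\<lambda>w k. h k (w k)) -` prod_emb UNIV M J (Pi\<^sub>E J F) \<inter> space (PiM UNIV N) \<longleftrightarrow> w \<in> prod_emb UNIV N J (Pi\<^sub>E J ?G)"
        unfolding Int_iff vimage_eq 1 2 using sp by blast
    qed
    have G: "?G j \<in> sets (N j)" if "j \<in> J" for j using F[OF that] h(1) by (rule measurable_sets[rotated])
    have "emeasure (distr (PiM UNIV N) (PiM UNIV M) (\<lambda>w k. h k (w k))) (prod_emb UNIV M J (Pi\<^sub>E J F))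
      = emeasure (PiM UNIV N) (prod_emb UNIV N J (Pi\<^sub>E J ?G))"
      unfolding pre[symmetric] using F J m by (intro emeasure_distr sets_PiM_I) auto
    also have "\<dots> = (\<Prod>j\<in>J. emeasure (N j) (?G j))"
      using G J N by (intro Infinite_Product_Measure.emeasure_PiM_emb) auto
    also have "\<dots> = (\<Prod>j\<in>J. emeasure (M j) (F j))"
      using F h by (intro prod.cong refl) (metis emeasure_distr)
    finally show "emeasure (distr (PiM UNIV N) (PiM UNIV M) (\<lambda>w k. h k (w k))) (prod_emb UNIV M J (Pi\<^sub>E J F))
      = (\<Prod>j\<in>J. emeasure (M j) (F j))" .
  qed simp
qed

lemma distr_expd_scale:
  assumes a: "0 < a"
  shows "distr (expd a) (expd 1) (\<lambda>y. y * a) = expd 1"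
proof (rule measure_eqI)
  fix A assume "A \<in> sets (distr (expd a) (expd 1) (\<lambda>y. y * a))"
  then have A: "A \<in> sets borel" by simp
  have m: "(\<lambda>y. y * a) \<in> expd a \<rightarrow>\<^sub>M expd 1"
    by (simp add: measurable_cong_sets[OF sets_density sets_density])
  have "emeasure (distr (expd a) (expd 1) (\<lambda>y. y * a)) A = (\<integral>\<^sup>+y. indicator A (y * a) \<partial>expd a)"
    using nn_integral_distr[OF m, of "indicator A"] A by simp
  also have "\<dots> = (\<integral>\<^sup>+x. indicator A (x / a * a) \<partial>expd 1)"
    by (intro nn_integral_expd_scale a measurable_compose[OF _ borel_measurable_indicator[OF A]]) measurable
  also have "\<dots> = emeasure (expd 1) A" using a A by simp
  finally show "emeasure (distr (expd a) (expd 1) (\<lambda>y. y * a)) A = emeasure (expd 1) A" .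
qed simp

text \<open>For fixed rates, multiplying each weight by its rate turns the original weights into
  independent unit exponentials.\<close>

lemma AE_lpp_env:
  assumes \<alpha>: "\<And>i. 0 < \<alpha> i" and R: "AE X in exp_env UNIV. R X"
  shows "AE Y in lpp_env \<alpha>. R (\<lambda>k. Y k * \<alpha> (fst k))"
proof -
  let ?N = "\<lambda>k :: int \<times> int. expd (\<alpha> (fst k))"
  have h: "(\<lambda>y. y * \<alpha> (fst k)) \<in> ?N k \<rightarrow>\<^sub>M expd 1" "distr (?N k) (expd 1) (\<lambda>y. y * \<alpha> (fst k)) = expd 1" for k
    using distr_expd_scale[OF \<alpha>] by (simp_all add: measurable_cong_sets[OF sets_density sets_density])
  have N: "prob_space (?N k)" for k by (rule prob_space_exponential_density) (rule \<alpha>)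
  note d = distr_PiM_componentwise[of ?N "\<lambda>_. expd 1" "\<lambda>k y. y * \<alpha> (fst k)", OF N prob_space_exp1 h]
  show ?thesis
    unfolding lpp_env_def by (rule AE_distrD[OF d(1)], subst d(2), rule R)
qed

lemma prob_space_lpp_env:
  assumes "\<And>i. 0 < \<alpha> i"
  shows "prob_space (lpp_env \<alpha>)"
  unfolding lpp_env_def by (intro prob_space_PiM prob_space_exponential_density assms)

context disorder_law begin

interpretation L: prob_space L by (rule prob_L)
interpretation env: prob_space env by (rule prob_env)

lemma pw_nonneg: "(\<And>i. r \<le> \<alpha> i) \<Longrightarrow> (\<And>k. 0 \<le> X k) \<Longrightarrow> 0 \<le> pw \<alpha> X a b"
  unfolding pw_def using r_pos by (intro divide_nonneg_nonneg) (auto intro: order_trans[OF less_imp_le])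

lemma good_has_rates: "good g \<alpha> X \<Longrightarrow> has_rates (lpp (pw \<alpha> X)) g"
  unfolding good_def has_rates_def by (auto intro!: lpp_mono pw_nonneg)

lemma floor_div_tendsto: "(\<lambda>n. real_of_int \<lfloor>z * real n\<rfloor> / n) \<longlonglongrightarrow> z"
proof (rule tendsto_sandwich)
  show "\<forall>\<^sub>F n in sequentially. z - 1 / n \<le> real_of_int \<lfloor>z * real n\<rfloor> / n"
    using eventually_gt_at_top[of "0::nat"]
  proof eventually_elim
    case (elim n)
    have "(z * n - 1) / n \<le> real_of_int \<lfloor>z * real n\<rfloor> / n" by (rule divide_right_mono) linarith+
    then show ?case using elim by (simp add: diff_divide_distrib)
  qed
  show "\<forall>\<^sub>F n in sequentially. real_of_int \<lfloor>z * real n\<rfloor> / n \<le> z"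
    using eventually_gt_at_top[of "0::nat"]
  proof eventually_elim
    case (elim n)
    have "real_of_int \<lfloor>z * real n\<rfloor> / n \<le> (z * n) / n" by (rule divide_right_mono) linarith+
    then show ?case using elim by simp
  qed
  show "(\<lambda>n. z - 1 / real n) \<longlonglongrightarrow> z" using tendsto_diff[OF tendsto_const lim_1_over_n, of z] by simp
qed simp

text \<open>\<open>coord_a x y n\<close> and \<open>coord_b y n\<close> are the quadrant coordinates of the lattice point below \<open>n (x, y)\<close>.\<close>

definition coord_a :: "real \<Rightarrow> real \<Rightarrow> nat \<Rightarrow> nat" where
  "coord_a x y n = nat (\<lfloor>x * real n\<rfloor> + \<lfloor>y * real n\<rfloor>)"

definition coord_b :: "real \<Rightarrow> nat \<Rightarrow> nat" where
  "coord_b y n = nat \<lfloor>y * real n\<rfloor>"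

lemma coord_facts:
  assumes "0 \<le> y" "0 < x + y"
  shows "\<forall>\<^sub>F n in sequentially. int (coord_a x y n) - int (coord_b y n) = \<lfloor>x * real n\<rfloor> \<and> int (coord_b y n) = \<lfloor>y * real n\<rfloor>"
    and "(\<lambda>n. real (coord_a x y n) / n) \<longlonglongrightarrow> x + y" "(\<lambda>n. real (coord_b y n) / n) \<longlonglongrightarrow> y"
proof -
  \<comment> \<open>The two floors together lose at most 2, so the sum is nonnegative, and
    \<open>nat\<close> harmless, once n (x + y) >= 2.\<close>
  have ev: "\<forall>\<^sub>F n in sequentially. int (coord_a x y n) = \<lfloor>x * real n\<rfloor> + \<lfloor>y * real n\<rfloor>"
    using eventually_ge_at_top[of "nat \<lceil>2 / (x + y)\<rceil>"]
  proof eventually_elim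
    case (elim n)
    have "2 / (x + y) \<le> real n" using elim by linarith
    then have "2 \<le> (x + y) * real n" using assms by (simp add: field_simps)
    then have "0 \<le> \<lfloor>x * real n\<rfloor> + \<lfloor>y * real n\<rfloor>" by (simp add: algebra_simps) linarith
    then show ?case by (simp add: coord_a_def)
  qed
  have b: "int (coord_b y n) = \<lfloor>y * real n\<rfloor>" for n using assms by (simp add: coord_b_def)
  show "\<forall>\<^sub>F n in sequentially. int (coord_a x y n) - int (coord_b y n) = \<lfloor>x * real n\<rfloor> \<and> int (coord_b y n) = \<lfloor>y * real n\<rfloor>"
    using ev by eventually_elim (simp add: b)
  have "real (coord_b y n) / n = real_of_int \<lfloor>y * real n\<rfloor> / n" for n
    using b[of n] by (metis of_int_of_nat_eq)
  then have "(\<lambda>n. real (coord_b y n) / n) = (\<lambda>n. real_of_int \<lfloor>y * real n\<rfloor> / n)" by (rule ext)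
  then show "(\<lambda>n. real (coord_b y n) / n) \<longlonglongrightarrow> y" using floor_div_tendsto[of y] by presburger
  have "(\<lambda>n. real_of_int \<lfloor>x * real n\<rfloor> / n + real_of_int \<lfloor>y * real n\<rfloor> / n) \<longlonglongrightarrow> x + y"
    by (intro tendsto_add floor_div_tendsto)
  moreover have "\<forall>\<^sub>F n in sequentially. real_of_int \<lfloor>x * real n\<rfloor> / n + real_of_int \<lfloor>y * real n\<rfloor> / n = real (coord_a x y n) / n"
    using ev
  proof eventually_elim
    case (elim n)
    then have "real (coord_a x y n) = real_of_int (\<lfloor>x * real n\<rfloor> + \<lfloor>y * real n\<rfloor>)" by (metis of_int_of_nat_eq)
    then show ?case by (simp add: add_divide_distrib)
  qed
  ultimately show "(\<lambda>n. real (coord_a x y n) / n) \<longlonglongrightarrow> x + y" by (blast intro: Lim_transform_eventually)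
qed

text \<open>Unfolding the definite description takes existence and uniqueness of an almost sure
  constant limit. The deterministic \<open>l\<close> of \<open>direction_limit\<close> provides the
  first; the second holds because an almost sure statement without random variables is true in a
  probability space.\<close>

lemma time_constant:
  assumes xy: "0 \<le> y" "0 < x + y"
  shows "AE w in env. (\<lambda>n. lpp (wt w) (coord_a x y n) (coord_b y n) / n) \<longlonglongrightarrow> lpp_tau L x y"
    and "AE \<alpha> in disorder L. AE X in exp_env UNIV. (\<forall>i. r \<le> \<alpha> i) \<and> (\<forall>k. 0 \<le> X k) \<and>
      (\<lambda>n. lpp (pw \<alpha> X) (coord_a x y n) (coord_b y n) / n) \<longlonglongrightarrow> lpp_tau L x y"
proof -
  obtain g where g: "\<And>c d. c \<noteq> d \<Longrightarrow> 0 \<le> g c d \<and> g c d \<le> 12 * real (c + d) / r"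
    and gd: "AE w in env. good g (\<lambda>i. w (Inl i)) (\<lambda>k. w (Inr k))" "AE \<alpha> in disorder L. AE X in exp_env UNIV. good g \<alpha> X"
    using AE_good by blast
  have gC: "0 \<le> g c d \<and> g c d \<le> 12 / r * real (c + d)" if "c \<noteq> d" for c d
    using g[OF that] by simp
  have C: "0 \<le> 12 / r" using r_pos by simp
  obtain l where l: "\<And>U (a :: nat \<Rightarrow> nat) (b :: nat \<Rightarrow> nat). has_rates U g \<Longrightarrow> (\<lambda>n. real (a n) / n) \<longlonglongrightarrow> x + y \<Longrightarrow> (\<lambda>n. real (b n) / n) \<longlonglongrightarrow> y \<Longrightarrow>
    (y = 0 \<Longrightarrow> \<forall>n. b n = 0) \<Longrightarrow> (\<lambda>n. U (a n) (b n) / n) \<longlonglongrightarrow> l"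
    using direction_limit[OF xy(2,1) C gC] by blast
  note co = coord_facts[OF xy]
  have b0: "y = 0 \<Longrightarrow> \<forall>n. coord_b y n = 0" by (simp add: coord_b_def)
  have lim: "(\<lambda>n. lpp (pw \<alpha> X) (coord_a x y n) (coord_b y n) / n) \<longlonglongrightarrow> l" if "good g \<alpha> X" for \<alpha> X
    by (rule l[OF good_has_rates[OF that] co(2,3) b0])
  \<comment> \<open>\<open>lpp_T\<close> counts the end weight: it lies between \<open>lpp\<close>
    at the end point and \<open>lpp\<close> one step to the right, which have the same
    limit.\<close>
  have limS: "(\<lambda>n. lpp (pw \<alpha> X) (Suc (coord_a x y n)) (coord_b y n) / n) \<longlonglongrightarrow> l" if "good g \<alpha> X" for \<alpha> X
  proof (rule l[OF good_has_rates[OF that] _ co(3) b0])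
    show "(\<lambda>n. real (Suc (coord_a x y n)) / n) \<longlonglongrightarrow> x + y"
      using tendsto_add[OF co(2) lim_1_over_n] by (simp add: add_divide_distrib add.commute)
  qed
  have limT: "(\<lambda>n. lpp_T (\<lambda>k. X k / \<alpha> (fst k)) \<lfloor>x * real n\<rfloor> \<lfloor>y * real n\<rfloor> / real n) \<longlonglongrightarrow> l" if gX: "good g \<alpha> X" for \<alpha> X
  proof (rule tendsto_sandwich[OF _ _ lim[OF gX] limS[OF gX]])
    have pos: "0 \<le> pw \<alpha> X a b" for a b using gX by (intro pw_nonneg) (auto simp: good_def)
    have T: "\<forall>\<^sub>F n in sequentially. lpp_T (\<lambda>k. X k / \<alpha> (fst k)) \<lfloor>x * real n\<rfloor> \<lfloor>y * real n\<rfloor> =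
      lpp (pw \<alpha> X) (coord_a x y n) (coord_b y n) + pw \<alpha> X (coord_a x y n) (coord_b y n)"
      using co(1)
    proof eventually_elim
      case (elim n)
      have "lpp_T (\<lambda>k. X k / \<alpha> (fst k)) (int (coord_a x y n) - int (coord_b y n)) (int (coord_b y n)) =
        lpp (pw \<alpha> X) (coord_a x y n) (coord_b y n) + pw \<alpha> X (coord_a x y n) (coord_b y n)"
        unfolding lpp_T_eq by (simp add: pw_def[abs_def])
      then show ?case unfolding conjunct1[OF elim] unfolding conjunct2[OF elim] .
    qed
    show "\<forall>\<^sub>F n in sequentially. lpp (pw \<alpha> X) (coord_a x y n) (coord_b y n) / n \<le> lpp_T (\<lambda>k. X k / \<alpha> (fst k)) \<lfloor>x * real n\<rfloor> \<lfloor>y * real n\<rfloor> / real n"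
      using T by eventually_elim (use pos in \<open>simp add: divide_right_mono\<close>)
    show "\<forall>\<^sub>F n in sequentially. lpp_T (\<lambda>k. X k / \<alpha> (fst k)) \<lfloor>x * real n\<rfloor> \<lfloor>y * real n\<rfloor> / real n \<le> lpp (pw \<alpha> X) (Suc (coord_a x y n)) (coord_b y n) / n"
      using T by eventually_elim (use lpp_step_right in \<open>simp add: divide_right_mono\<close>)
  qed
  have main: "AE \<alpha> in disorder L. prob_space (lpp_env \<alpha>) \<and> (AE Y in lpp_env \<alpha>. (\<lambda>n. lpp_T Y \<lfloor>x * real n\<rfloor> \<lfloor>y * real n\<rfloor> / real n) \<longlonglongrightarrow> l)"
    using gd(2)
  proof eventually_elim
    case (elim \<alpha>)
    have "AE X in exp_env (UNIV :: (int \<times> int) set). \<forall>i. r \<le> \<alpha> i"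
      using elim by eventually_elim (simp add: good_def)
    then have \<alpha>: "\<forall>i. r \<le> \<alpha> i" by (rule AE_prob_const[OF prob_space_exp_env])
    then have \<alpha>0: "0 < \<alpha> i" for i using r_pos by (meson less_le_trans)
    have nz: "\<alpha> i \<noteq> 0" for i using \<alpha>0[of i] by simp
    have "AE Y in lpp_env \<alpha>. good g \<alpha> (\<lambda>k. Y k * \<alpha> (fst k))" by (rule AE_lpp_env[OF \<alpha>0 elim])
    then have "AE Y in lpp_env \<alpha>. (\<lambda>n. lpp_T Y \<lfloor>x * real n\<rfloor> \<lfloor>y * real n\<rfloor> / real n) \<longlonglongrightarrow> l"
    proof eventually_elim
      case (elim Y)
      from limT[OF elim] show ?case by (simp add: nz)
    qed
    then show ?case using prob_space_lpp_env[of \<alpha>, OF \<alpha>0] by blast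
  qed
  have pd: "prob_space (disorder L)" unfolding disorder_def by (intro prob_space_PiM prob_L)
  have tau: "lpp_tau L x y = l"
    unfolding lpp_tau_def
  proof (rule the_equality)
    show "AE \<alpha> in disorder L. AE Y in lpp_env \<alpha>. (\<lambda>n. lpp_T Y \<lfloor>x * real n\<rfloor> \<lfloor>y * real n\<rfloor> / real n) \<longlonglongrightarrow> l"
      using main by eventually_elim blast
    fix c assume c: "AE \<alpha> in disorder L. AE Y in lpp_env \<alpha>. (\<lambda>n. lpp_T Y \<lfloor>x * real n\<rfloor> \<lfloor>y * real n\<rfloor> / real n) \<longlonglongrightarrow> c"
    have "AE \<alpha> in disorder L. c = l"
      using c main
    proof eventually_elim
      case (elim \<alpha>)
      from elim(1) conjunct2[OF elim(2)] have "AE Y in lpp_env \<alpha>. c = l"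
        by eventually_elim (rule LIMSEQ_unique)
      then show ?case by (rule AE_prob_const[OF conjunct1[OF elim(2)]])
    qed
    then show "c = l" by (rule AE_prob_const[OF pd])
  qed
  show "AE w in env. (\<lambda>n. lpp (wt w) (coord_a x y n) (coord_b y n) / n) \<longlonglongrightarrow> lpp_tau L x y"
    using gd(1)
  proof eventually_elim
    case (elim w)
    have "wt w = pw (\<lambda>i. w (Inl i)) (\<lambda>k. w (Inr k))"
      using elim unfolding good_def by (intro ext) (simp add: wt_def pw_def max_absorb2)
    then show ?case using lim[OF elim] by (simp add: tau)
  qed
  show "AE \<alpha> in disorder L. AE X in exp_env UNIV. (\<forall>i. r \<le> \<alpha> i) \<and> (\<forall>k. 0 \<le> X k) \<and>
      (\<lambda>n. lpp (pw \<alpha> X) (coord_a x y n) (coord_b y n) / n) \<longlonglongrightarrow> lpp_tau L x y"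
    using gd(2)
  proof eventually_elim
    case (elim \<alpha>)
    then show ?case
    proof eventually_elim
      case (elim X)
      then show ?case using lim[OF elim] by (simp add: tau good_def)
    qed
  qed
qed

subsection \<open>Bounds on the time constant\<close>

lemma inverse_rate_integrable: "integrable L (\<lambda>a. 1 / a)"
proof (rule L.integrable_const_bound[of _ "1 / r"])
  show "AE a in L. norm (1 / a) \<le> 1 / r"
    using L_ge
  proof eventually_elim
    case (elim a)
    then show ?case using r_pos by (simp add: frac_le)
  qed
qed measurable

text \<open>Averages the savings for fixed rates over the disorder: |a - b| forced columns, each
  saving 1/r - E[1/\<alpha>] in mean.\<close>

lemma mean_savings_env:
  "(\<integral>w. lpp (wt w) a b \<partial>env) + \<bar>real a - real b\<bar> * (1 / r - (\<integral>a. 1 / a \<partial>L))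
    \<le> (2 * real a + 2 * real b + 4 + 2 * sqrt (real a + 1) + 2 * sqrt (real b + 1)) / r"
proof -
  let ?A = "PiM UNIV (\<lambda>_::int. L)" and ?X = "exp_env (UNIV :: (int \<times> int) set)"
  let ?B = "(2 * real a + 2 * real b + 4 + 2 * sqrt (real a + 1) + 2 * sqrt (real b + 1)) / r"
  interpret A: prob_space ?A by (intro prob_space_PiM prob_L)
  interpret X: prob_space ?X by (rule prob_space_exp_env)
  interpret pair_prob_space ?A ?X by standard
  let ?f = "\<lambda>z. lpp (wt (case z of (\<alpha>, X) \<Rightarrow> case_sum \<alpha> X)) a b"
  have int: "integrable (?A \<Otimes>\<^sub>M ?X) ?f"
    using integrable_distr[OF distr_env_pair(1), of "\<lambda>w. lpp (wt w) a b"] lpp_wt_mean(1) unfolding distr_env_pair(2) by blast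
  have eq: "(\<integral>w. lpp (wt w) a b \<partial>env) = (\<integral>\<alpha>. \<integral>X. lpp (wt (case_sum \<alpha> X)) a b \<partial>?X \<partial>?A)"
    using integral_distr[OF distr_env_pair(1) measurable_lpp_wt0, of a b] integral_fst'[OF int] unfolding distr_env_pair(2) by simp
  have coord: "distr ?A L (\<lambda>\<alpha>. \<alpha> i) = L" for i by (intro distr_PiM_component prob_L) simp
  have mcoord: "(\<lambda>\<alpha>. \<alpha> i) \<in> ?A \<rightarrow>\<^sub>M L" for i by (rule measurable_component_singleton) simp
  have ci: "integrable ?A (\<lambda>\<alpha>. 1 / \<alpha> i)" "(\<integral>\<alpha>. 1 / \<alpha> i \<partial>?A) = (\<integral>a. 1 / a \<partial>L)" for i
  proof -
    have m: "(\<lambda>a. 1 / a) \<in> borel_measurable L" by measurable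
    show "integrable ?A (\<lambda>\<alpha>. 1 / \<alpha> i)"
      using integrable_distr[OF mcoord[of i], of "\<lambda>a. 1 / a"] inverse_rate_integrable unfolding coord by blast
    show "(\<integral>\<alpha>. 1 / \<alpha> i \<partial>?A) = (\<integral>a. 1 / a \<partial>L)"
      using integral_distr[OF mcoord[of i] m] unfolding coord by simp
  qed
  let ?D = "\<lambda>\<alpha>. \<Sum>i\<in>cols_between (int a - int b). 1 / r - 1 / \<alpha> i"
  have D: "integrable ?A ?D" "(\<integral>\<alpha>. ?D \<alpha> \<partial>?A) = \<bar>real a - real b\<bar> * (1 / r - (\<integral>a. 1 / a \<partial>L))"
  proof -
    show "integrable ?A ?D" using ci(1) by auto
    have "(\<integral>\<alpha>. ?D \<alpha> \<partial>?A) = (\<Sum>i\<in>cols_between (int a - int b). (\<integral>\<alpha>. 1 / r - 1 / \<alpha> i \<partial>?A))"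
      using ci(1) by (intro Bochner_Integration.integral_sum) auto
    also have "\<dots> = (\<Sum>i\<in>cols_between (int a - int b). 1 / r - (\<integral>a. 1 / a \<partial>L))"
      using ci A.prob_space by (intro sum.cong) simp_all
    also have "\<dots> = \<bar>real a - real b\<bar> * (1 / r - (\<integral>a. 1 / a \<partial>L))"
      by (simp only: sum_constant card_cols_between) simp
    finally show "(\<integral>\<alpha>. ?D \<alpha> \<partial>?A) = \<bar>real a - real b\<bar> * (1 / r - (\<integral>a. 1 / a \<partial>L))" .
  qed
  have "AE \<alpha> in ?A. r \<le> \<alpha> i" for i by (rule AE_PiM_component) (use prob_L L_ge in auto)
  then have "AE \<alpha> in ?A. \<forall>i. r \<le> \<alpha> i" by (simp add: AE_all_countable)
  then have ae: "AE \<alpha> in ?A. (\<integral>X. lpp (wt (case_sum \<alpha> X)) a b \<partial>?X) + ?D \<alpha> \<le> ?B"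
  proof eventually_elim
    case (elim \<alpha>)
    have m1: "(\<lambda>X. lpp (wt (case_sum \<alpha> X)) a b) \<in> borel_measurable ?X"
      unfolding wt_def by (intro borel_measurable_lpp) simp
    have m2: "(\<lambda>X. lpp (\<lambda>i j. X (int i - int j, int j) / \<alpha> (int i - int j)) a b) \<in> borel_measurable ?X"
      by (intro borel_measurable_lpp) simp
    have "AE X in ?X. \<forall>k. 0 \<le> X k" using AE_exp_env_nonneg[of "UNIV :: (int \<times> int) set"] by simp
    then have "AE X in ?X. lpp (wt (case_sum \<alpha> X)) a b = lpp (\<lambda>i j. X (int i - int j, int j) / \<alpha> (int i - int j)) a b"
      by eventually_elim (use elim in \<open>simp add: wt_def[abs_def] max_absorb2\<close>)
    then have "(\<integral>X. lpp (wt (case_sum \<alpha> X)) a b \<partial>?X) = (\<integral>X. lpp (\<lambda>i j. X (int i - int j, int j) / \<alpha> (int i - int j)) a b \<partial>?X)"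
      by (rule integral_cong_AE[OF m1 m2])
    then show ?case using lpp_mean_savings[OF r_pos, of \<alpha> a b] elim by simp
  qed
  have i1: "integrable ?A (\<lambda>\<alpha>. \<integral>X. lpp (wt (case_sum \<alpha> X)) a b \<partial>?X)" using integrable_fst'[OF int] by simp
  have "(\<integral>w. lpp (wt w) a b \<partial>env) + (\<integral>\<alpha>. ?D \<alpha> \<partial>?A) = (\<integral>\<alpha>. (\<integral>X. lpp (wt (case_sum \<alpha> X)) a b \<partial>?X) + ?D \<alpha> \<partial>?A)"
    unfolding eq by (rule Bochner_Integration.integral_add[OF i1 D(1), symmetric])
  also have "\<dots> \<le> (\<integral>\<alpha>. ?B \<partial>?A)"
    using ae by (intro integral_mono_AE Bochner_Integration.integrable_add i1 D(1)) auto
  also have "\<dots> = ?B" using A.prob_space by simp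
  finally show ?thesis unfolding D(2) .
qed

lemma sqrt_div_tendsto_0:
  fixes a :: "nat \<Rightarrow> nat"
  assumes "(\<lambda>n. real (a n) / n) \<longlonglongrightarrow> p"
  shows "(\<lambda>n. sqrt (real (a n) + 1) / n) \<longlonglongrightarrow> 0"
proof -
  have "(\<lambda>n. sqrt ((real (a n) / n + 1 / n) * (1 / n))) \<longlonglongrightarrow> sqrt ((p + 0) * 0)"
    by (intro tendsto_intros assms lim_1_over_n)
  moreover have "sqrt ((real (a n) / n + 1 / n) * (1 / n)) = sqrt (real (a n) + 1) / n" for n
  proof -
    have "(real (a n) / n + 1 / n) * (1 / n) = (real (a n) + 1) / (real n)\<^sup>2"
      by (simp add: power2_eq_square add_divide_distrib)
    then show ?thesis by (simp add: real_sqrt_divide)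
  qed
  ultimately show ?thesis by simp
qed

text \<open>An almost sure limit is at most the limit of bounds on the means, as in Fatou's lemma:
  the means truncated at \<open>l + 1\<close> converge to \<open>l\<close> by dominated convergence
  and lie below the full means.\<close>

lemma time_constant_upper:
  assumes xy: "0 \<le> y" "0 < x + y"
  shows "lpp_tau L x y \<le> (4 * y + 2 * x) / r - \<bar>x\<bar> * (1 / r - (\<integral>a. 1 / a \<partial>L))"
proof -
  define l where "l = lpp_tau L x y"
  define \<mu> where "\<mu> = 1 / r - (\<integral>a. 1 / a \<partial>L)"
  define U where "U n w = lpp (wt w) (coord_a x y n) (coord_b y n) / real n" for n w
  note co = coord_facts[OF xy]
  have U0: "0 \<le> U n w" for n w unfolding U_def by (intro divide_nonneg_nonneg lpp_nonneg wt_nonneg) auto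
  have lim: "AE w in env. (\<lambda>n. U n w) \<longlonglongrightarrow> l" using time_constant(1)[OF xy] by (simp add: U_def l_def)
  have Um [measurable]: "U n \<in> borel_measurable env" for n unfolding U_def by measurable
  have Ui: "integrable env (U n)" for n unfolding U_def using lpp_wt_mean(1) by auto
  have "AE w in env. 0 \<le> l"
    using lim by eventually_elim (rule LIMSEQ_le_const, auto simp: U0)
  then have l0: "0 \<le> l" by (rule AE_prob_const[OF prob_env])
  have "(\<lambda>n. \<integral>w. min (l + 1) (U n w) \<partial>env) \<longlonglongrightarrow> (\<integral>w. l \<partial>env)"
  proof (rule integral_dominated_convergence[where w = "\<lambda>_. l + 1"])
    show "AE w in env. (\<lambda>n. min (l + 1) (U n w)) \<longlonglongrightarrow> l"
      using lim
    proof eventually_elim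
      case (elim w)
      from tendsto_min[OF tendsto_const elim, of "l + 1"] show ?case by simp
    qed
    show "AE w in env. norm (min (l + 1) (U n w)) \<le> l + 1" for n
      using U0[of n] l0 by (intro AE_I2) (simp add: min_def)
  qed auto
  then have lim1: "(\<lambda>n. \<integral>w. min (l + 1) (U n w) \<partial>env) \<longlonglongrightarrow> l" by (simp add: env.prob_space)
  define R where "R n = (2 * (real (coord_a x y n) / n) + 2 * (real (coord_b y n) / n) + 4 * (1 / n) + 2 * (sqrt (real (coord_a x y n) + 1) / n) + 2 * (sqrt (real (coord_b y n) + 1) / n)) / r
     - \<bar>real (coord_a x y n) / n - real (coord_b y n) / n\<bar> * \<mu>" for n
  have le: "(\<integral>w. min (l + 1) (U n w) \<partial>env) \<le> R n" if n: "0 < n" for n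
  proof -
    have "(\<integral>w. min (l + 1) (U n w) \<partial>env) \<le> (\<integral>w. U n w \<partial>env)"
      using Ui by (intro integral_mono) auto
    also have "\<dots> = (\<integral>w. lpp (wt w) (coord_a x y n) (coord_b y n) \<partial>env) / n" by (simp add: U_def)
    also have "\<dots> \<le> ((2 * real (coord_a x y n) + 2 * real (coord_b y n) + 4 + 2 * sqrt (real (coord_a x y n) + 1) + 2 * sqrt (real (coord_b y n) + 1)) / r
        - \<bar>real (coord_a x y n) - real (coord_b y n)\<bar> * \<mu>) / n"
      using mean_savings_env[of "coord_a x y n" "coord_b y n"] by (intro divide_right_mono) (auto simp: \<mu>_def)
    also have "\<dots> = R n"
    proof -
      have "\<bar>real (coord_a x y n) / n - real (coord_b y n) / n\<bar> = \<bar>real (coord_a x y n) - real (coord_b y n)\<bar> / n"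
        by (simp add: diff_divide_distrib[symmetric])
      then show ?thesis using n r_pos by (simp add: R_def diff_divide_distrib add_divide_distrib mult.commute)
    qed
    finally show ?thesis .
  qed
  have "R \<longlonglongrightarrow> (2 * (x + y) + 2 * y + 4 * 0 + 2 * 0 + 2 * 0) / r - \<bar>(x + y) - y\<bar> * \<mu>"
    unfolding R_def
    by (intro tendsto_intros co(2,3) lim_1_over_n sqrt_div_tendsto_0[OF co(2)] sqrt_div_tendsto_0[OF co(3)]) (use r_pos in auto)
  then have "l \<le> (2 * (x + y) + 2 * y + 4 * 0 + 2 * 0 + 2 * 0) / r - \<bar>(x + y) - y\<bar> * \<mu>"
    using le by (intro tendsto_le[OF _ _ lim1] eventually_mono[OF eventually_gt_at_top[of "0::nat"]]) auto
  then show ?thesis by (simp add: l_def \<mu>_def)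
qed

section \<open>Lower bound along the diagonal\<close>

lemma integrable_lpp_pw: "integrable (exp_env UNIV) (\<lambda>X. lpp (pw \<alpha> X) a b)"
proof -
  have "integrable (exp_env UNIV) (\<lambda>X. pw \<alpha> X i j)" for i j
    unfolding pw_def by (intro integrable_divide exp_env_mean(1)) simp_all
  then show ?thesis using lpp_jensen[of a b "exp_env UNIV" "pw \<alpha>"] by blast
qed

text \<open>If the rates near the origin are close to \<open>r\<close>, paths that zigzag through the blocks on the diagonal
are almost as slow as in the homogeneous model of rate \<open>r\<close>.\<close>

lemma diagonal_chain:
  assumes \<alpha>: "\<And>i. r \<le> \<alpha> i" and slow: "\<And>i. \<bar>i\<bar> \<le> int N \<Longrightarrow> \<alpha> i \<le> s"
  shows "real k * ((\<integral>w. lpp (\<lambda>i j. w (i, j)) N N \<partial>exp_env UNIV) / s) \<le> (\<integral>X. lpp (pw \<alpha> X) (k * N) (k * N) \<partial>exp_env UNIV)"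
proof (induction k)
  case 0
  then show ?case by simp
next
  case (Suc k)
  have s0: "0 < s" using slow[of 0] \<alpha>[of 0] r_pos by simp
  have \<alpha>0: "0 < \<alpha> i" for i using \<alpha>[of i] r_pos by simp
  \<comment> \<open>The k-th block meets the same slow columns as the first, |i - j| <= N, but at
    new heights, hence with fresh clocks of the same law.\<close>
  let ?Q = "\<lambda>X :: int \<times> int \<Rightarrow> real. lpp (\<lambda>i j. X (int i - int j, int (k * N + j))) N N"
  have iQ: "integrable (exp_env UNIV) ?Q"
    by (rule integrable_hom_lpp[of "\<lambda>i j. (int i - int j, int (k * N + j))"])
  have EQ: "(\<integral>X. ?Q X \<partial>exp_env UNIV) = (\<integral>w. lpp (\<lambda>i j. w (i, j)) N N \<partial>exp_env UNIV)"
    by (rule hom_lpp_reindex[of "\<lambda>i j. (int i - int j, int (k * N + j))" "\<lambda>x. x"]) auto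
  have "(\<integral>X. lpp (pw \<alpha> X) (k * N) (k * N) + (1 / s) * ?Q X \<partial>exp_env UNIV) \<le> (\<integral>X. lpp (pw \<alpha> X) (Suc k * N) (Suc k * N) \<partial>exp_env UNIV)"
  proof (rule integral_mono_AE)
    show "integrable (exp_env UNIV) (\<lambda>X. lpp (pw \<alpha> X) (k * N) (k * N) + (1 / s) * ?Q X)"
      using integrable_lpp_pw iQ by auto
    have "AE X in exp_env UNIV. \<forall>k :: int \<times> int. 0 \<le> X k" using AE_exp_env_nonneg[of "UNIV :: (int \<times> int) set"] by simp
    then show "AE X in exp_env UNIV. lpp (pw \<alpha> X) (k * N) (k * N) + (1 / s) * ?Q X \<le> lpp (pw \<alpha> X) (Suc k * N) (Suc k * N)"
    proof eventually_elim
      case (elim X)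
      have "(1 / s) * ?Q X = lpp (\<lambda>i j. (1 / s) * X (int i - int j, int (k * N + j))) N N"
        using s0 by (intro lpp_scale[symmetric]) simp
      also have "\<dots> \<le> lpp (\<lambda>i j. pw \<alpha> X (k * N + i) (k * N + j)) N N"
      proof (rule lpp_mono_weights)
        fix i j assume "i \<le> N" "j \<le> N"
        then have "\<alpha> (int i - int j) \<le> s" by (intro slow) linarith
        then have "X (int i - int j, int (k * N + j)) / s \<le> X (int i - int j, int (k * N + j)) / \<alpha> (int i - int j)"
          using elim \<alpha>0 s0 by (intro divide_left_mono mult_pos_pos) auto
        then show "(1 / s) * X (int i - int j, int (k * N + j)) \<le> pw \<alpha> X (k * N + i) (k * N + j)"
          by (simp add: pw_def)
      qed
      finally show ?case
        using lpp_superadd[of "pw \<alpha> X" "k * N" "k * N" N N] by (simp add: add.commute)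
    qed
  qed (rule integrable_lpp_pw)
  then show ?case
    using Suc iQ integrable_lpp_pw[of \<alpha> "k * N" "k * N"] EQ by (simp add: distrib_right add_divide_distrib)
qed

text \<open>As the time constant is deterministic, it may be computed in a single environment taken
  from an event of positive probability. For these fixed rates, means are bounded below by
  \<open>diagonal_chain\<close>; carrying this over to the limit needs uniform integrability, which
  the excess bound \<open>hom_lpp_upper\<close> provides.\<close>

lemma time_constant_lower_eps:
  assumes y: "0 < y" and mass: "\<And>s. r < s \<Longrightarrow> 0 < measure L {..<s}" and e: "0 < e" "e < 4"
  shows "y * (4 - e) / (r + e) \<le> lpp_tau L 0 y"
proof -
  define l where "l = lpp_tau L 0 y"
  have xy: "0 \<le> y" "0 < 0 + y" using y by auto
  obtain N :: nat where N: "0 < N" "(4 - e) * N \<le> (\<integral>w. lpp (\<lambda>i j. w (i, j)) N N \<partial>exp_env UNIV)"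
    using hom_lpp_lower[OF e] by blast
  define J where "J = {- int N..int N}"
  define A where "A = prod_emb UNIV (\<lambda>_::int. L) J (\<Pi>\<^sub>E i\<in>J. {..<r + e})"
  have sL: "{..<r + e} \<in> sets L" by (simp add: sets_L)
  have "emeasure (PiM UNIV (\<lambda>_::int. L)) A = (\<Prod>i\<in>J. emeasure L {..<r + e})"
    unfolding A_def by (intro Infinite_Product_Measure.emeasure_PiM_emb prob_L sL) (auto simp: J_def)
  also have "\<dots> \<noteq> 0"
    using mass[of "r + e"] e by (auto simp: L.emeasure_eq_measure)
  finally have A0: "emeasure (disorder L) A \<noteq> 0" by (simp add: disorder_def)
  have As: "A \<in> sets (disorder L)" unfolding A_def disorder_def using sL by (intro sets_PiM_I) (auto simp: J_def)
  define Q where "Q \<alpha> \<longleftrightarrow> (AE X in exp_env UNIV. (\<forall>i. r \<le> \<alpha> i) \<and> (\<forall>k. 0 \<le> X k) \<and>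
      (\<lambda>n. lpp (pw \<alpha> X) (coord_a 0 y n) (coord_b y n) / n) \<longlonglongrightarrow> l)" for \<alpha>
  have aeQ: "AE \<alpha> in disorder L. Q \<alpha>" unfolding Q_def l_def by (rule time_constant(2)[OF xy])
  \<comment> \<open>An event of positive probability meets every almost sure set.\<close>
  have "\<exists>\<alpha>\<in>A. Q \<alpha>"
  proof (rule ccontr)
    assume nA: "\<not> ?thesis"
    have "AE \<alpha> in disorder L. \<alpha> \<notin> A" using aeQ by eventually_elim (use nA in blast)
    then have "emeasure (disorder L) A = 0" using As by (subst (asm) AE_iff_measurable[OF As]) (auto dest: sets.sets_into_space)
    then show False using A0 by simp
  qed
  then obtain \<alpha> where \<alpha>A: "\<alpha> \<in> A" and \<alpha>Q: "Q \<alpha>" by blast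
  interpret X: prob_space "exp_env (UNIV :: (int \<times> int) set)" by (rule prob_space_exp_env)
  have "AE X in exp_env (UNIV :: (int \<times> int) set). \<forall>i. r \<le> \<alpha> i" using \<alpha>Q unfolding Q_def by eventually_elim blast
  then have \<alpha>: "r \<le> \<alpha> i" for i using AE_prob_const[OF prob_space_exp_env] by blast
  have slow: "\<alpha> i \<le> r + e" if "\<bar>i\<bar> \<le> int N" for i
  proof -
    have "i \<in> J" using that by (auto simp: J_def)
    then show ?thesis using \<alpha>A by (auto simp: A_def prod_emb_iff PiE_iff less_imp_le)
  qed
  define m where "m n = nat \<lfloor>y * real n\<rfloor>" for n
  have m_eq: "coord_a 0 y n = m n" "coord_b y n = m n" for n by (auto simp: coord_a_def coord_b_def m_def)
  have mlim: "(\<lambda>n. real (m n) / n) \<longlonglongrightarrow> y" using coord_facts(3)[OF xy] by (simp add: m_eq)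
  have my: "real (m n) \<le> y * n" for n
  proof -
    have "0 \<le> y * real n" using y by simp
    then show ?thesis unfolding m_def by linarith
  qed
  define U where "U n X = lpp (pw \<alpha> X) (m n) (m n) / real n" for n X
  \<comment> \<open>Being above \<open>l\<close>, the cut leaves the limit unchanged. Being above
    (4y + 5)/r, it exceeds the centring (4 m + 4)/(r n) of the rate-r model, so what lies beyond it
    is part of that model's excess, of order 1/sqrt n after division by n.\<close>
  define K where "K = max (l + 1) ((4 * y + 5) / r)"
  have lim: "AE X in exp_env UNIV. (\<forall>k. 0 \<le> X k) \<and> (\<lambda>n. U n X) \<longlonglongrightarrow> l"
    using \<alpha>Q unfolding Q_def by eventually_elim (simp add: U_def m_eq)
  have Ui: "integrable (exp_env UNIV) (U n)" for n unfolding U_def using integrable_lpp_pw by auto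
  have "(4 * y + 5) / r \<le> K" by (simp add: K_def)
  then have K0: "0 \<le> K" using y r_pos by (smt (verit) divide_nonneg_pos mult_nonneg_nonneg)
  have lim1: "(\<lambda>n. \<integral>X. min K (U n X) \<partial>exp_env UNIV) \<longlonglongrightarrow> l"
  proof -
    have "(\<lambda>n. \<integral>X. min K (U n X) \<partial>exp_env UNIV) \<longlonglongrightarrow> (\<integral>X. l \<partial>exp_env (UNIV :: (int \<times> int) set))"
    proof (rule integral_dominated_convergence[where w = "\<lambda>_. K"])
      show "AE X in exp_env UNIV. (\<lambda>n. min K (U n X)) \<longlonglongrightarrow> l"
        using lim
      proof eventually_elim
        case (elim X)
        from tendsto_min[OF tendsto_const conjunct2[OF elim], of K] show ?case by (simp add: K_def)
      qed
      show "AE X in exp_env UNIV. norm (min K (U n X)) \<le> K" for n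
        using lim
      proof eventually_elim
        case (elim X)
        have "0 \<le> U n X" unfolding U_def using elim \<alpha> by (intro divide_nonneg_nonneg lpp_nonneg pw_nonneg) auto
        then show ?case using K0 by (simp add: min_def)
      qed
      show "(\<lambda>X. min K (U n X)) \<in> borel_measurable (exp_env UNIV)" for n using Ui[of n] by auto
    qed auto
    then show ?thesis using X.prob_space by simp
  qed
  let ?t = "\<lambda>i j. (int i - int j, int j)"
  have excess: "(\<integral>X. U n X \<partial>exp_env UNIV) \<le> (\<integral>X. min K (U n X) \<partial>exp_env UNIV) + 4 / r * (sqrt (real (m n) + 1) / n)" if n: "0 < n" for n
  proof -
    let ?c = "2 * real (m n) + 2 * real (m n) + 4"
    let ?E = "\<lambda>X :: int \<times> int \<Rightarrow> real. max 0 (lpp (\<lambda>i j. X (?t i j)) (m n) (m n) - ?c)"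
    have iE: "integrable (exp_env UNIV) ?E" using integrable_hom_lpp[of ?t "m n" "m n"] by auto
    have "(\<integral>X. ?E X \<partial>exp_env UNIV) = (\<integral>w. max 0 (lpp (\<lambda>i j. w (i, j)) (m n) (m n) - ?c) \<partial>exp_env UNIV)"
      by (rule hom_lpp_reindex[of ?t "\<lambda>x. max 0 (x - ?c)"]) auto
    also have "\<dots> \<le> 2 * sqrt (real (m n) + 1) + 2 * sqrt (real (m n) + 1)"
      using hom_lpp_upper[of "m n" "m n"] by (simp add: add.commute)
    finally have EE: "(\<integral>X. ?E X \<partial>exp_env UNIV) \<le> 4 * sqrt (real (m n) + 1)" by simp
    have "(\<integral>X. U n X \<partial>exp_env UNIV) \<le> (\<integral>X. min K (U n X) + 1 / (r * n) * ?E X \<partial>exp_env UNIV)"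
    proof (rule integral_mono_AE)
      show "integrable (exp_env UNIV) (\<lambda>X. min K (U n X) + 1 / (r * n) * ?E X)" using Ui[of n] iE by auto
      show "AE X in exp_env UNIV. U n X \<le> min K (U n X) + 1 / (r * n) * ?E X"
        using lim
      proof eventually_elim
        case (elim X)
        have "lpp (pw \<alpha> X) (m n) (m n) \<le> lpp (\<lambda>i j. (1 / r) * X (?t i j)) (m n) (m n)"
        proof (rule lpp_mono_weights)
          fix i j
          have "X (?t i j) / \<alpha> (int i - int j) \<le> X (?t i j) / r"
            using elim \<alpha>[of "int i - int j"] r_pos by (intro divide_left_mono mult_pos_pos) auto
          then show "pw \<alpha> X i j \<le> (1 / r) * X (?t i j)" by (simp add: pw_def)
        qed
        also have "\<dots> = (1 / r) * lpp (\<lambda>i j. X (?t i j)) (m n) (m n)" using r_pos by (intro lpp_scale) simp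
        also have "\<dots> \<le> (1 / r) * (?c + ?E X)" using r_pos by (intro mult_left_mono) auto
        finally have "U n X \<le> (1 / r) * (?c + ?E X) / n" unfolding U_def by (intro divide_right_mono) auto
        also have "\<dots> = ?c / (r * n) + 1 / (r * n) * ?E X" by (simp add: add_divide_distrib distrib_left)
        also have "?c / (r * n) \<le> ((4 * y + 5) * n) / (r * n)"
        proof (rule divide_right_mono)
          have "1 \<le> real n" using n by simp
          then show "?c \<le> (4 * y + 5) * n" using my[of n] by (simp add: algebra_simps)
        qed (use r_pos in simp)
        also have "\<dots> = (4 * y + 5) / r" using n by simp
        also have "\<dots> \<le> K" by fact
        finally have "U n X \<le> K + 1 / (r * n) * ?E X" by simp
        moreover have "0 \<le> 1 / (r * n) * ?E X" using r_pos by (intro mult_nonneg_nonneg) auto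
        ultimately show ?case by (simp add: min_def)
      qed
    qed (rule Ui)
    also have "\<dots> = (\<integral>X. min K (U n X) \<partial>exp_env UNIV) + 1 / (r * n) * (\<integral>X. ?E X \<partial>exp_env UNIV)"
      using Ui[of n] iE by (subst Bochner_Integration.integral_add) auto
    also have "1 / (r * n) * (\<integral>X. ?E X \<partial>exp_env UNIV) \<le> 1 / (r * n) * (4 * sqrt (real (m n) + 1))"
      using EE r_pos by (intro mult_left_mono) auto
    finally show ?thesis by simp
  qed
  have below: "(real (m n) / n - real N * (1 / n)) * ((4 - e) / (r + e)) \<le> (\<integral>X. U n X \<partial>exp_env UNIV)" if n: "0 < n" for n
  proof -
    \<comment> \<open>Whole blocks of side N below \<open>m n\<close>; the incomplete one costs at
      most N, which vanishes after division by n.\<close>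
    define k where "k = m n div N"
    have "m n < (k + 1) * N" using N(1) unfolding k_def by (metis Suc_eq_plus1 div_less_iff_less_mult lessI)
    then have "real (m n) < real ((k + 1) * N)" by (rule of_nat_less_iff[THEN iffD2])
    then have kN: "real (m n) - N \<le> real k * N" by (simp add: algebra_simps)
    have pos: "0 \<le> (4 - e) / (r + e)" using e r_pos by auto
    have "(real (m n) - N) * ((4 - e) / (r + e)) \<le> (real k * N) * ((4 - e) / (r + e))"
      using kN pos by (rule mult_right_mono)
    also have "\<dots> = real k * ((4 - e) * N / (r + e))" by simp
    also have "\<dots> \<le> real k * ((\<integral>w. lpp (\<lambda>i j. w (i, j)) N N \<partial>exp_env UNIV) / (r + e))"
      using N(2) r_pos e by (intro mult_left_mono divide_right_mono) auto
    also have "\<dots> \<le> (\<integral>X. lpp (pw \<alpha> X) (k * N) (k * N) \<partial>exp_env UNIV)"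
      by (rule diagonal_chain[OF \<alpha> slow])
    also have "\<dots> \<le> (\<integral>X. lpp (pw \<alpha> X) (m n) (m n) \<partial>exp_env UNIV)"
    proof (rule integral_mono_AE)
      show "AE X in exp_env UNIV. lpp (pw \<alpha> X) (k * N) (k * N) \<le> lpp (pw \<alpha> X) (m n) (m n)"
        using lim
      proof eventually_elim
        case (elim X)
        then show ?case using \<alpha> by (intro lpp_mono pw_nonneg) (auto simp: k_def)
      qed
    qed (rule integrable_lpp_pw)+
    finally have "(real (m n) - N) * ((4 - e) / (r + e)) / n \<le> (\<integral>X. lpp (pw \<alpha> X) (m n) (m n) \<partial>exp_env UNIV) / n"
      by (rule divide_right_mono) simp
    moreover have "(\<integral>X. U n X \<partial>exp_env UNIV) = (\<integral>X. lpp (pw \<alpha> X) (m n) (m n) \<partial>exp_env UNIV) / n" by (simp add: U_def)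
    moreover have "(real (m n) / n - real N * (1 / n)) * ((4 - e) / (r + e)) = (real (m n) - N) * ((4 - e) / (r + e)) / n"
      by (simp add: diff_divide_distrib[symmetric])
    ultimately show ?thesis by presburger
  qed
  have L1: "(\<lambda>n. (real (m n) / n - real N * (1 / n)) * ((4 - e) / (r + e))) \<longlonglongrightarrow> (y - real N * 0) * ((4 - e) / (r + e))"
    by (intro tendsto_intros mlim lim_1_over_n)
  have L2: "(\<lambda>n. (\<integral>X. min K (U n X) \<partial>exp_env UNIV) + 4 / r * (sqrt (real (m n) + 1) / n)) \<longlonglongrightarrow> l + 4 / r * 0"
    by (intro tendsto_intros lim1 sqrt_div_tendsto_0[OF mlim])
  have "(y - real N * 0) * ((4 - e) / (r + e)) \<le> l + 4 / r * 0"
  proof (rule tendsto_le[OF _ L2 L1])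
    show "\<forall>\<^sub>F n in sequentially. (real (m n) / n - real N * (1 / n)) * ((4 - e) / (r + e)) \<le> (\<integral>X. min K (U n X) \<partial>exp_env UNIV) + 4 / r * (sqrt (real (m n) + 1) / n)"
      using eventually_gt_at_top[of "0::nat"]
    proof eventually_elim
      case (elim n)
      show ?case using below[OF elim] excess[OF elim] by linarith
    qed
  qed simp
  then show ?thesis by (simp add: l_def)
qed

lemma time_constant_lower:
  assumes y: "0 < y" and mass: "\<And>s. r < s \<Longrightarrow> 0 < measure L {..<s}"
  shows "4 * y / r \<le> lpp_tau L 0 y"
proof -
  have "(\<lambda>n. y * (4 - 1 / real (Suc n)) / (r + 1 / real (Suc n))) \<longlonglongrightarrow> y * (4 - 0) / (r + 0)"
    by (intro tendsto_intros LIMSEQ_Suc[OF lim_1_over_n]) (use r_pos in auto)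
  then have "y * (4 - 0) / (r + 0) \<le> lpp_tau L 0 y"
  proof (rule tendsto_upperbound)
    show "\<forall>\<^sub>F n in sequentially. y * (4 - 1 / real (Suc n)) / (r + 1 / real (Suc n)) \<le> lpp_tau L 0 y"
    proof (rule always_eventually, rule allI)
      fix n :: nat
      have "1 / real (Suc n) < 4" by (simp add: field_simps)
      then show "y * (4 - 1 / real (Suc n)) / (r + 1 / real (Suc n)) \<le> lpp_tau L 0 y"
        by (intro time_constant_lower_eps y mass) auto
    qed
  qed simp
  then show ?thesis by (simp add: mult.commute)
qed

section \<open>The flux on the plateau\<close>

text \<open>Monotonicity is in the quadrant coordinates (x + y, y). Strict inequalities survive
  rounding, so the lattice points are eventually ordered.\<close>

lemma time_constant_mono:
  assumes "0 \<le> y" "0 < x + y" "0 \<le> y'" "0 < x' + y'" and less: "y' < y" "x' + y' < x + y"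
  shows "lpp_tau L x' y' \<le> lpp_tau L x y"
proof -
  note c = coord_facts[OF assms(1,2)] and c' = coord_facts[OF assms(3,4)]
  have less_ev: "\<forall>\<^sub>F n in sequentially. u' n \<le> u n"
    if lim: "(\<lambda>n. real (u' n) / n) \<longlonglongrightarrow> t'" "(\<lambda>n. real (u n) / n) \<longlonglongrightarrow> t" "t' < t" for u u' :: "nat \<Rightarrow> nat" and t t'
  proof -
    obtain s where s: "t' < s" "s < t" using dense[OF lim(3)] by blast
    show ?thesis
      using order_tendstoD(2)[OF lim(1) s(1)] order_tendstoD(1)[OF lim(2) s(2)] eventually_gt_at_top[of "0::nat"]
    proof eventually_elim
      case (elim n)
      then have "real (u' n) / n < real (u n) / n" by linarith
      then show ?case using elim by (simp add: divide_less_cancel)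
    qed
  qed
  have "AE w in env. lpp_tau L x' y' \<le> lpp_tau L x y"
    using time_constant(1)[OF assms(1,2)] time_constant(1)[OF assms(3,4)]
  proof eventually_elim
    case (elim w)
    show ?case
    proof (rule tendsto_le[OF _ elim])
      show "\<forall>\<^sub>F n in sequentially. lpp (wt w) (coord_a x' y' n) (coord_b y' n) / n \<le> lpp (wt w) (coord_a x y n) (coord_b y n) / n"
        using less_ev[OF c'(2) c(2) less(2)] less_ev[OF c'(3) c(3) less(1)]
        by eventually_elim (intro divide_right_mono lpp_mono wt_nonneg, auto)
    qed simp
  qed
  then show ?thesis by (rule AE_prob_const[OF prob_env])
qed

lemma flux_plateau:
  fixes \<rho> :: real
  assumes mass: "\<And>s. r < s \<Longrightarrow> 0 < measure L {..<s}"
  defines "\<mu> \<equiv> 1 / r - (\<integral>a. 1 / a \<partial>L)"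
  assumes \<rho>: "1/2 - 1/4 * \<mu> * r \<le> \<rho>" "\<rho> \<le> 1/2 + 1/4 * \<mu> * r"
  shows "flux L \<rho> = r / 4"
proof -
  define S where "S v = {y. 0 \<le> y \<and> 0 < v + y \<and> 1 < lpp_tau L v y}" for v
  have k: "lpp_k L v = Inf (S v)" for v by (simp add: lpp_k_def lpp_h_def S_def)
  have large: "1 < lpp_tau L 0 y" if "r / 4 < y" for y
  proof -
    have "1 < 4 * y / r" using that r_pos by (simp add: field_simps)
    also have "\<dots> \<le> lpp_tau L 0 y" using that r_pos by (intro time_constant_lower mass) auto
    finally show ?thesis .
  qed
  \<comment> \<open>An infimum over the empty set would be unspecified. The witness lies beyond the
    diagonal point (0, r/2) in both quadrant coordinates, and that point has time constant above
    1.\<close>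
  have ne: "S v \<noteq> {}" for v
  proof -
    have "1 < lpp_tau L 0 (r / 2)" using r_pos by (intro large) auto
    also have "\<dots> \<le> lpp_tau L v (r / 2 + \<bar>v\<bar> + 1)" using r_pos by (intro time_constant_mono) auto
    finally have "r / 2 + \<bar>v\<bar> + 1 \<in> S v" using r_pos by (auto simp: S_def)
    then show ?thesis by blast
  qed
  have lower: "r / 4 - v * \<rho> \<le> y" if y: "y \<in> S v" for v y
  proof -
    have "1 < (4 * y + 2 * v) / r - \<bar>v\<bar> * \<mu>"
      using y time_constant_upper[of y v] unfolding S_def \<mu>_def by auto
    then have "(1 + \<bar>v\<bar> * \<mu>) * r < ((4 * y + 2 * v) / r) * r" using r_pos by (intro mult_strict_right_mono) auto
    moreover have "(1 + \<bar>v\<bar> * \<mu>) * r = r + \<bar>v\<bar> * (\<mu> * r)" by (simp add: algebra_simps)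
    moreover have "((4 * y + 2 * v) / r) * r = 4 * y + 2 * v" using r_pos by simp
    ultimately have "r + \<bar>v\<bar> * (\<mu> * r) < 4 * y + 2 * v" by linarith
    \<comment> \<open>Where the interval comes from: v (1/2 - \<rho>) <= |v| \<mu> r / 4 holds for
      both signs of v exactly when |\<rho> - 1/2| <= \<mu> r / 4.\<close>
    moreover have "v / 2 - \<bar>v\<bar> * (\<mu> * r) / 4 \<le> v * \<rho>"
    proof (cases "0 \<le> v")
      case True
      have "v * (1/2 - 1/4 * \<mu> * r) \<le> v * \<rho>" by (rule mult_left_mono[OF \<rho>(1) True])
      then show ?thesis using True by (simp add: algebra_simps)
    next
      case False
      then have "v * (1/2 + 1/4 * \<mu> * r) \<le> v * \<rho>" using \<rho>(2) by (intro mult_left_mono_neg) auto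
      then show ?thesis using False by (simp add: algebra_simps)
    qed
    ultimately show ?thesis by linarith
  qed
  have ge: "r / 4 \<le> lpp_k L v + v * \<rho>" for v
  proof -
    have "r / 4 - v * \<rho> \<le> lpp_k L v" unfolding k by (rule cInf_greatest[OF ne lower])
    then show ?thesis by linarith
  qed
  \<comment> \<open>The direction v = 0 attains the minimum for every \<rho> in the interval, since
    its contribution does not involve \<rho>. The uniform bound \<open>ge\<close> also makes the
    infimum a genuine one.\<close>
  have "flux L \<rho> \<le> lpp_k L 0 + 0 * \<rho>"
    unfolding flux_def by (rule cINF_lower) (use ge in \<open>auto intro!: bdd_belowI[of _ "r / 4"]\<close>)
  also have "\<dots> \<le> r / 4"
  proof (rule dense_ge)
    fix y assume "r / 4 < y"
    then have "y \<in> S 0" using large[of y] r_pos by (auto simp: S_def)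
    moreover have "bdd_below (S 0)" by (rule bdd_belowI[of _ 0]) (simp add: S_def)
    ultimately show "lpp_k L 0 + 0 * \<rho> \<le> y" unfolding k by (simp add: cInf_lower)
  qed
  finally have "flux L \<rho> \<le> r / 4" .
  moreover have "r / 4 \<le> flux L \<rho>" unfolding flux_def by (rule cINF_greatest) (use ge in auto)
  ultimately show ?thesis by simp
qed

end

section \<open>The essential infimum of the law\<close>

text \<open>Positivity bounds the defining set from below, and continuity of the measure from above
  makes it nonempty, so \<open>Inf\<close> is a true infimum. The almost sure bound is reached
  through the levels below it at distance 1/(n + 1); mass near it comes from elements of the set
  just above.\<close>

lemma law_ess_inf_facts:
  assumes "prob_space L" "sets L = sets borel" "AE a in L. 0 < a"
  shows "AE a in L. law_ess_inf L \<le> a" "\<And>s. law_ess_inf L < s \<Longrightarrow> 0 < measure L {..<s}"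
proof -
  interpret prob_space L by fact
  have spL: "space L = UNIV" using sets_eq_imp_space_eq[OF assms(2)] by simp
  have sL [simp]: "{x. s \<le> x} \<in> sets L" "{..<s} \<in> sets L" for s :: real
    using assms(2) by (auto simp flip: atLeast_def)
  define S where "S = {s. measure L {x. s \<le> x} < 1}"
  have r: "law_ess_inf L = Inf S" by (simp add: law_ess_inf_def S_def)
  have full: "(AE a in L. s \<le> a) \<longleftrightarrow> measure L {x. s \<le> x} = 1" for s
    using prob_eq_1[OF sL(1)[of s]] by simp
  have pos: "0 < s" if "s \<in> S" for s
  proof (rule ccontr)
    assume "\<not> 0 < s"
    then have "AE a in L. s \<le> a" using assms(3) by (auto elim: eventually_mono)
    then show False using that full[of s] by (simp add: S_def)
  qed
  then have bdd: "bdd_below S" by (intro bdd_belowI[of _ 0]) (simp add: less_imp_le)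
  have below: "AE a in L. s \<le> a" if "s < law_ess_inf L" for s
  proof -
    have "s \<notin> S" using that cInf_lower[OF _ bdd, of s] unfolding r by force
    then have "1 \<le> measure L {x. s \<le> x}" by (simp add: S_def not_less)
    then have "measure L {x. s \<le> x} = 1" using prob_le_1[of "{x. s \<le> x}"] by linarith
    then show ?thesis using full by simp
  qed
  have "AE a in L. law_ess_inf L - 1 / real (Suc n) \<le> a" for n by (rule below) simp
  then have "AE a in L. \<forall>n. law_ess_inf L - 1 / real (Suc n) \<le> a" by (simp add: AE_all_countable)
  then show "AE a in L. law_ess_inf L \<le> a"
  proof eventually_elim
    case (elim a)
    have "(\<lambda>n. law_ess_inf L - 1 / real (Suc n)) \<longlonglongrightarrow> law_ess_inf L - 0"
      by (intro tendsto_intros LIMSEQ_Suc[OF lim_1_over_n])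
    from tendsto_upperbound[OF this, of a] elim show ?case by simp
  qed
  have "S \<noteq> {}"
  proof -
    have "(\<lambda>n. prob {x. real n \<le> x}) \<longlonglongrightarrow> prob (\<Inter>n. {x. real n \<le> x})"
      by (rule finite_Lim_measure_decseq) (auto simp: decseq_def)
    moreover have "(\<Inter>n. {x. real n \<le> x}) = {}"
    proof (rule equals0I)
      fix x :: real assume x: "x \<in> (\<Inter>n. {x. real n \<le> x})"
      obtain n where "x < real n" using reals_Archimedean2 by blast
      moreover have "real n \<le> x" using x by blast
      ultimately show False by simp
    qed
    ultimately have "(\<lambda>n. prob {x. real n \<le> x}) \<longlonglongrightarrow> 0" by simp
    from order_tendstoD(2)[OF this, of 1] obtain n where "prob {x. real n \<le> x} < 1"
      by (auto simp: eventually_sequentially)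
    then show ?thesis by (auto simp: S_def)
  qed
  fix s assume "law_ess_inf L < s"
  then obtain s' where s': "s' \<in> S" "s' < s" unfolding r using cInf_lessD[OF \<open>S \<noteq> {}\<close>] by blast
  have "measure L {x. s \<le> x} \<le> measure L {x. s' \<le> x}" using s'(2) by (intro finite_measure_mono) auto
  then have "measure L {x. s \<le> x} < 1" using s'(1) by (simp add: S_def)
  moreover have "measure L {..<s} = 1 - measure L {x. s \<le> x}"
  proof -
    have "{..<s} = space L - {x. s \<le> x}" by (auto simp: spL)
    then show ?thesis using prob_compl[OF sL(1)[of s]] by simp
  qed
  ultimately show "0 < measure L {..<s}" by simp
qed

theorem mainTheorem1:
  fixes L :: "real measure" and \<rho> :: real
  assumes "prob_space L"
    and "sets L = sets borel"
    and "AE a in L. 0 < a"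
    and "\<forall>c. measure L {c} < 1"
    and "0 < law_ess_inf L"
    and "1/2 - 1/4 * (1 / law_ess_inf L - (\<integral>a. 1 / a \<partial>L)) * law_ess_inf L \<le> \<rho>"
    and "\<rho> \<le> 1/2 + 1/4 * (1 / law_ess_inf L - (\<integral>a. 1 / a \<partial>L)) * law_ess_inf L"
  shows "flux L \<rho> = law_ess_inf L / 4"
proof -
  interpret disorder_law L "law_ess_inf L"
    by (rule disorder_law.intro[OF assms(1,2,5) law_ess_inf_facts(1)[OF assms(1-3)]])
  show ?thesis
    by (rule flux_plateau[OF law_ess_inf_facts(2)[OF assms(1-3)] assms(6,7)])
qed
end
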